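(* Let $R$ be a commutative ring. Let $\mathbf{DirGr}$ be the category of finite (unbased) digraphs and inclusions, let $\mathbf{Alg}$ be the category of unital (possibly non-commutative) $R$-algebras and their homomorphisms, and let $\mathbf{GrMod}$ be the category of $\mathbb{Z}$-graded $R$-modules. Then $$\mathcal{H}_*(-,-)\colon\mathbf{DirGr}\times\mathbf{Alg}\to\mathbf{GrMod},\qquad(\Gamma,A)\mapsto\mathcal{H}_*(\Gamma,A),$$ with the induced maps on digraph inclusions and algebra homomorphisms described in the context, is a bifunctor (covariant in both variables).
   Context: All tensor products are over the commutative ring $R$; empty tensor products are $R$. Algebra homomorphisms preserve units. Digraphs. A digraph $\Gamma$ has tail and head functions $t,h\colon Edge(\Gamma)\to Vert(\Gamma)$; it is finite if its vertex and edge sets are finite. An inclusion of digraphs is a map injective on vertices and on edges, compatible with $t$ and $h$. Path poset. A simple path in $\Gamma$ is a sequence of edges $e_1,\dots,e_r$ with $h(e_i)=t(e_{i+1})$ in which no vertex is encountered twice (in particular it is not closed). A multipath is a collection of (vertex-)disjoint simple paths, regarded as a set of edges; the empty multipath is allowed. $P(\Gamma)$ is the poset of multipaths of $\Gamma$ ordered by inclusion of edge sets, viewed as a category with a unique morphism $x\to y$ whenever $x\le y$. Write $x\prec y$ if $x<y$ and there is no $z$ with $x<z<y$; then $y$ has exactly one more edge than $x$. An inclusion $f\colon\Gamma'\to\Gamma$ induces a poset map $\tilde f\colon P(\Gamma')\to P(\Gamma)$. Homology. For a covariant functor $\mathcal{F}\colon P(\Gamma)\to R\text{-}\mathbf{Mod}$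 let $\mathcal{S}_k(\Gamma;\mathcal{F})=\bigoplus_{x_0\le x_1\le\cdots\le x_k}\mathcal{F}(x_0)$, with elements written as sums of $\lambda x_0x_1\ldots x_k$, $\lambda\in\mathcal{F}(x_0)$, and differential $$d(\lambda x_0\ldots x_k)=\mathcal{F}(x_0\le x_1)(\lambda)\,x_1\ldots x_k+\sum_{i=1}^k(-1)^i\lambda x_0\ldots\widehat{x_i}\ldots x_k .$$ $H_*(\Gamma;\mathcal{F})$ is the homology of this chain complex. The functor $\mathcal{F}_{A,A}$. For $x\in P(\Gamma)$ let $\Gamma_x$ be the digraph with the vertex set of $\Gamma$ and edge set $x$, and $\pi_0(\Gamma_x)$ its set of connected components. Put $\mathcal{F}_{A,A}(x)=\bigotimes_{\alpha\in\pi_0(\Gamma_x)}A$ (unordered tensor product). If $x\prec y$ and $e$ is the additional edge of $y$, then $e$ joins two distinct components of $\Gamma_x$, and $\mathcal{F}_{A,A}(x\prec y)$ is the identity on the tensor factors of the components not involved, while on the two fusing factors it is the multiplication $a\otimes b\mapsto ab$, where $a$ is in the factor of the component containing $t(e)$ and $b$ is in the factor of the component containing $h(e)$. For general $x\le y$, $\mathcal{F}_{A,A}(x\le y)$ is the composite along any chain $x\prec x_1\prec\cdots\prec x_l\prec y$ (independent of the chain; the identity if $x=y$). This is a covariant functor $P(\Gamma)\to R\text{-}\mathbf{Mod}$, and $$\mathcal{H}_*(\Gamma,A):=H_*(\Gamma;\mathcal{F}_{A,A}).$$ Induced maps. (1) Let $f\colon\Gamma'\to\Gamma$ be an inclusion,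 let $\mathcal{F}'_{A,A}$ denote the functor for $\Gamma'$, and let $W$ be the set of vertices of $\Gamma$ not in the image of $\Gamma'$. For $x\in P(\Gamma')$ there is an identification $\mathcal{F}_{A,A}(\tilde f(x))\cong\mathcal{F}'_{A,A}(x)\otimes\bigotimes_{W}A$, and $\tau_x\colon\mathcal{F}'_{A,A}(x)\to\mathcal{F}_{A,A}(\tilde f(x))$ is $\lambda\mapsto\lambda\otimes\bigotimes_W1$. The map $\mathcal{H}_*(\Gamma',A)\to\mathcal{H}_*(\Gamma,A)$ induced by $f$ is the one induced by the chain map $\lambda x_0\ldots x_k\mapsto\tau_{x_0}(\lambda)\,\tilde f(x_0)\ldots\tilde f(x_k)$. (2) Let $\varphi\colon A\to B$ be an algebra homomorphism. The map $\mathcal{H}_*(\Gamma,A)\to\mathcal{H}_*(\Gamma,B)$ induced by $\varphi$ is the one induced by the chain map $\lambda x_0\ldots x_k\mapsto\sigma_{x_0}(\lambda)x_0\ldots x_k$, where $\sigma_x=\bigotimes_{\pi_0(\Gamma_x)}\varphi\colon\mathcal{F}_{A,A}(x)\to\mathcal{F}_{B,B}(x)$. *)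

theory Defs
  imports "HOL-Algebra.Module" "HOL-Algebra.AbelCoset" "Graph_Theory.Arc_Walk"
begin

section \<open>Categories and functors\<close>

record ('o, 'm) category =
  Obj :: "'o set"
  Arr :: "'m set"
  Dom :: "'m \<Rightarrow> 'o"
  Cod :: "'m \<Rightarrow> 'o"
  Ide :: "'o \<Rightarrow> 'm"
  Comp :: "'m \<Rightarrow> 'm \<Rightarrow> 'm"

text \<open>\<open>Comp C g f\<close> is \<open>g\<close> after \<open>f\<close>.\<close>

locale category =
  fixes C :: "('o, 'm) category"
  assumes Dom_in_Obj: "f \<in> Arr C \<Longrightarrow> Dom C f \<in> Obj C"
    and Cod_in_Obj: "f \<in> Arr C \<Longrightarrow> Cod C f \<in> Obj C"
    and Ide_in_Arr: "x \<in> Obj C \<Longrightarrow> Ide C x \<in> Arr C"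
    and Dom_Ide: "x \<in> Obj C \<Longrightarrow> Dom C (Ide C x) = x"
    and Cod_Ide: "x \<in> Obj C \<Longrightarrow> Cod C (Ide C x) = x"
    and Comp_in_Arr: "\<lbrakk>f \<in> Arr C; g \<in> Arr C; Cod C f = Dom C g\<rbrakk> \<Longrightarrow> Comp C g f \<in> Arr C"
    and Dom_Comp: "\<lbrakk>f \<in> Arr C; g \<in> Arr C; Cod C f = Dom C g\<rbrakk> \<Longrightarrow> Dom C (Comp C g f) = Dom C f"
    and Cod_Comp: "\<lbrakk>f \<in> Arr C; g \<in> Arr C; Cod C f = Dom C g\<rbrakk> \<Longrightarrow> Cod C (Comp C g f) = Cod C g"
    and Comp_Ide_right: "f \<in> Arr C \<Longrightarrow> Comp C f (Ide C (Dom C f)) = f"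
    and Comp_Ide_left: "f \<in> Arr C \<Longrightarrow> Comp C (Ide C (Cod C f)) f = f"
    and Comp_assoc: "\<lbrakk>f \<in> Arr C; g \<in> Arr C; h \<in> Arr C; Cod C f = Dom C g; Cod C g = Dom C h\<rbrakk>
      \<Longrightarrow> Comp C h (Comp C g f) = Comp C (Comp C h g) f"

definition product_category ::
  "('o, 'm) category \<Rightarrow> ('p, 'n) category \<Rightarrow> ('o \<times> 'p, 'm \<times> 'n) category"
  where "product_category C D = \<lparr>
    Obj = Obj C \<times> Obj D,
    Arr = Arr C \<times> Arr D,
    Dom = map_prod (Dom C) (Dom D),
    Cod = map_prod (Cod C) (Cod D),
    Ide = map_prod (Ide C) (Ide D),
    Comp = (\<lambda>(g, g') (f, f'). (Comp C g f, Comp D g' f'))\<rparr>"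

locale covariant_functor = C: category C + D: category D
  for C :: "('o, 'm) category" and D :: "('p, 'n) category" +
  fixes Fo :: "'o \<Rightarrow> 'p" and Fa :: "'m \<Rightarrow> 'n"
  assumes Fo_in_Obj: "x \<in> Obj C \<Longrightarrow> Fo x \<in> Obj D"
    and Fa_in_Arr: "f \<in> Arr C \<Longrightarrow> Fa f \<in> Arr D"
    and Dom_Fa: "f \<in> Arr C \<Longrightarrow> Dom D (Fa f) = Fo (Dom C f)"
    and Cod_Fa: "f \<in> Arr C \<Longrightarrow> Cod D (Fa f) = Fo (Cod C f)"
    and Fa_Ide: "x \<in> Obj C \<Longrightarrow> Fa (Ide C x) = Ide D (Fo x)"
    and Fa_Comp: "\<lbrakk>f \<in> Arr C; g \<in> Arr C; Cod C f = Dom C g\<rbrakk>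
      \<Longrightarrow> Fa (Comp C g f) = Comp D (Fa g) (Fa f)"

text \<open>
  A bifunctor is a functor on the product category. Given are its values on objects and on the
  arrows \<open>(f, id\<^sub>y)\<close> and \<open>(id\<^sub>x, g)\<close>; as \<open>(f, g)\<close> is a composite of such arrows, the
  functor is determined by these.
\<close>

definition bifunctor ::
  "('o, 'm) category \<Rightarrow> ('p, 'n) category \<Rightarrow> ('q, 'l) category
    \<Rightarrow> ('o \<Rightarrow> 'p \<Rightarrow> 'q) \<Rightarrow> ('m \<Rightarrow> 'p \<Rightarrow> 'l) \<Rightarrow> ('o \<Rightarrow> 'n \<Rightarrow> 'l) \<Rightarrow> bool"
  where "bifunctor C D E Fo F1 F2 \<longleftrightarrow>
    (\<exists>Fa. covariant_functor (product_category C D) E (\<lambda>(x, y). Fo x y) Fa \<and>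
      (\<forall>f\<in>Arr C. \<forall>y\<in>Obj D. Fa (f, Ide D y) = F1 f y) \<and>
      (\<forall>x\<in>Obj C. \<forall>g\<in>Arr D. Fa (Ide C x, g) = F2 x g))"


section \<open>Modules and tensor products\<close>

text \<open>
  The record type \<open>module\<close> extends that of rings, but the locale \<open>module\<close> does not constrain the
  fields \<open>mult\<close> and \<open>one\<close>; they are left undefined for modules that are not algebras.
  Maps between modules are taken to be extensional, so that a map is determined by its values
  on the carrier.
\<close>

definition linear_maps ::
  "('r, 'z) ring_scheme \<Rightarrow> ('r, 'a) module \<Rightarrow> ('r, 'b) module \<Rightarrow> ('a \<Rightarrow> 'b) set"
  where "linear_maps R M N = {f \<in> hom (add_monoid M) (add_monoid N) \<inter> extensional (carrier M).
    \<forall>r\<in>carrier R. \<forall>x\<in>carrier M. f (r \<odot>\<^bsub>M\<^esub> x) = r \<odot>\<^bsub>N\<^esub> f x}"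

definition generated_submodule ::
  "('r, 'z) ring_scheme \<Rightarrow> ('r, 'a) module \<Rightarrow> 'a set \<Rightarrow> 'a set"
  where "generated_submodule R M S = \<Inter>{N. submodule N R M \<and> S \<subseteq> N}"

definition quotient_module :: "('r, 'a) module \<Rightarrow> 'a set \<Rightarrow> ('r, 'a set) module"
  where "quotient_module M N = \<lparr>
    carrier = a_rcosets\<^bsub>M\<^esub> N,
    mult = undefined,
    one = undefined,
    zero = N,
    add = set_add M,
    smult = (\<lambda>r X. \<Union>x\<in>X. N +>\<^bsub>M\<^esub> (r \<odot>\<^bsub>M\<^esub> x))\<rparr>"

definition direct_sum :: "'j set \<Rightarrow> ('j \<Rightarrow> ('r, 'a) module) \<Rightarrow> ('r, 'j \<Rightarrow> 'a) module"
  where "direct_sum J M = \<lparr>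
    carrier = {c \<in> (\<Pi>\<^sub>E j\<in>J. carrier (M j)). finite {j \<in> J. c j \<noteq> \<zero>\<^bsub>M j\<^esub>}},
    mult = undefined,
    one = undefined,
    zero = (\<lambda>j\<in>J. \<zero>\<^bsub>M j\<^esub>),
    add = (\<lambda>c c'. \<lambda>j\<in>J. c j \<oplus>\<^bsub>M j\<^esub> c' j),
    smult = (\<lambda>r c. \<lambda>j\<in>J. r \<odot>\<^bsub>M j\<^esub> c j)\<rparr>"

definition summand :: "'j set \<Rightarrow> ('j \<Rightarrow> ('r, 'a) module) \<Rightarrow> 'j \<Rightarrow> 'a \<Rightarrow> 'j \<Rightarrow> 'a"
  where "summand J M j x = (\<lambda>i\<in>J. if i = j then x else \<zero>\<^bsub>M i\<^esub>)"

definition regular_module :: "('r, 'z) ring_scheme \<Rightarrow> ('r, 'r) module"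
  where "regular_module R = \<lparr>carrier = carrier R, mult = mult R, one = one R,
    zero = zero R, add = add R, smult = mult R\<rparr>"

definition free_module :: "('r, 'z) ring_scheme \<Rightarrow> 'j set \<Rightarrow> ('r, 'j \<Rightarrow> 'r) module"
  where "free_module R J = direct_sum J (\<lambda>_. regular_module R)"

definition basis_element :: "('r, 'z) ring_scheme \<Rightarrow> 'j set \<Rightarrow> 'j \<Rightarrow> 'j \<Rightarrow> 'r"
  where "basis_element R J j = summand J (\<lambda>_. regular_module R) j \<one>\<^bsub>R\<^esub>"

text \<open>
  The unordered tensor product of the modules \<open>M i\<close>, \<open>i \<in> I\<close>, is the quotient of the free module
  on the families \<open>a \<in> (\<Pi>\<^sub>E i\<in>I. carrier (M i))\<close> by the relations of multilinearity. For empty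
  \<open>I\<close> there is one family and there are no relations, so the result is a copy of \<open>R\<close>.
\<close>

definition tensor_relations ::
  "('r, 'z) ring_scheme \<Rightarrow> 'i set \<Rightarrow> ('i \<Rightarrow> ('r, 'a) module) \<Rightarrow> (('i \<Rightarrow> 'a) \<Rightarrow> 'r) set"
  where "tensor_relations R I M =
    (let X = (\<Pi>\<^sub>E i\<in>I. carrier (M i)); L = free_module R X; \<delta> = basis_element R X in
      {\<delta> (a(i := x \<oplus>\<^bsub>M i\<^esub> y)) \<ominus>\<^bsub>L\<^esub> (\<delta> (a(i := x)) \<oplus>\<^bsub>L\<^esub> \<delta> (a(i := y))) | a i x y.
         a \<in> X \<and> i \<in> I \<and> x \<in> carrier (M i) \<and> y \<in> carrier (M i)}
      \<union> {\<delta> (a(i := r \<odot>\<^bsub>M i\<^esub> x)) \<ominus>\<^bsub>L\<^esub> (r \<odot>\<^bsub>L\<^esub> \<delta> (a(i := x))) | a i r x.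
         a \<in> X \<and> i \<in> I \<and> r \<in> carrier R \<and> x \<in> carrier (M i)})"

definition tensor_null ::
  "('r, 'z) ring_scheme \<Rightarrow> 'i set \<Rightarrow> ('i \<Rightarrow> ('r, 'a) module) \<Rightarrow> (('i \<Rightarrow> 'a) \<Rightarrow> 'r) set"
  where "tensor_null R I M =
    generated_submodule R (free_module R (\<Pi>\<^sub>E i\<in>I. carrier (M i))) (tensor_relations R I M)"

definition tensor_product ::
  "('r, 'z) ring_scheme \<Rightarrow> 'i set \<Rightarrow> ('i \<Rightarrow> ('r, 'a) module) \<Rightarrow> ('r, (('i \<Rightarrow> 'a) \<Rightarrow> 'r) set) module"
  where "tensor_product R I M =
    quotient_module (free_module R (\<Pi>\<^sub>E i\<in>I. carrier (M i))) (tensor_null R I M)"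

definition pure_tensor ::
  "('r, 'z) ring_scheme \<Rightarrow> 'i set \<Rightarrow> ('i \<Rightarrow> ('r, 'a) module) \<Rightarrow> ('i \<Rightarrow> 'a) \<Rightarrow> (('i \<Rightarrow> 'a) \<Rightarrow> 'r) set"
  where "pure_tensor R I M a =
    tensor_null R I M +>\<^bsub>free_module R (\<Pi>\<^sub>E i\<in>I. carrier (M i))\<^esub>
      basis_element R (\<Pi>\<^sub>E i\<in>I. carrier (M i)) a"

text \<open>The linear map with prescribed values \<open>u a\<close> on pure tensors, for multilinear \<open>u\<close>.\<close>

definition tensor_lift ::
  "('r, 'z) ring_scheme \<Rightarrow> 'i set \<Rightarrow> ('i \<Rightarrow> ('r, 'a) module) \<Rightarrow> ('r, 'b) module
    \<Rightarrow> (('i \<Rightarrow> 'a) \<Rightarrow> 'b) \<Rightarrow> (('i \<Rightarrow> 'a) \<Rightarrow> 'r) set \<Rightarrow> 'b"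
  where "tensor_lift R I M N u = (THE g. g \<in> linear_maps R (tensor_product R I M) N \<and>
    (\<forall>a \<in> (\<Pi>\<^sub>E i\<in>I. carrier (M i)). g (pure_tensor R I M a) = u a))"


section \<open>Homology of a poset with coefficients in a functor\<close>

text \<open>
  The poset is a subset \<open>P\<close> of an ordered type. A functor on it is given by the modules
  \<open>Fo x\<close> and the maps \<open>Fm x y\<close> for \<open>x \<le> y\<close>. Everything is indexed by the integers; there are no
  simplices in negative degrees, so the chain modules vanish there.
\<close>

definition simplices :: "'p::order set \<Rightarrow> int \<Rightarrow> 'p list set"
  where "simplices P k =
    {xs. xs \<noteq> [] \<and> int (length xs) = k + 1 \<and> set xs \<subseteq> P \<and> sorted_wrt (\<le>) xs}"

definition chain_module ::
  "'p::order set \<Rightarrow> ('p \<Rightarrow> ('r, 'm) module) \<Rightarrow> int \<Rightarrow> ('r, 'p list \<Rightarrow> 'm) module"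
  where "chain_module P Fo k = direct_sum (simplices P k) (\<lambda>xs. Fo (hd xs))"

text \<open>The chain \<open>\<lambda> x\<^sub>0 \<dots> x\<^sub>k\<close>, with \<open>v\<close> for the coefficient.\<close>

definition elementary_chain ::
  "'p::order set \<Rightarrow> ('p \<Rightarrow> ('r, 'm) module) \<Rightarrow> int \<Rightarrow> 'm \<Rightarrow> 'p list \<Rightarrow> 'p list \<Rightarrow> 'm"
  where "elementary_chain P Fo k v xs = summand (simplices P k) (\<lambda>xs. Fo (hd xs)) xs v"

text \<open>The linear extension to all of \<open>chain_module P Fo k\<close> of a map given on elementary chains.\<close>

definition extend_linearly ::
  "'p::order set \<Rightarrow> ('p \<Rightarrow> ('r, 'm) module) \<Rightarrow> int \<Rightarrow> ('r, 'n) module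
    \<Rightarrow> ('m \<Rightarrow> 'p list \<Rightarrow> 'n) \<Rightarrow> ('p list \<Rightarrow> 'm) \<Rightarrow> 'n"
  where "extend_linearly P Fo k N u = (\<lambda>c \<in> carrier (chain_module P Fo k).
    \<Oplus>\<^bsub>N\<^esub>xs \<in> {xs \<in> simplices P k. c xs \<noteq> \<zero>\<^bsub>Fo (hd xs)\<^esub>}. u (c xs) xs)"

definition elementary_boundary ::
  "'p::order set \<Rightarrow> ('p \<Rightarrow> ('r, 'm) module) \<Rightarrow> ('p \<Rightarrow> 'p \<Rightarrow> 'm \<Rightarrow> 'm) \<Rightarrow> int
    \<Rightarrow> 'm \<Rightarrow> 'p list \<Rightarrow> 'p list \<Rightarrow> 'm"
  where "elementary_boundary P Fo Fm k v xs =
    (let S = chain_module P Fo (k - 1) in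
      elementary_chain P Fo (k - 1) (Fm (xs ! 0) (xs ! 1) v) (tl xs) \<oplus>\<^bsub>S\<^esub>
      (\<Oplus>\<^bsub>S\<^esub>i \<in> {1..<length xs}.
        (let y = elementary_chain P Fo (k - 1) v (take i xs @ drop (Suc i) xs)
         in if even i then y else \<ominus>\<^bsub>S\<^esub> y)))"

definition boundary ::
  "'p::order set \<Rightarrow> ('p \<Rightarrow> ('r, 'm) module) \<Rightarrow> ('p \<Rightarrow> 'p \<Rightarrow> 'm \<Rightarrow> 'm) \<Rightarrow> int
    \<Rightarrow> ('p list \<Rightarrow> 'm) \<Rightarrow> 'p list \<Rightarrow> 'm"
  where "boundary P Fo Fm k =
    (if k \<le> 0 then (\<lambda>c \<in> carrier (chain_module P Fo k). \<zero>\<^bsub>chain_module P Fo (k - 1)\<^esub>)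
     else extend_linearly P Fo k (chain_module P Fo (k - 1)) (elementary_boundary P Fo Fm k))"

definition cycles ::
  "'p::order set \<Rightarrow> ('p \<Rightarrow> ('r, 'm) module) \<Rightarrow> ('p \<Rightarrow> 'p \<Rightarrow> 'm \<Rightarrow> 'm) \<Rightarrow> int
    \<Rightarrow> ('p list \<Rightarrow> 'm) set"
  where "cycles P Fo Fm k =
    a_kernel (chain_module P Fo k) (chain_module P Fo (k - 1)) (boundary P Fo Fm k)"

definition boundaries ::
  "'p::order set \<Rightarrow> ('p \<Rightarrow> ('r, 'm) module) \<Rightarrow> ('p \<Rightarrow> 'p \<Rightarrow> 'm \<Rightarrow> 'm) \<Rightarrow> int
    \<Rightarrow> ('p list \<Rightarrow> 'm) set"
  where "boundaries P Fo Fm k =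
    boundary P Fo Fm (k + 1) ` carrier (chain_module P Fo (k + 1))"

definition homology ::
  "'p::order set \<Rightarrow> ('p \<Rightarrow> ('r, 'm) module) \<Rightarrow> ('p \<Rightarrow> 'p \<Rightarrow> 'm \<Rightarrow> 'm) \<Rightarrow> int
    \<Rightarrow> ('r, ('p list \<Rightarrow> 'm) set) module"
  where "homology P Fo Fm k =
    quotient_module ((chain_module P Fo k)\<lparr>carrier := cycles P Fo Fm k\<rparr>) (boundaries P Fo Fm k)"

text \<open>
  For an order-preserving map \<open>g\<close> from \<open>P\<close> to \<open>Q\<close> and maps \<open>\<tau> x\<close> from \<open>Fo x\<close> to \<open>Go (g x)\<close>, the
  map \<open>\<lambda> x\<^sub>0 \<dots> x\<^sub>k \<mapsto> \<tau> x\<^sub>0 (\<lambda>) g(x\<^sub>0) \<dots> g(x\<^sub>k)\<close>.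
\<close>

definition induced_chain_map ::
  "'p::order set \<Rightarrow> ('p \<Rightarrow> ('r, 'm) module) \<Rightarrow> 'q::order set \<Rightarrow> ('q \<Rightarrow> ('r, 'n) module)
    \<Rightarrow> ('p \<Rightarrow> 'q) \<Rightarrow> ('p \<Rightarrow> 'm \<Rightarrow> 'n) \<Rightarrow> int \<Rightarrow> ('p list \<Rightarrow> 'm) \<Rightarrow> 'q list \<Rightarrow> 'n"
  where "induced_chain_map P Fo Q Go g \<tau> k =
    extend_linearly P Fo k (chain_module Q Go k)
      (\<lambda>v xs. elementary_chain Q Go k (\<tau> (hd xs) v) (map g xs))"

text \<open>
  The map induced on homology takes the class of \<open>z\<close> to the class of its image. The union below is
  a single coset exactly when this does not depend on the choice of \<open>z\<close>.
\<close>

definition induced_homology_map ::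
  "'p::order set \<Rightarrow> ('p \<Rightarrow> ('r, 'm) module) \<Rightarrow> ('p \<Rightarrow> 'p \<Rightarrow> 'm \<Rightarrow> 'm)
    \<Rightarrow> 'q::order set \<Rightarrow> ('q \<Rightarrow> ('r, 'n) module) \<Rightarrow> ('q \<Rightarrow> 'q \<Rightarrow> 'n \<Rightarrow> 'n)
    \<Rightarrow> ('p \<Rightarrow> 'q) \<Rightarrow> ('p \<Rightarrow> 'm \<Rightarrow> 'n) \<Rightarrow> int \<Rightarrow> ('p list \<Rightarrow> 'm) set \<Rightarrow> ('q list \<Rightarrow> 'n) set"
  where "induced_homology_map P Fo Fm Q Go Gm g \<tau> k =
    (\<lambda>X \<in> carrier (homology P Fo Fm k).
      \<Union>z\<in>X. boundaries Q Go Gm k +>\<^bsub>chain_module Q Go k\<^esub> induced_chain_map P Fo Q Go g \<tau> k z)"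


section \<open>The path poset\<close>

definition simple_path :: "('v, 'e) pre_digraph \<Rightarrow> 'e list \<Rightarrow> bool"
  where "simple_path \<Gamma> p \<longleftrightarrow> p \<noteq> [] \<and> (\<exists>u v. pre_digraph.apath \<Gamma> u p v)"

definition path_verts :: "('v, 'e) pre_digraph \<Rightarrow> 'e list \<Rightarrow> 'v set"
  where "path_verts \<Gamma> p = tail \<Gamma> ` set p \<union> head \<Gamma> ` set p"

definition multipaths :: "('v, 'e) pre_digraph \<Rightarrow> 'e set set"
  where "multipaths \<Gamma> = {\<Union>p\<in>Q. set p | Q. (\<forall>p\<in>Q. simple_path \<Gamma> p) \<and>
    pairwise (\<lambda>p q. disjnt (path_verts \<Gamma> p) (path_verts \<Gamma> q)) Q}"

definition covers :: "'p::order set \<Rightarrow> 'p \<Rightarrow> 'p \<Rightarrow> bool"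
  where "covers P x y \<longleftrightarrow> x \<in> P \<and> y \<in> P \<and> x < y \<and> \<not> (\<exists>z\<in>P. x < z \<and> z < y)"

definition saturated_chain :: "'p::order set \<Rightarrow> 'p \<Rightarrow> 'p \<Rightarrow> 'p list \<Rightarrow> bool"
  where "saturated_chain P x y xs \<longleftrightarrow>
    xs \<noteq> [] \<and> set xs \<subseteq> P \<and> hd xs = x \<and> last xs = y \<and> successively (covers P) xs"


section \<open>The coefficient functor of an algebra\<close>

definition connectivity :: "('v, 'e) pre_digraph \<Rightarrow> ('v \<times> 'v) set"
  where "connectivity \<Gamma> = (arcs_ends \<Gamma> \<union> (arcs_ends \<Gamma>)\<inverse>)\<^sup>* \<inter> verts \<Gamma> \<times> verts \<Gamma>"

definition component :: "('v, 'e) pre_digraph \<Rightarrow> 'v \<Rightarrow> 'v set"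
  where "component \<Gamma> v = connectivity \<Gamma> `` {v}"

definition pi0 :: "('v, 'e) pre_digraph \<Rightarrow> 'v set set"
  where "pi0 \<Gamma> = verts \<Gamma> // connectivity \<Gamma>"

definition spanning :: "('v, 'e) pre_digraph \<Rightarrow> 'e set \<Rightarrow> ('v, 'e) pre_digraph"
  where "spanning \<Gamma> x = \<Gamma>\<lparr>arcs := x\<rparr>"

locale unital_algebra = Module.module R A + ring A
  for R :: "('r, 'z) ring_scheme" and A :: "('r, 'a) module" +
  assumes smult_mult_left: "\<lbrakk>r \<in> carrier R; x \<in> carrier A; y \<in> carrier A\<rbrakk>
      \<Longrightarrow> (r \<odot>\<^bsub>A\<^esub> x) \<otimes>\<^bsub>A\<^esub> y = r \<odot>\<^bsub>A\<^esub> (x \<otimes>\<^bsub>A\<^esub> y)"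
    and smult_mult_right: "\<lbrakk>r \<in> carrier R; x \<in> carrier A; y \<in> carrier A\<rbrakk>
      \<Longrightarrow> x \<otimes>\<^bsub>A\<^esub> (r \<odot>\<^bsub>A\<^esub> y) = r \<odot>\<^bsub>A\<^esub> (x \<otimes>\<^bsub>A\<^esub> y)"

type_synonym ('v, 'a, 'r) tensor = "(('v set \<Rightarrow> 'a) \<Rightarrow> 'r) set"

definition F_obj ::
  "('r, 'z) ring_scheme \<Rightarrow> ('v, 'e) pre_digraph \<Rightarrow> ('r, 'a) module
    \<Rightarrow> 'e set \<Rightarrow> ('r, ('v, 'a, 'r) tensor) module"
  where "F_obj R \<Gamma> A x = tensor_product R (pi0 (spanning \<Gamma> x)) (\<lambda>_. A)"

definition F_pure ::
  "('r, 'z) ring_scheme \<Rightarrow> ('v, 'e) pre_digraph \<Rightarrow> ('r, 'a) module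
    \<Rightarrow> 'e set \<Rightarrow> ('v set \<Rightarrow> 'a) \<Rightarrow> ('v, 'a, 'r) tensor"
  where "F_pure R \<Gamma> A x = pure_tensor R (pi0 (spanning \<Gamma> x)) (\<lambda>_. A)"

definition F_lift ::
  "('r, 'z) ring_scheme \<Rightarrow> ('v, 'e) pre_digraph \<Rightarrow> ('r, 'a) module
    \<Rightarrow> 'e set \<Rightarrow> ('r, 'n) module \<Rightarrow> (('v set \<Rightarrow> 'a) \<Rightarrow> 'n) \<Rightarrow> ('v, 'a, 'r) tensor \<Rightarrow> 'n"
  where "F_lift R \<Gamma> A x = tensor_lift R (pi0 (spanning \<Gamma> x)) (\<lambda>_. A)"

text \<open>
  If \<open>y\<close> covers \<open>x\<close> and \<open>e\<close> is the additional edge, the components for \<open>y\<close> are those for \<open>x\<close>,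
  except that the components of \<open>tail \<Gamma> e\<close> and \<open>head \<Gamma> e\<close> are replaced by their union.
\<close>

definition F_cover ::
  "('r, 'z) ring_scheme \<Rightarrow> ('v, 'e) pre_digraph \<Rightarrow> ('r, 'a) module
    \<Rightarrow> 'e set \<Rightarrow> 'e set \<Rightarrow> ('v, 'a, 'r) tensor \<Rightarrow> ('v, 'a, 'r) tensor"
  where "F_cover R \<Gamma> A x y = (let e = (THE e. e \<in> y - x) in
    F_lift R \<Gamma> A x (F_obj R \<Gamma> A y) (\<lambda>a. F_pure R \<Gamma> A y (\<lambda>\<beta> \<in> pi0 (spanning \<Gamma> y).
      if tail \<Gamma> e \<in> \<beta>
      then a (component (spanning \<Gamma> x) (tail \<Gamma> e)) \<otimes>\<^bsub>A\<^esub> a (component (spanning \<Gamma> x) (head \<Gamma> e))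
      else a \<beta>)))"

fun F_along ::
  "('r, 'z) ring_scheme \<Rightarrow> ('v, 'e) pre_digraph \<Rightarrow> ('r, 'a) module
    \<Rightarrow> 'e set list \<Rightarrow> ('v, 'a, 'r) tensor \<Rightarrow> ('v, 'a, 'r) tensor"
  where
    "F_along R \<Gamma> A [] = undefined"
  | "F_along R \<Gamma> A [x] = (\<lambda>v \<in> carrier (F_obj R \<Gamma> A x). v)"
  | "F_along R \<Gamma> A (x # y # zs) =
      compose (carrier (F_obj R \<Gamma> A x)) (F_along R \<Gamma> A (y # zs)) (F_cover R \<Gamma> A x y)"

text \<open>The composite along a saturated chain does not depend on the chain chosen here.\<close>

definition F_map ::
  "('r, 'z) ring_scheme \<Rightarrow> ('v, 'e) pre_digraph \<Rightarrow> ('r, 'a) module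
    \<Rightarrow> 'e set \<Rightarrow> 'e set \<Rightarrow> ('v, 'a, 'r) tensor \<Rightarrow> ('v, 'a, 'r) tensor"
  where "F_map R \<Gamma> A x y = F_along R \<Gamma> A (SOME xs. saturated_chain (multipaths \<Gamma>) x y xs)"

type_synonym ('v, 'e, 'a, 'r) homology_class = "('e set list \<Rightarrow> ('v, 'a, 'r) tensor) set"

definition path_homology ::
  "('r, 'z) ring_scheme \<Rightarrow> ('v, 'e) pre_digraph \<Rightarrow> ('r, 'a) module
    \<Rightarrow> int \<Rightarrow> ('r, ('v, 'e, 'a, 'r) homology_class) module"
  where "path_homology R \<Gamma> A = homology (multipaths \<Gamma>) (F_obj R \<Gamma> A) (F_map R \<Gamma> A)"


section \<open>The categories\<close>

text \<open>
  An arrow is a triple consisting of its domain, its underlying map and its codomain. The types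
  of vertices, of edges and of elements of algebras play the role of universes.
\<close>

definition inclusions ::
  "('v, 'e) pre_digraph \<Rightarrow> ('w, 'f) pre_digraph \<Rightarrow> (('v \<Rightarrow> 'w) \<times> ('e \<Rightarrow> 'f)) set"
  where "inclusions \<Gamma>' \<Gamma> = {(fv, fe).
    fv \<in> verts \<Gamma>' \<rightarrow>\<^sub>E verts \<Gamma> \<and> inj_on fv (verts \<Gamma>') \<and>
    fe \<in> arcs \<Gamma>' \<rightarrow>\<^sub>E arcs \<Gamma> \<and> inj_on fe (arcs \<Gamma>') \<and>
    (\<forall>e\<in>arcs \<Gamma>'. tail \<Gamma> (fe e) = fv (tail \<Gamma>' e) \<and> head \<Gamma> (fe e) = fv (head \<Gamma>' e))}"

type_synonym ('v, 'e) inclusion_arrow =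
  "('v, 'e) pre_digraph \<times> (('v \<Rightarrow> 'v) \<times> ('e \<Rightarrow> 'e)) \<times> ('v, 'e) pre_digraph"

definition DirGr :: "(('v, 'e) pre_digraph, ('v, 'e) inclusion_arrow) category"
  where "DirGr = \<lparr>
    Obj = {\<Gamma>. fin_digraph \<Gamma>},
    Arr = {(\<Gamma>', f, \<Gamma>). fin_digraph \<Gamma>' \<and> fin_digraph \<Gamma> \<and> f \<in> inclusions \<Gamma>' \<Gamma>},
    Dom = (\<lambda>(\<Gamma>', f, \<Gamma>). \<Gamma>'),
    Cod = (\<lambda>(\<Gamma>', f, \<Gamma>). \<Gamma>),
    Ide = (\<lambda>\<Gamma>. (\<Gamma>, (\<lambda>v\<in>verts \<Gamma>. v, \<lambda>e\<in>arcs \<Gamma>. e), \<Gamma>)),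
    Comp = (\<lambda>(_, (gv, ge), \<Gamma>\<^sub>3) (\<Gamma>\<^sub>1, (fv, fe), _).
      (\<Gamma>\<^sub>1, (compose (verts \<Gamma>\<^sub>1) gv fv, compose (arcs \<Gamma>\<^sub>1) ge fe), \<Gamma>\<^sub>3))\<rparr>"

type_synonym ('r, 'a) algebra_arrow = "('r, 'a) module \<times> ('a \<Rightarrow> 'a) \<times> ('r, 'a) module"

definition Alg :: "('r, 'z) ring_scheme \<Rightarrow> (('r, 'a) module, ('r, 'a) algebra_arrow) category"
  where "Alg R = \<lparr>
    Obj = {A. unital_algebra R A},
    Arr = {(A, \<phi>, B). unital_algebra R A \<and> unital_algebra R B \<and>
      \<phi> \<in> ring_hom A B \<inter> linear_maps R A B},
    Dom = (\<lambda>(A, \<phi>, B). A),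
    Cod = (\<lambda>(A, \<phi>, B). B),
    Ide = (\<lambda>A. (A, \<lambda>a\<in>carrier A. a, A)),
    Comp = (\<lambda>(_, \<psi>, A\<^sub>3) (A\<^sub>1, \<phi>, _). (A\<^sub>1, compose (carrier A\<^sub>1) \<psi> \<phi>, A\<^sub>3))\<rparr>"

type_synonym ('r, 'm) graded_arrow =
  "(int \<Rightarrow> ('r, 'm) module) \<times> (int \<Rightarrow> 'm \<Rightarrow> 'm) \<times> (int \<Rightarrow> ('r, 'm) module)"

definition GrMod ::
  "('r, 'z) ring_scheme \<Rightarrow> (int \<Rightarrow> ('r, 'm) module, ('r, 'm) graded_arrow) category"
  where "GrMod R = \<lparr>
    Obj = {M. \<forall>k. Module.module R (M k)},
    Arr = {(M, f, N). (\<forall>k. Module.module R (M k)) \<and> (\<forall>k. Module.module R (N k)) \<and>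
      (\<forall>k. f k \<in> linear_maps R (M k) (N k))},
    Dom = (\<lambda>(M, f, N). M),
    Cod = (\<lambda>(M, f, N). N),
    Ide = (\<lambda>M. (M, \<lambda>k. \<lambda>x\<in>carrier (M k). x, M)),
    Comp = (\<lambda>(_, g, M\<^sub>3) (M\<^sub>1, f, _). (M\<^sub>1, \<lambda>k. compose (carrier (M\<^sub>1 k)) (g k) (f k), M\<^sub>3))\<rparr>"


section \<open>Induced maps\<close>

text \<open>
  The components of the image of a multipath \<open>x\<close> of \<open>\<Gamma>'\<close> are the images of the components for
  \<open>x\<close> and the singletons of the vertices outside the image of \<open>\<Gamma>'\<close>; the latter are assigned 1.
\<close>

definition tau ::
  "('r, 'z) ring_scheme \<Rightarrow> ('r, 'a) module \<Rightarrow> ('v, 'e) pre_digraph \<Rightarrow> ('v \<Rightarrow> 'w) \<times> ('e \<Rightarrow> 'f)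
    \<Rightarrow> ('w, 'f) pre_digraph \<Rightarrow> 'e set \<Rightarrow> ('v, 'a, 'r) tensor \<Rightarrow> ('w, 'a, 'r) tensor"
  where "tau R A \<Gamma>' f \<Gamma> x =
    F_lift R \<Gamma>' A x (F_obj R \<Gamma> A (snd f ` x))
      (\<lambda>a. F_pure R \<Gamma> A (snd f ` x) (\<lambda>\<beta> \<in> pi0 (spanning \<Gamma> (snd f ` x)).
        if \<beta> \<subseteq> fst f ` verts \<Gamma>' then a {v \<in> verts \<Gamma>'. fst f v \<in> \<beta>} else \<one>\<^bsub>A\<^esub>))"

definition sigma ::
  "('r, 'z) ring_scheme \<Rightarrow> ('v, 'e) pre_digraph \<Rightarrow> ('r, 'a) module \<Rightarrow> ('a \<Rightarrow> 'b)
    \<Rightarrow> ('r, 'b) module \<Rightarrow> 'e set \<Rightarrow> ('v, 'a, 'r) tensor \<Rightarrow> ('v, 'b, 'r) tensor"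
  where "sigma R \<Gamma> A \<phi> B x =
    F_lift R \<Gamma> A x (F_obj R \<Gamma> B x)
      (\<lambda>a. F_pure R \<Gamma> B x (\<lambda>\<alpha> \<in> pi0 (spanning \<Gamma> x). \<phi> (a \<alpha>)))"

definition inclusion_map ::
  "('r, 'z) ring_scheme \<Rightarrow> ('r, 'a) module \<Rightarrow> ('v, 'e) pre_digraph \<Rightarrow> ('v \<Rightarrow> 'w) \<times> ('e \<Rightarrow> 'f)
    \<Rightarrow> ('w, 'f) pre_digraph \<Rightarrow> int
    \<Rightarrow> ('v, 'e, 'a, 'r) homology_class \<Rightarrow> ('w, 'f, 'a, 'r) homology_class"
  where "inclusion_map R A \<Gamma>' f \<Gamma> = induced_homology_map
    (multipaths \<Gamma>') (F_obj R \<Gamma>' A) (F_map R \<Gamma>' A) (multipaths \<Gamma>) (F_obj R \<Gamma> A) (F_map R \<Gamma> A)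
    ((`) (snd f)) (tau R A \<Gamma>' f \<Gamma>)"

definition algebra_map ::
  "('r, 'z) ring_scheme \<Rightarrow> ('v, 'e) pre_digraph \<Rightarrow> ('r, 'a) module \<Rightarrow> ('a \<Rightarrow> 'b)
    \<Rightarrow> ('r, 'b) module \<Rightarrow> int
    \<Rightarrow> ('v, 'e, 'a, 'r) homology_class \<Rightarrow> ('v, 'e, 'b, 'r) homology_class"
  where "algebra_map R \<Gamma> A \<phi> B = induced_homology_map
    (multipaths \<Gamma>) (F_obj R \<Gamma> A) (F_map R \<Gamma> A) (multipaths \<Gamma>) (F_obj R \<Gamma> B) (F_map R \<Gamma> B)
    (\<lambda>x. x) (sigma R \<Gamma> A \<phi> B)"

definition inclusion_arrow ::
  "('r, 'z) ring_scheme \<Rightarrow> ('v, 'e) inclusion_arrow \<Rightarrow> ('r, 'a) module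
    \<Rightarrow> ('r, ('v, 'e, 'a, 'r) homology_class) graded_arrow"
  where "inclusion_arrow R = (\<lambda>(\<Gamma>', f, \<Gamma>) A.
    (path_homology R \<Gamma>' A, inclusion_map R A \<Gamma>' f \<Gamma>, path_homology R \<Gamma> A))"

definition algebra_arrow ::
  "('r, 'z) ring_scheme \<Rightarrow> ('v, 'e) pre_digraph \<Rightarrow> ('r, 'a) algebra_arrow
    \<Rightarrow> ('r, ('v, 'e, 'a, 'r) homology_class) graded_arrow"
  where "algebra_arrow R \<Gamma> = (\<lambda>(A, \<phi>, B).
    (path_homology R \<Gamma> A, algebra_map R \<Gamma> A \<phi> B, path_homology R \<Gamma> B))"

end

theory Submission
  imports Defs
begin

text \<open>
  The coefficients form a functor because the multipaths below a given one form a Boolean lattice,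
  so that two saturated chains can be compared through diamonds. Removing two edges from a multipath
  leaves their ends in four distinct components, or in three consecutive ones; in the second case the
  two ways round the diamond agree by associativity in \<open>A\<close>.

  A digraph inclusion \<open>f\<close> and an algebra homomorphism \<open>\<phi>\<close> together induce a natural transformation of
  coefficients: apply \<open>\<phi>\<close> in every factor and insert 1 at the vertices outside the image of \<open>f\<close>.
  Naturality has to be checked along covering relations only, where it says that \<open>\<phi>\<close> is
  multiplicative. The assignment is functorial in the pair \<open>(f, \<phi>)\<close>, and so is the passage from
  natural transformations to homology.
\<close>

section \<open>Linear maps, quotients and direct sums\<close>

text \<open>The algebra need not be commutative, so the diamonds have content: both ways round must
  multiply the same factors in the same order. This would break down if the head of each of the two
  edges were connected to the tail of the other, since the second merge would then no longer fuse
  distinct components. Positions along the paths of a multipath exclude this: removing an edge cuts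
  its line, and no remaining edge crosses the cut.

  The structure maps and the induced maps are given on pure tensors by operations on families,
  \<open>merge\<close> and \<open>push\<close>. The identities between them are proved there, as
  equalities of functions, and reach tensors through the universal property and homology through
  elementary chains.

  \<open>F_map\<close> follows a chosen chain. Once the choice is shown to be immaterial, arguments
  about its values use only \<open>F_map_refl\<close> and \<open>F_map_step\<close>, which lets the
  first added edge be arbitrary.

  Working with pairs makes the interchange law between the two variables an instance of
  functoriality instead of a separate check.\<close>

lemma linear_mapsI:
  assumes "\<And>x. x \<in> carrier M \<Longrightarrow> f x \<in> carrier N"
    and "\<And>x y. \<lbrakk>x \<in> carrier M; y \<in> carrier M\<rbrakk> \<Longrightarrow> f (x \<oplus>\<^bsub>M\<^esub> y) = f x \<oplus>\<^bsub>N\<^esub> f y"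
    and "\<And>r x. \<lbrakk>r \<in> carrier R; x \<in> carrier M\<rbrakk> \<Longrightarrow> f (r \<odot>\<^bsub>M\<^esub> x) = r \<odot>\<^bsub>N\<^esub> f x"
    and "f \<in> extensional (carrier M)"
  shows "f \<in> linear_maps R M N"
  using assms by (auto simp: linear_maps_def hom_def)

lemma linear_maps_restrictI:
  assumes "Module.module R M"
    and "\<And>x. x \<in> carrier M \<Longrightarrow> f x \<in> carrier N"
    and "\<And>x y. \<lbrakk>x \<in> carrier M; y \<in> carrier M\<rbrakk> \<Longrightarrow> f (x \<oplus>\<^bsub>M\<^esub> y) = f x \<oplus>\<^bsub>N\<^esub> f y"
    and "\<And>r x. \<lbrakk>r \<in> carrier R; x \<in> carrier M\<rbrakk> \<Longrightarrow> f (r \<odot>\<^bsub>M\<^esub> x) = r \<odot>\<^bsub>N\<^esub> f x"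
  shows "restrict f (carrier M) \<in> linear_maps R M N"
proof -
  interpret Module.module R M by fact
  show ?thesis
    by (rule linear_mapsI) (use assms(2-) in auto)
qed

lemma
  assumes "f \<in> linear_maps R M N"
  shows linear_maps_closed: "x \<in> carrier M \<Longrightarrow> f x \<in> carrier N"
    and linear_maps_add: "\<lbrakk>x \<in> carrier M; y \<in> carrier M\<rbrakk> \<Longrightarrow> f (x \<oplus>\<^bsub>M\<^esub> y) = f x \<oplus>\<^bsub>N\<^esub> f y"
    and linear_maps_smult: "\<lbrakk>r \<in> carrier R; x \<in> carrier M\<rbrakk> \<Longrightarrow> f (r \<odot>\<^bsub>M\<^esub> x) = r \<odot>\<^bsub>N\<^esub> f x"
    and linear_maps_extensional: "f \<in> extensional (carrier M)"
  using assms by (auto simp: linear_maps_def hom_def)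

lemma linear_maps_abelian_group_hom:
  assumes "Module.module R M" "Module.module R N" "f \<in> linear_maps R M N"
  shows "abelian_group_hom M N f"
proof -
  interpret M: Module.module R M by fact
  interpret N: Module.module R N by fact
  show ?thesis
    using assms(3) M.abelian_group_axioms N.abelian_group_axioms
    by (intro abelian_group_homI group_hom.intro group_hom_axioms.intro M.a_group N.a_group)
      (auto simp: linear_maps_def)
qed

lemma
  assumes "Module.module R M" "Module.module R N" "f \<in> linear_maps R M N"
  shows linear_maps_zero: "f \<zero>\<^bsub>M\<^esub> = \<zero>\<^bsub>N\<^esub>"
    and linear_maps_minus: "x \<in> carrier M \<Longrightarrow> f (\<ominus>\<^bsub>M\<^esub> x) = \<ominus>\<^bsub>N\<^esub> f x"
  using abelian_group_hom.hom_zero[OF linear_maps_abelian_group_hom[OF assms]]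
    abelian_group_hom.hom_a_inv[OF linear_maps_abelian_group_hom[OF assms]] by auto

lemma linear_maps_finsum:
  assumes "Module.module R M" "Module.module R N" "f \<in> linear_maps R M N" "g \<in> A \<rightarrow> carrier M"
  shows "f (\<Oplus>\<^bsub>M\<^esub>i\<in>A. g i) = (\<Oplus>\<^bsub>N\<^esub>i\<in>A. f (g i))"
proof -
  interpret M: Module.module R M by fact
  interpret N: Module.module R N by fact
  show ?thesis using assms(4)
  \<comment> \<open>A sum over an infinite set is zero by convention, so the infinite case reduces
    to preservation of zero.\<close>
  proof (induction A rule: infinite_finite_induct)
    case (insert a A)
    then have "(\<lambda>i. f (g i)) \<in> A \<rightarrow> carrier N" "f (g a) \<in> carrier N" "g \<in> A \<rightarrow> carrier M" "g a \<in> carrier M"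
      using linear_maps_closed[OF assms(3)] by auto
    with insert show ?case
      using linear_maps_add[OF assms(3)] by (simp add: M.finsum_closed)
  qed (use linear_maps_zero[OF assms(1-3)] in simp_all)
qed

lemma linear_maps_compose:
  assumes "Module.module R M" "f \<in> linear_maps R M N" "g \<in> linear_maps R N P"
  shows "compose (carrier M) g f \<in> linear_maps R M P"
proof -
  interpret M: Module.module R M by fact
  show ?thesis
    by (rule linear_mapsI)
      (auto simp: compose_eq linear_maps_closed[OF assms(2)] linear_maps_closed[OF assms(3)]
        linear_maps_add[OF assms(2)] linear_maps_add[OF assms(3)]
        linear_maps_smult[OF assms(2)] linear_maps_smult[OF assms(3)])
qed

lemma linear_maps_ident:
  assumes "Module.module R M"
  shows "(\<lambda>x\<in>carrier M. x) \<in> linear_maps R M M"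
  by (rule linear_maps_restrictI[OF assms]) auto

lemma linear_maps_eqI:
  assumes "f \<in> linear_maps R M N" "g \<in> linear_maps R M N" "\<And>x. x \<in> carrier M \<Longrightarrow> f x = g x"
  shows "f = g"
  using assms linear_maps_extensional extensionalityI by metis

section \<open>Generated submodules and quotient modules\<close>

lemma generated_submodule_submodule:
  assumes "Module.module R M" "S \<subseteq> carrier M"
  shows "submodule (generated_submodule R M S) R M"
proof -
  interpret Module.module R M by fact
  \<comment> \<open>The whole module belongs to the family, so the intersection is taken over a
    nonempty set and stays inside the carrier.\<close>
  have ne: "carrier M \<in> {N. submodule N R M \<and> S \<subseteq> N}"
    using carrier_is_submodule assms(2) by simp
  have 0: "\<zero>\<^bsub>M\<^esub> \<in> N" if "submodule N R M" for N
    using subgroup.one_closed[OF submodule.axioms(1)[OF that]] by simp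
  show ?thesis unfolding generated_submodule_def
  proof (rule submoduleI)
    show "\<Inter> {N. submodule N R M \<and> S \<subseteq> N} \<subseteq> carrier M" using ne by (rule Inter_lower)
  qed (auto intro: 0 submoduleE(3-5))
qed

lemma generated_submodule_superset: "S \<subseteq> generated_submodule R M S"
  by (auto simp: generated_submodule_def)

lemma generated_submodule_least:
  "\<lbrakk>submodule N R M; S \<subseteq> N\<rbrakk> \<Longrightarrow> generated_submodule R M S \<subseteq> N"
  by (auto simp: generated_submodule_def)

locale module_quotient = Module.module R M for R :: "('r, 'z) ring_scheme" and M :: "('r, 'a) module" +
  fixes H assumes H: "submodule H R M"
begin

abbreviation "Q \<equiv> quotient_module M H"

sublocale H: abelian_subgroup H M
  by (intro abelian_subgroupI3 additive_subgroupI submodule.axioms(1)[OF H] abelian_group_axioms)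

lemma carrier_quotient: "carrier Q = (\<lambda>x. H +>\<^bsub>M\<^esub> x) ` carrier M"
  by (auto simp: quotient_module_def A_RCOSETS_def')

lemma coset_eq_iff:
  assumes "x \<in> carrier M" "y \<in> carrier M"
  shows "H +>\<^bsub>M\<^esub> x = H +>\<^bsub>M\<^esub> y \<longleftrightarrow> x \<ominus>\<^bsub>M\<^esub> y \<in> H"
  using assms H.a_rcos_module[of y x] H.a_repr_independence'[of x y] H.a_rcos_self[of x]
  by (auto simp: minus_eq)

lemma zero_quotient: "\<zero>\<^bsub>Q\<^esub> = H +>\<^bsub>M\<^esub> \<zero>\<^bsub>M\<^esub>"
  by (simp add: quotient_module_def H.a_subset)

lemma add_quotient:
  "\<lbrakk>x \<in> carrier M; y \<in> carrier M\<rbrakk> \<Longrightarrow> (H +>\<^bsub>M\<^esub> x) \<oplus>\<^bsub>Q\<^esub> (H +>\<^bsub>M\<^esub> y) = H +>\<^bsub>M\<^esub> (x \<oplus>\<^bsub>M\<^esub> y)"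
  by (simp add: quotient_module_def H.a_rcos_sum)

text \<open>The scalar multiple of a coset is defined as a union over all its representatives.
  Closure of H under scalars makes every member of this union the same coset.\<close>

lemma smult_quotient:
  assumes "r \<in> carrier R" "x \<in> carrier M"
  shows "r \<odot>\<^bsub>Q\<^esub> (H +>\<^bsub>M\<^esub> x) = H +>\<^bsub>M\<^esub> (r \<odot>\<^bsub>M\<^esub> x)"
proof -
  have "H +>\<^bsub>M\<^esub> (r \<odot>\<^bsub>M\<^esub> y) = H +>\<^bsub>M\<^esub> (r \<odot>\<^bsub>M\<^esub> x)" if y: "y \<in> H +>\<^bsub>M\<^esub> x" for y
  proof -
    have yM: "y \<in> carrier M" using H.a_elemrcos_carrier[OF assms(2) y] .
    have "y \<oplus>\<^bsub>M\<^esub> \<ominus>\<^bsub>M\<^esub> x \<in> H" using H.a_rcos_module_imp[OF assms(2) y] .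
    then have "r \<odot>\<^bsub>M\<^esub> (y \<oplus>\<^bsub>M\<^esub> \<ominus>\<^bsub>M\<^esub> x) \<in> H" using assms H by (blast intro: submoduleE)
    then show ?thesis
      using assms yM by (subst coset_eq_iff) (auto simp: smult_r_distr smult_r_minus minus_eq)
  qed
  then have "(\<Union>y\<in>H +>\<^bsub>M\<^esub> x. H +>\<^bsub>M\<^esub> (r \<odot>\<^bsub>M\<^esub> y)) = (\<Union>y\<in>H +>\<^bsub>M\<^esub> x. H +>\<^bsub>M\<^esub> (r \<odot>\<^bsub>M\<^esub> x))"
    by (rule SUP_cong[OF refl])
  also have "\<dots> = H +>\<^bsub>M\<^esub> (r \<odot>\<^bsub>M\<^esub> x)"
    using H.a_rcos_self[OF assms(2)] by (simp only: UN_constant split: if_splits) blast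
  finally show ?thesis by (simp add: quotient_module_def)
qed

lemma module_quotient: "Module.module R Q"
proof (rule moduleI)
  show "abelian_group Q"
  proof (rule abelian_groupI)
    fix X assume "X \<in> carrier Q"
    then obtain x where x: "x \<in> carrier M" "X = H +>\<^bsub>M\<^esub> x" by (auto simp: carrier_quotient)
    then have "(H +>\<^bsub>M\<^esub> (\<ominus>\<^bsub>M\<^esub> x)) \<oplus>\<^bsub>Q\<^esub> X = \<zero>\<^bsub>Q\<^esub>"
      by (simp add: add_quotient zero_quotient l_neg del: a_coset_add_zero)
    then show "\<exists>Y\<in>carrier Q. Y \<oplus>\<^bsub>Q\<^esub> X = \<zero>\<^bsub>Q\<^esub>"
      using x by (auto simp: carrier_quotient)
  qed (auto simp: carrier_quotient add_quotient zero_quotient a_ac simp del: a_coset_add_zero)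
qed (auto simp: carrier_quotient add_quotient smult_quotient smult_l_distr smult_r_distr
    smult_assoc1 R.is_cring)

lemma coset_linear: "(\<lambda>x\<in>carrier M. H +>\<^bsub>M\<^esub> x) \<in> linear_maps R M Q"
  by (rule linear_maps_restrictI)
    (auto simp: carrier_quotient add_quotient smult_quotient module_axioms)

lemma quotient_lift:
  assumes N: "Module.module R N" and f: "f \<in> linear_maps R M N"
    and 0: "\<And>x. x \<in> H \<Longrightarrow> f x = \<zero>\<^bsub>N\<^esub>"
  shows "\<exists>g\<in>linear_maps R Q N. \<forall>x\<in>carrier M. g (H +>\<^bsub>M\<^esub> x) = f x"
proof -
  interpret N: Module.module R N by fact
  have eq: "f x = f y" if "x \<in> carrier M" "y \<in> carrier M" "H +>\<^bsub>M\<^esub> x = H +>\<^bsub>M\<^esub> y" for x y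
  proof -
    have "f (x \<oplus>\<^bsub>M\<^esub> \<ominus>\<^bsub>M\<^esub> y) = \<zero>\<^bsub>N\<^esub>" using that coset_eq_iff[of x y] 0 by (auto simp: minus_eq)
    then have "f x \<oplus>\<^bsub>N\<^esub> \<ominus>\<^bsub>N\<^esub> f y = \<zero>\<^bsub>N\<^esub>"
      using that linear_maps_add[OF f] linear_maps_minus[OF module_axioms N f] by auto
    then show ?thesis
      using that linear_maps_closed[OF f] N.add.inv_equality[of "f x" "\<ominus>\<^bsub>N\<^esub> f y"] by simp
  qed
  \<comment> \<open>A representative is chosen in each coset; \<open>eq\<close> says that the value
    does not depend on it.\<close>
  define g where "g = (\<lambda>X\<in>carrier Q. f (SOME x. x \<in> carrier M \<and> X = H +>\<^bsub>M\<^esub> x))"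
  have g: "g (H +>\<^bsub>M\<^esub> x) = f x" if "x \<in> carrier M" for x
  proof -
    let ?y = "SOME y. y \<in> carrier M \<and> H +>\<^bsub>M\<^esub> x = H +>\<^bsub>M\<^esub> y"
    have "?y \<in> carrier M \<and> H +>\<^bsub>M\<^esub> x = H +>\<^bsub>M\<^esub> ?y"
      by (rule someI[where x = x]) (use that in simp)
    then have "f ?y = f x" using eq[of ?y x] that by metis
    moreover have "H +>\<^bsub>M\<^esub> x \<in> carrier Q" using that by (simp add: carrier_quotient)
    ultimately show ?thesis by (simp only: g_def restrict_apply if_True)
  qed
  have "g \<in> linear_maps R Q N"
  proof (rule linear_mapsI)
    show "g \<in> extensional (carrier Q)" by (simp add: g_def)
  qed (auto simp: carrier_quotient add_quotient smult_quotient g linear_maps_closed[OF f]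
      linear_maps_add[OF f] linear_maps_smult[OF f])
  with g show ?thesis by (intro bexI[of _ g]) auto
qed

lemma quotient_eqI:
  assumes "f \<in> linear_maps R Q N" "g \<in> linear_maps R Q N"
    and "\<And>x. x \<in> carrier M \<Longrightarrow> f (H +>\<^bsub>M\<^esub> x) = g (H +>\<^bsub>M\<^esub> x)"
  shows "f = g"
  by (rule linear_maps_eqI[OF assms(1,2)]) (auto simp: carrier_quotient assms(3))

end

section \<open>Direct sums\<close>

locale module_direct_sum = R: cring R for R :: "('r, 'z) ring_scheme" +
  fixes J :: "'j set" and M :: "'j \<Rightarrow> ('r, 'a) module"
  assumes modules: "j \<in> J \<Longrightarrow> Module.module R (M j)"
begin

abbreviation "S \<equiv> direct_sum J M"

lemma abelian_group_summand: "j \<in> J \<Longrightarrow> abelian_group (M j)"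
  using modules by (simp add: Module.module_def)

lemma zero_summand [simp]: "j \<in> J \<Longrightarrow> \<zero>\<^bsub>M j\<^esub> \<in> carrier (M j)"
  using abelian_group_summand abelian_group_def abelian_monoid.zero_closed by metis

lemma zero_add_zero_summand: "j \<in> J \<Longrightarrow> \<zero>\<^bsub>M j\<^esub> \<oplus>\<^bsub>M j\<^esub> \<zero>\<^bsub>M j\<^esub> = \<zero>\<^bsub>M j\<^esub>"
  by (simp add: abelian_group_summand abelian_group.axioms(1) abelian_monoid.l_zero)

lemma smult_zero_summand: "\<lbrakk>j \<in> J; r \<in> carrier R\<rbrakk> \<Longrightarrow> r \<odot>\<^bsub>M j\<^esub> \<zero>\<^bsub>M j\<^esub> = \<zero>\<^bsub>M j\<^esub>"
  by (rule module.smult_r_null[OF modules])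

lemma carrier_direct_sum_iff:
  "c \<in> carrier S \<longleftrightarrow> c \<in> (\<Pi>\<^sub>E j\<in>J. carrier (M j)) \<and> finite {j \<in> J. c j \<noteq> \<zero>\<^bsub>M j\<^esub>}"
  by (simp add: direct_sum_def)

lemma direct_sum_apply: "\<lbrakk>c \<in> carrier S; j \<in> J\<rbrakk> \<Longrightarrow> c j \<in> carrier (M j)"
  by (auto simp: carrier_direct_sum_iff)

lemma direct_sum_eqI:
  assumes "c \<in> carrier S" "c' \<in> carrier S" "\<And>j. j \<in> J \<Longrightarrow> c j = c' j"
  shows "c = c'"
  using assms by (auto simp: carrier_direct_sum_iff intro: PiE_ext)

lemma zero_direct_sum: "j \<in> J \<Longrightarrow> \<zero>\<^bsub>S\<^esub> j = \<zero>\<^bsub>M j\<^esub>"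
  and add_direct_sum: "j \<in> J \<Longrightarrow> (c \<oplus>\<^bsub>S\<^esub> c') j = c j \<oplus>\<^bsub>M j\<^esub> c' j"
  and smult_direct_sum: "j \<in> J \<Longrightarrow> (r \<odot>\<^bsub>S\<^esub> c) j = r \<odot>\<^bsub>M j\<^esub> c j"
  by (simp_all add: direct_sum_def)

lemma zero_direct_sum_closed: "\<zero>\<^bsub>S\<^esub> \<in> carrier S"
  unfolding carrier_direct_sum_iff by (auto simp: direct_sum_def)

lemma add_direct_sum_closed:
  assumes "c \<in> carrier S" "c' \<in> carrier S"
  shows "c \<oplus>\<^bsub>S\<^esub> c' \<in> carrier S"
proof -
  have "finite ({j \<in> J. c j \<noteq> \<zero>\<^bsub>M j\<^esub>} \<union> {j \<in> J. c' j \<noteq> \<zero>\<^bsub>M j\<^esub>})"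
    using assms by (simp add: carrier_direct_sum_iff)
  moreover have "{j \<in> J. (c \<oplus>\<^bsub>S\<^esub> c') j \<noteq> \<zero>\<^bsub>M j\<^esub>} \<subseteq> \<dots>"
    by (auto simp: add_direct_sum zero_add_zero_summand)
  ultimately have "finite {j \<in> J. (c \<oplus>\<^bsub>S\<^esub> c') j \<noteq> \<zero>\<^bsub>M j\<^esub>}" by (rule finite_subset[rotated])
  moreover have "c \<oplus>\<^bsub>S\<^esub> c' \<in> (\<Pi>\<^sub>E j\<in>J. carrier (M j))"
    using assms direct_sum_apply abelian_group_summand
    by (auto simp: direct_sum_def abelian_group_def intro!: abelian_monoid.a_closed)
  ultimately show ?thesis by (simp add: carrier_direct_sum_iff)
qed

lemma smult_direct_sum_closed:
  assumes "r \<in> carrier R" "c \<in> carrier S"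
  shows "r \<odot>\<^bsub>S\<^esub> c \<in> carrier S"
proof -
  have "{j \<in> J. (r \<odot>\<^bsub>S\<^esub> c) j \<noteq> \<zero>\<^bsub>M j\<^esub>} \<subseteq> {j \<in> J. c j \<noteq> \<zero>\<^bsub>M j\<^esub>}"
    using assms(1) by (auto simp: smult_direct_sum smult_zero_summand)
  then have "finite {j \<in> J. (r \<odot>\<^bsub>S\<^esub> c) j \<noteq> \<zero>\<^bsub>M j\<^esub>}"
    using assms(2) by (auto simp: carrier_direct_sum_iff intro: finite_subset)
  moreover have "r \<odot>\<^bsub>S\<^esub> c \<in> (\<Pi>\<^sub>E j\<in>J. carrier (M j))"
    using assms direct_sum_apply modules
    by (auto simp: direct_sum_def intro!: module.smult_closed)
  ultimately show ?thesis by (simp add: carrier_direct_sum_iff)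
qed

lemma module_direct_sum: "Module.module R S"
proof (rule moduleI)
  note closed = zero_direct_sum_closed add_direct_sum_closed smult_direct_sum_closed
  note app = zero_direct_sum add_direct_sum smult_direct_sum direct_sum_apply
  show "abelian_group S"
  proof (rule abelian_groupI)
    fix c assume c: "c \<in> carrier S"
    \<comment> \<open>The inverse is taken as the multiple by minus one, so that its finite support
      is already known from \<open>smult_direct_sum_closed\<close>.\<close>
    have "(\<ominus>\<^bsub>R\<^esub> \<one>\<^bsub>R\<^esub>) \<odot>\<^bsub>S\<^esub> c \<oplus>\<^bsub>S\<^esub> c = \<zero>\<^bsub>S\<^esub>"
    proof (rule direct_sum_eqI)
      fix j assume j: "j \<in> J"
      interpret Module.module R "M j" using modules[OF j] .
      show "((\<ominus>\<^bsub>R\<^esub> \<one>\<^bsub>R\<^esub>) \<odot>\<^bsub>S\<^esub> c \<oplus>\<^bsub>S\<^esub> c) j = \<zero>\<^bsub>S\<^esub> j"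
        using c j by (simp add: app smult_l_minus l_neg)
    qed (use c in \<open>auto intro!: closed\<close>)
    then show "\<exists>d\<in>carrier S. d \<oplus>\<^bsub>S\<^esub> c = \<zero>\<^bsub>S\<^esub>"
      using c by (intro bexI[of _ "(\<ominus>\<^bsub>R\<^esub> \<one>\<^bsub>R\<^esub>) \<odot>\<^bsub>S\<^esub> c"]) (auto intro!: closed)
    show "\<zero>\<^bsub>S\<^esub> \<oplus>\<^bsub>S\<^esub> c = c"
      by (rule direct_sum_eqI)
        (use c abelian_group_summand in \<open>auto simp: app abelian_group_def abelian_monoid.l_zero intro!: closed\<close>)
  next
    fix c d e assume cde: "c \<in> carrier S" "d \<in> carrier S" "e \<in> carrier S"
    show "c \<oplus>\<^bsub>S\<^esub> d = d \<oplus>\<^bsub>S\<^esub> c"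
      by (rule direct_sum_eqI)
        (use cde abelian_group_summand in \<open>auto simp: app abelian_group_def abelian_monoid.a_comm intro!: closed\<close>)
    show "c \<oplus>\<^bsub>S\<^esub> d \<oplus>\<^bsub>S\<^esub> e = c \<oplus>\<^bsub>S\<^esub> (d \<oplus>\<^bsub>S\<^esub> e)"
      by (rule direct_sum_eqI)
        (use cde abelian_group_summand in \<open>auto simp: app abelian_group_def abelian_monoid.a_assoc intro!: closed\<close>)
  qed (auto intro!: closed)
  show "(a \<oplus>\<^bsub>R\<^esub> b) \<odot>\<^bsub>S\<^esub> x = a \<odot>\<^bsub>S\<^esub> x \<oplus>\<^bsub>S\<^esub> b \<odot>\<^bsub>S\<^esub> x"
    if "a \<in> carrier R" "b \<in> carrier R" "x \<in> carrier S" for a b x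
    by (rule direct_sum_eqI)
      (use that modules in \<open>auto simp: app module.smult_l_distr intro!: closed\<close>)
  show "a \<odot>\<^bsub>S\<^esub> (x \<oplus>\<^bsub>S\<^esub> y) = a \<odot>\<^bsub>S\<^esub> x \<oplus>\<^bsub>S\<^esub> a \<odot>\<^bsub>S\<^esub> y"
    if "a \<in> carrier R" "x \<in> carrier S" "y \<in> carrier S" for a x y
    by (rule direct_sum_eqI)
      (use that modules[THEN module.smult_r_distr] in \<open>auto simp: app intro!: closed\<close>)
  show "(a \<otimes>\<^bsub>R\<^esub> b) \<odot>\<^bsub>S\<^esub> x = a \<odot>\<^bsub>S\<^esub> (b \<odot>\<^bsub>S\<^esub> x)"
    if "a \<in> carrier R" "b \<in> carrier R" "x \<in> carrier S" for a b x
    by (rule direct_sum_eqI)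
      (use that modules in \<open>auto simp: app module.smult_assoc1 intro!: closed\<close>)
  show "\<one>\<^bsub>R\<^esub> \<odot>\<^bsub>S\<^esub> x = x" if "x \<in> carrier S" for x
    by (rule direct_sum_eqI)
      (use that modules in \<open>auto simp: app module.smult_one intro!: closed\<close>)
qed (auto intro: smult_direct_sum_closed R.is_cring)

sublocale S: Module.module R S by (rule module_direct_sum)

lemma summand_apply: "i \<in> J \<Longrightarrow> summand J M j x i = (if i = j then x else \<zero>\<^bsub>M i\<^esub>)"
  by (simp add: summand_def)

lemma summand_closed:
  assumes "j \<in> J" "x \<in> carrier (M j)"
  shows "summand J M j x \<in> carrier S"
proof -
  have "{i \<in> J. summand J M j x i \<noteq> \<zero>\<^bsub>M i\<^esub>} \<subseteq> {j}" by (auto simp: summand_def)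
  then have "finite {i \<in> J. summand J M j x i \<noteq> \<zero>\<^bsub>M i\<^esub>}" by (rule finite_subset) simp
  moreover have "summand J M j x \<in> (\<Pi>\<^sub>E j\<in>J. carrier (M j))"
    using assms by (auto simp: summand_def)
  ultimately show ?thesis by (simp add: carrier_direct_sum_iff)
qed

lemma summand_linear:
  assumes "j \<in> J"
  shows "(\<lambda>x\<in>carrier (M j). summand J M j x) \<in> linear_maps R (M j) S"
proof -
  interpret Mj: Module.module R "M j" using modules assms .
  show ?thesis
  proof (rule linear_maps_restrictI[OF modules[OF assms]])
    fix x y assume xy: "x \<in> carrier (M j)" "y \<in> carrier (M j)"
    show "summand J M j (x \<oplus>\<^bsub>M j\<^esub> y) = summand J M j x \<oplus>\<^bsub>S\<^esub> summand J M j y"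
    proof (rule direct_sum_eqI)
      fix i assume i: "i \<in> J"
      interpret Mi: Module.module R "M i" using modules i .
      show "summand J M j (x \<oplus>\<^bsub>M j\<^esub> y) i = (summand J M j x \<oplus>\<^bsub>S\<^esub> summand J M j y) i"
        using i xy by (simp add: summand_apply add_direct_sum)
    qed (use assms xy in \<open>simp_all add: summand_closed\<close>)
  next
    fix r x assume rx: "r \<in> carrier R" "x \<in> carrier (M j)"
    show "summand J M j (r \<odot>\<^bsub>M j\<^esub> x) = r \<odot>\<^bsub>S\<^esub> summand J M j x"
    proof (rule direct_sum_eqI)
      fix i assume i: "i \<in> J"
      interpret Mi: Module.module R "M i" using modules i .
      show "summand J M j (r \<odot>\<^bsub>M j\<^esub> x) i = (r \<odot>\<^bsub>S\<^esub> summand J M j x) i"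
        using i rx by (simp add: summand_apply smult_direct_sum)
    qed (use assms rx in \<open>simp_all add: summand_closed\<close>)
  qed (use assms in \<open>simp add: summand_closed\<close>)
qed

lemma projection_linear:
  assumes "j \<in> J"
  shows "(\<lambda>c\<in>carrier S. c j) \<in> linear_maps R S (M j)"
  by (rule linear_maps_restrictI[OF module_direct_sum])
    (use assms in \<open>auto simp: direct_sum_apply add_direct_sum smult_direct_sum\<close>)

lemma finsum_apply:
  assumes "j \<in> J" "g \<in> A \<rightarrow> carrier S"
  shows "(\<Oplus>\<^bsub>S\<^esub>i\<in>A. g i) j = (\<Oplus>\<^bsub>M j\<^esub>i\<in>A. g i j)"
proof -
  interpret Mj: Module.module R "M j" using modules assms(1) .
  have "(\<Oplus>\<^bsub>S\<^esub>i\<in>A. g i) j = (\<lambda>c\<in>carrier S. c j) (\<Oplus>\<^bsub>S\<^esub>i\<in>A. g i)"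
    using assms by (simp add: S.finsum_closed)
  also have "\<dots> = (\<Oplus>\<^bsub>M j\<^esub>i\<in>A. (\<lambda>c\<in>carrier S. c j) (g i))"
    using linear_maps_finsum[OF module_direct_sum modules projection_linear] assms by blast
  also have "\<dots> = (\<Oplus>\<^bsub>M j\<^esub>i\<in>A. g i j)"
    by (rule Mj.finsum_cong') (use assms direct_sum_apply in \<open>auto simp: Pi_iff\<close>)
  finally show ?thesis .
qed

lemma direct_sum_decomp:
  assumes c: "c \<in> carrier S"
  shows "c = (\<Oplus>\<^bsub>S\<^esub>i\<in>{i \<in> J. c i \<noteq> \<zero>\<^bsub>M i\<^esub>}. summand J M i (c i))"
    (is "c = (\<Oplus>\<^bsub>S\<^esub>i\<in>?A. ?s i)")
proof (rule direct_sum_eqI[OF c])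
  have s: "?s \<in> ?A \<rightarrow> carrier S" using c by (auto intro!: summand_closed direct_sum_apply)
  then show "(\<Oplus>\<^bsub>S\<^esub>i\<in>?A. ?s i) \<in> carrier S" by (rule S.finsum_closed)
  fix j assume j: "j \<in> J"
  interpret Mj: Module.module R "M j" using modules j .
  have fin: "finite ?A" using c by (simp add: carrier_direct_sum_iff)
  have "(\<Oplus>\<^bsub>S\<^esub>i\<in>?A. ?s i) j = (\<Oplus>\<^bsub>M j\<^esub>i\<in>?A. ?s i j)" using finsum_apply[OF j s] .
  also have "\<dots> = (\<Oplus>\<^bsub>M j\<^esub>i\<in>?A. if i = j then c j else \<zero>\<^bsub>M j\<^esub>)"
    by (rule Mj.finsum_cong') (use c j direct_sum_apply in \<open>auto simp: summand_apply Pi_iff\<close>)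
  also have "\<dots> = c j"
  \<comment> \<open>If \<open>c j\<close> is zero, then j lies outside the support and no term
    survives; otherwise exactly one does.\<close>
  proof (cases "c j = \<zero>\<^bsub>M j\<^esub>")
    case True
    then have "(\<Oplus>\<^bsub>M j\<^esub>i\<in>?A. if i = j then c j else \<zero>\<^bsub>M j\<^esub>) = \<zero>\<^bsub>M j\<^esub>"
      by (intro Mj.add.finprod_one_eqI) auto
    with True show ?thesis by simp
  next
    case False
    then show ?thesis
      using Mj.add.finprod_singleton_swap[of j ?A "\<lambda>_. c j"] fin c j direct_sum_apply by auto
  qed
  finally show "c j = (\<Oplus>\<^bsub>S\<^esub>i\<in>?A. ?s i) j" ..
qed

lemma direct_sum_map_eqI:
  assumes N: "Module.module R N" and f: "f \<in> linear_maps R S N" and g: "g \<in> linear_maps R S N"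
    and eq: "\<And>j x. \<lbrakk>j \<in> J; x \<in> carrier (M j)\<rbrakk> \<Longrightarrow> f (summand J M j x) = g (summand J M j x)"
  shows "f = g"
proof (rule linear_maps_eqI[OF f g])
  fix c assume c: "c \<in> carrier S"
  interpret N: Module.module R N by fact
  let ?A = "{i \<in> J. c i \<noteq> \<zero>\<^bsub>M i\<^esub>}"
  have s: "(\<lambda>i. summand J M i (c i)) \<in> ?A \<rightarrow> carrier S"
    using c by (auto intro!: summand_closed direct_sum_apply)
  have "(\<Oplus>\<^bsub>N\<^esub>i\<in>?A. f (summand J M i (c i))) = (\<Oplus>\<^bsub>N\<^esub>i\<in>?A. g (summand J M i (c i)))"
    by (rule N.finsum_cong')
      (use c linear_maps_closed[OF g] in \<open>auto simp: Pi_iff intro!: eq summand_closed direct_sum_apply\<close>)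
  then show "f c = g c"
    using linear_maps_finsum[OF module_direct_sum N f s] linear_maps_finsum[OF module_direct_sum N g s]
      direct_sum_decomp[OF c] by simp
qed

lemma
  assumes N: "Module.module R N"
    and u: "\<And>j. j \<in> J \<Longrightarrow> (\<lambda>x\<in>carrier (M j). u j x) \<in> linear_maps R (M j) N"
  defines "f \<equiv> \<lambda>c\<in>carrier S. \<Oplus>\<^bsub>N\<^esub>j\<in>{j \<in> J. c j \<noteq> \<zero>\<^bsub>M j\<^esub>}. u j (c j)"
  shows direct_sum_lift_linear: "f \<in> linear_maps R S N"
    and direct_sum_lift_summand: "\<lbrakk>j \<in> J; x \<in> carrier (M j)\<rbrakk> \<Longrightarrow> f (summand J M j x) = u j x"
proof -
  interpret N: Module.module R N by fact
  have uc: "u j x \<in> carrier N" if "j \<in> J" "x \<in> carrier (M j)" for j x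
    using linear_maps_closed[OF u[OF that(1)]] that by simp
  have u0: "u j \<zero>\<^bsub>M j\<^esub> = \<zero>\<^bsub>N\<^esub>" if "j \<in> J" for j
    using linear_maps_zero[OF modules[OF that] N u[OF that]] that by simp
  \<comment> \<open>The sum may be taken over any finite set containing the support. This gives
    elements with different supports, such as c, d and their sum, a common index set.\<close>
  have f: "f c = (\<Oplus>\<^bsub>N\<^esub>j\<in>A. u j (c j))"
    if "c \<in> carrier S" "finite A" "A \<subseteq> J" "{j \<in> J. c j \<noteq> \<zero>\<^bsub>M j\<^esub>} \<subseteq> A" for c A
  proof -
    have "f c = (\<Oplus>\<^bsub>N\<^esub>j\<in>{j \<in> J. c j \<noteq> \<zero>\<^bsub>M j\<^esub>}. u j (c j))" using that by (simp add: f_def)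
    also have "\<dots> = (\<Oplus>\<^bsub>N\<^esub>j\<in>A. u j (c j))"
      by (rule N.add.finprod_mono_neutral_cong_left)
        (use that direct_sum_apply in \<open>auto simp: Pi_iff u0 intro!: uc\<close>)
    finally show ?thesis .
  qed
  have u_add: "u j (x \<oplus>\<^bsub>M j\<^esub> y) = u j x \<oplus>\<^bsub>N\<^esub> u j y"
    if "j \<in> J" "x \<in> carrier (M j)" "y \<in> carrier (M j)" for j x y
    using linear_maps_add[OF u[OF that(1)]] that abelian_group_summand
    by (simp add: abelian_group_def abelian_monoid.a_closed)
  have u_smult: "u j (r \<odot>\<^bsub>M j\<^esub> x) = r \<odot>\<^bsub>N\<^esub> u j x"
    if "j \<in> J" "r \<in> carrier R" "x \<in> carrier (M j)" for j r x
    using linear_maps_smult[OF u[OF that(1)]] that module.smult_closed[OF modules[OF that(1)]] by simp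
  show "f \<in> linear_maps R S N"
  proof (rule linear_mapsI)
    fix c assume c: "c \<in> carrier S"
    then show "f c \<in> carrier N" unfolding f_def
      by (auto intro!: N.finsum_closed uc direct_sum_apply)
    fix r assume r: "r \<in> carrier R"
    let ?A = "{j \<in> J. c j \<noteq> \<zero>\<^bsub>M j\<^esub>}"
    have fin: "finite ?A" using c by (simp add: carrier_direct_sum_iff)
    have sub: "{j \<in> J. (r \<odot>\<^bsub>S\<^esub> c) j \<noteq> \<zero>\<^bsub>M j\<^esub>} \<subseteq> ?A"
      using r by (auto simp: smult_direct_sum smult_zero_summand)
    have "f (r \<odot>\<^bsub>S\<^esub> c) = (\<Oplus>\<^bsub>N\<^esub>j\<in>?A. u j ((r \<odot>\<^bsub>S\<^esub> c) j))"
      by (rule f) (use c r fin sub in auto)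
    also have "\<dots> = (\<Oplus>\<^bsub>N\<^esub>j\<in>?A. r \<odot>\<^bsub>N\<^esub> u j (c j))"
      by (rule N.finsum_cong')
        (use c r direct_sum_apply in \<open>auto simp: Pi_iff smult_direct_sum u_smult intro!: uc\<close>)
    also have "\<dots> = r \<odot>\<^bsub>N\<^esub> f c"
      using c r fin direct_sum_apply
      by (subst N.finsum_smult_ldistr[symmetric]) (auto simp: Pi_iff f_def intro!: uc)
    finally show "f (r \<odot>\<^bsub>S\<^esub> c) = r \<odot>\<^bsub>N\<^esub> f c" .
  next
    fix c d assume cd: "c \<in> carrier S" "d \<in> carrier S"
    let ?A = "{j \<in> J. c j \<noteq> \<zero>\<^bsub>M j\<^esub>} \<union> {j \<in> J. d j \<noteq> \<zero>\<^bsub>M j\<^esub>}"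
    have fin: "finite ?A" using cd by (simp add: carrier_direct_sum_iff)
    have sub: "{j \<in> J. (c \<oplus>\<^bsub>S\<^esub> d) j \<noteq> \<zero>\<^bsub>M j\<^esub>} \<subseteq> ?A"
      by (auto simp: add_direct_sum zero_add_zero_summand)
    have "f (c \<oplus>\<^bsub>S\<^esub> d) = (\<Oplus>\<^bsub>N\<^esub>j\<in>?A. u j ((c \<oplus>\<^bsub>S\<^esub> d) j))"
      by (rule f) (use cd fin sub in auto)
    also have "\<dots> = (\<Oplus>\<^bsub>N\<^esub>j\<in>?A. u j (c j) \<oplus>\<^bsub>N\<^esub> u j (d j))"
      by (rule N.finsum_cong')
        (use cd direct_sum_apply in \<open>auto simp: Pi_iff add_direct_sum u_add intro!: uc\<close>)
    also have "\<dots> = (\<Oplus>\<^bsub>N\<^esub>j\<in>?A. u j (c j)) \<oplus>\<^bsub>N\<^esub> (\<Oplus>\<^bsub>N\<^esub>j\<in>?A. u j (d j))"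
      by (rule N.finsum_addf) (use cd direct_sum_apply in \<open>auto intro!: uc\<close>)
    also have "(\<Oplus>\<^bsub>N\<^esub>j\<in>?A. u j (c j)) = f c" by (rule f[symmetric]) (use cd fin in auto)
    also have "(\<Oplus>\<^bsub>N\<^esub>j\<in>?A. u j (d j)) = f d" by (rule f[symmetric]) (use cd fin in auto)
    finally show "f (c \<oplus>\<^bsub>S\<^esub> d) = f c \<oplus>\<^bsub>N\<^esub> f d" .
  qed (simp add: f_def)
  assume jx: "j \<in> J" "x \<in> carrier (M j)"
  have "f (summand J M j x) = (\<Oplus>\<^bsub>N\<^esub>i\<in>{j}. u i (summand J M j x i))"
    by (rule f) (use jx in \<open>auto simp: summand_closed summand_apply split: if_splits\<close>)
  also have "\<dots> = u j x" using jx by (simp add: summand_apply uc)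
  finally show "f (summand J M j x) = u j x" .
qed

end

section \<open>Free modules\<close>

lemma regular_module_simps [simp]:
  "carrier (regular_module R) = carrier R" "zero (regular_module R) = zero R"
  "add (regular_module R) = add R" "smult (regular_module R) = mult R"
  by (simp_all add: regular_module_def)

lemma (in cring) module_regular_module: "Module.module R (regular_module R)"
proof (rule moduleI)
  show "abelian_group (regular_module R)"
  proof (rule abelian_groupI)
    fix x assume "x \<in> carrier (regular_module R)"
    then show "\<exists>y\<in>carrier (regular_module R). y \<oplus>\<^bsub>regular_module R\<^esub> x = \<zero>\<^bsub>regular_module R\<^esub>"
      using l_neg by auto
  qed (auto simp: a_ac)
qed (auto simp: l_distr r_distr m_assoc is_cring)

locale free_module_on = cring R for R :: "('r, 'z) ring_scheme" +
  fixes J :: "'j set"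
begin

sublocale module_direct_sum R J "\<lambda>_. regular_module R"
  by (intro module_direct_sum.intro module_direct_sum_axioms.intro cring_axioms module_regular_module)

lemma module_free_module: "Module.module R (free_module R J)"
  unfolding free_module_def by (rule module_direct_sum)

lemma basis_element_closed: "j \<in> J \<Longrightarrow> basis_element R J j \<in> carrier (free_module R J)"
  unfolding free_module_def basis_element_def
  by (rule summand_closed) auto

lemma summand_eq_smult_basis_element:
  assumes "j \<in> J" "r \<in> carrier R"
  shows "summand J (\<lambda>_. regular_module R) j r = r \<odot>\<^bsub>free_module R J\<^esub> basis_element R J j"
  using linear_maps_smult[OF summand_linear[OF assms(1)], of r "\<one>\<^bsub>R\<^esub>"] assms
  by (simp add: free_module_def basis_element_def)

lemma free_module_map_eqI:
  assumes "Module.module R N" "f \<in> linear_maps R (free_module R J) N" "g \<in> linear_maps R (free_module R J) N"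
    and "\<And>j. j \<in> J \<Longrightarrow> f (basis_element R J j) = g (basis_element R J j)"
  shows "f = g"
proof (rule direct_sum_map_eqI[OF assms(1) assms(2,3)[unfolded free_module_def]])
  fix j r assume "j \<in> J" "r \<in> carrier (regular_module R)"
  then show "f (summand J (\<lambda>_. regular_module R) j r) = g (summand J (\<lambda>_. regular_module R) j r)"
    using assms(4) linear_maps_smult[OF assms(2)] linear_maps_smult[OF assms(3)] basis_element_closed
    by (simp add: summand_eq_smult_basis_element)
qed

lemma free_module_lift:
  assumes "Module.module R N" and u: "\<And>j. j \<in> J \<Longrightarrow> u j \<in> carrier N"
  obtains f where "f \<in> linear_maps R (free_module R J) N" "\<And>j. j \<in> J \<Longrightarrow> f (basis_element R J j) = u j"
proof -
  interpret N: Module.module R N by fact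
  have lin: "(\<lambda>r\<in>carrier (regular_module R). r \<odot>\<^bsub>N\<^esub> u j) \<in> linear_maps R (regular_module R) N"
    if "j \<in> J" for j
    by (rule linear_maps_restrictI[OF module_regular_module])
      (use u[OF that] in \<open>auto simp: N.smult_l_distr N.smult_assoc1\<close>)
  define f where "f = (\<lambda>c\<in>carrier S. \<Oplus>\<^bsub>N\<^esub>j\<in>{j \<in> J. c j \<noteq> \<zero>\<^bsub>regular_module R\<^esub>}. c j \<odot>\<^bsub>N\<^esub> u j)"
  have "f \<in> linear_maps R S N"
    unfolding f_def by (rule direct_sum_lift_linear[OF assms(1) lin])
  moreover have "f (summand J (\<lambda>_. regular_module R) j \<one>\<^bsub>R\<^esub>) = u j" if "j \<in> J" for j
    using direct_sum_lift_summand[OF assms(1) lin that, where x = "\<one>\<^bsub>R\<^esub>"] u[OF that]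
    by (simp add: f_def)
  ultimately show ?thesis using that by (simp add: free_module_def basis_element_def)
qed

end

section \<open>The universal property of the tensor product\<close>

text \<open>Phrased by updating one coordinate of a family, so that the conditions correspond
  directly to the generators in \<open>tensor_relations\<close>.\<close>

definition multilinear ::
  "('r, 'z) ring_scheme \<Rightarrow> 'i set \<Rightarrow> ('i \<Rightarrow> ('r, 'a) module) \<Rightarrow> ('r, 'b) module \<Rightarrow> (('i \<Rightarrow> 'a) \<Rightarrow> 'b) \<Rightarrow> bool"
  where "multilinear R I M N u \<longleftrightarrow>
    (\<forall>a\<in>\<Pi>\<^sub>E i\<in>I. carrier (M i). u a \<in> carrier N) \<and>
    (\<forall>a\<in>\<Pi>\<^sub>E i\<in>I. carrier (M i). \<forall>i\<in>I. \<forall>x\<in>carrier (M i).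
      (\<forall>y\<in>carrier (M i). u (a(i := x \<oplus>\<^bsub>M i\<^esub> y)) = u (a(i := x)) \<oplus>\<^bsub>N\<^esub> u (a(i := y))) \<and>
      (\<forall>r\<in>carrier R. u (a(i := r \<odot>\<^bsub>M i\<^esub> x)) = r \<odot>\<^bsub>N\<^esub> u (a(i := x))))"

locale tensor = cring R for R :: "('r, 'z) ring_scheme" +
  fixes I :: "'i set" and M :: "'i \<Rightarrow> ('r, 'a) module"
  assumes factor_modules: "i \<in> I \<Longrightarrow> Module.module R (M i)"
begin

abbreviation "X \<equiv> \<Pi>\<^sub>E i\<in>I. carrier (M i)"
abbreviation "T \<equiv> tensor_product R I M"
abbreviation "L \<equiv> free_module R X"
abbreviation "\<delta> \<equiv> basis_element R X"

sublocale free: free_module_on R X by unfold_locales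

sublocale L: Module.module R L by (rule free.module_free_module)

lemma fun_upd_PiE: "\<lbrakk>a \<in> X; i \<in> I; x \<in> carrier (M i)\<rbrakk> \<Longrightarrow> a(i := x) \<in> X"
  by (auto simp: PiE_iff extensional_def)

lemma factor_add_closed:
  "\<lbrakk>i \<in> I; x \<in> carrier (M i); y \<in> carrier (M i)\<rbrakk> \<Longrightarrow> x \<oplus>\<^bsub>M i\<^esub> y \<in> carrier (M i)"
  using factor_modules by (meson abelian_group_def abelian_monoid.a_closed module.axioms(2))

lemma factor_smult_closed:
  "\<lbrakk>i \<in> I; r \<in> carrier R; x \<in> carrier (M i)\<rbrakk> \<Longrightarrow> r \<odot>\<^bsub>M i\<^esub> x \<in> carrier (M i)"
  using factor_modules module.smult_closed by metis

lemma tensor_relations_iff: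
  "c \<in> tensor_relations R I M \<longleftrightarrow>
    (\<exists>a i x y. c = \<delta> (a(i := x \<oplus>\<^bsub>M i\<^esub> y)) \<ominus>\<^bsub>L\<^esub> (\<delta> (a(i := x)) \<oplus>\<^bsub>L\<^esub> \<delta> (a(i := y))) \<and>
      a \<in> X \<and> i \<in> I \<and> x \<in> carrier (M i) \<and> y \<in> carrier (M i)) \<or>
    (\<exists>a i r x. c = \<delta> (a(i := r \<odot>\<^bsub>M i\<^esub> x)) \<ominus>\<^bsub>L\<^esub> (r \<odot>\<^bsub>L\<^esub> \<delta> (a(i := x))) \<and>
      a \<in> X \<and> i \<in> I \<and> r \<in> carrier R \<and> x \<in> carrier (M i))"
  by (simp only: tensor_relations_def Let_def Un_iff mem_Collect_eq)

lemma relations_subset: "tensor_relations R I M \<subseteq> carrier L"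
  unfolding subset_iff tensor_relations_iff
  by (auto intro!: L.M.minus_closed L.M.a_closed L.smult_closed free.basis_element_closed fun_upd_PiE
      factor_add_closed factor_smult_closed)

sublocale quot: module_quotient R L "tensor_null R I M"
  by (intro module_quotient.intro module_quotient_axioms.intro L.module_axioms)
    (simp add: tensor_null_def generated_submodule_submodule[OF L.module_axioms relations_subset])

lemma module_tensor: "Module.module R T"
  unfolding tensor_product_def by (rule quot.module_quotient)

lemma pure_tensor_closed: "a \<in> X \<Longrightarrow> pure_tensor R I M a \<in> carrier T"
  by (simp add: tensor_product_def pure_tensor_def quot.carrier_quotient free.basis_element_closed)

lemma pure_tensor_multilinear: "multilinear R I M T (pure_tensor R I M)"
  unfolding multilinear_def
proof (intro conjI ballI)
  fix a i x assume a: "a \<in> X" "i \<in> I" "x \<in> carrier (M i)"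
  note cl = free.basis_element_closed fun_upd_PiE factor_add_closed factor_smult_closed
  {
    fix y assume y: "y \<in> carrier (M i)"
    have "\<delta> (a(i := x \<oplus>\<^bsub>M i\<^esub> y)) \<ominus>\<^bsub>L\<^esub> (\<delta> (a(i := x)) \<oplus>\<^bsub>L\<^esub> \<delta> (a(i := y))) \<in> tensor_relations R I M"
      by (rule tensor_relations_iff[THEN iffD2], rule disjI1, rule exI[of _ a], rule exI[of _ i],
          rule exI[of _ x], rule exI[of _ y]) (simp only: a y simp_thms)
    then have "\<delta> (a(i := x \<oplus>\<^bsub>M i\<^esub> y)) \<ominus>\<^bsub>L\<^esub> (\<delta> (a(i := x)) \<oplus>\<^bsub>L\<^esub> \<delta> (a(i := y))) \<in> tensor_null R I M"
      unfolding tensor_null_def by (rule subsetD[OF generated_submodule_superset])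
    then show "pure_tensor R I M (a(i := x \<oplus>\<^bsub>M i\<^esub> y)) =
        pure_tensor R I M (a(i := x)) \<oplus>\<^bsub>T\<^esub> pure_tensor R I M (a(i := y))"
      using a y by (simp add: tensor_product_def pure_tensor_def quot.add_quotient quot.coset_eq_iff cl
          del: fun_upd_apply)
  next
    fix r assume r: "r \<in> carrier R"
    have "\<delta> (a(i := r \<odot>\<^bsub>M i\<^esub> x)) \<ominus>\<^bsub>L\<^esub> (r \<odot>\<^bsub>L\<^esub> \<delta> (a(i := x))) \<in> tensor_relations R I M"
      by (rule tensor_relations_iff[THEN iffD2], rule disjI2, rule exI[of _ a], rule exI[of _ i],
          rule exI[of _ r], rule exI[of _ x]) (simp only: a r simp_thms)
    then have "\<delta> (a(i := r \<odot>\<^bsub>M i\<^esub> x)) \<ominus>\<^bsub>L\<^esub> (r \<odot>\<^bsub>L\<^esub> \<delta> (a(i := x))) \<in> tensor_null R I M"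
      unfolding tensor_null_def by (rule subsetD[OF generated_submodule_superset])
    then show "pure_tensor R I M (a(i := r \<odot>\<^bsub>M i\<^esub> x)) = r \<odot>\<^bsub>T\<^esub> pure_tensor R I M (a(i := x))"
      using a r by (simp add: tensor_product_def pure_tensor_def quot.smult_quotient quot.coset_eq_iff cl
          del: fun_upd_apply)
  }
qed (rule pure_tensor_closed)

text \<open>Both maps are pulled back along the quotient map to the free module, where a linear map
  is determined by its values on basis elements.\<close>

lemma tensor_map_eqI:
  assumes N: "Module.module R N" and f: "f \<in> linear_maps R T N" and g: "g \<in> linear_maps R T N"
    and eq: "\<And>a. a \<in> X \<Longrightarrow> f (pure_tensor R I M a) = g (pure_tensor R I M a)"
  shows "f = g"
proof -
  let ?p = "\<lambda>x\<in>carrier L. tensor_null R I M +>\<^bsub>L\<^esub> x"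
  have "compose (carrier L) f ?p = compose (carrier L) g ?p"
  proof (rule free.free_module_map_eqI[OF N])
    show "compose (carrier L) f ?p \<in> linear_maps R L N"
      by (rule linear_maps_compose[OF L.module_axioms quot.coset_linear f[unfolded tensor_product_def]])
    show "compose (carrier L) g ?p \<in> linear_maps R L N"
      by (rule linear_maps_compose[OF L.module_axioms quot.coset_linear g[unfolded tensor_product_def]])
    fix a assume "a \<in> X"
    then show "compose (carrier L) f ?p (\<delta> a) = compose (carrier L) g ?p (\<delta> a)"
      using eq[of a] by (simp add: compose_eq pure_tensor_def free.basis_element_closed)
  qed
  then have "f (tensor_null R I M +>\<^bsub>L\<^esub> x) = g (tensor_null R I M +>\<^bsub>L\<^esub> x)" if "x \<in> carrier L" for x
    using that by (auto dest: fun_cong[where x = x] simp: compose_eq)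
  then show ?thesis
    by (rule quot.quotient_eqI[OF f[unfolded tensor_product_def] g[unfolded tensor_product_def]])
qed

text \<open>\<open>tensor_lift\<close> is a definite description, so unique existence has to come
  first. The linear extension of u to the free module vanishes on the relations by multilinearity;
  its kernel is a submodule and hence contains \<open>tensor_null\<close>, so the extension factors
  through the quotient. Uniqueness is \<open>tensor_map_eqI\<close>.\<close>

lemma
  assumes N: "Module.module R N" and u: "multilinear R I M N u"
  shows tensor_lift_linear: "tensor_lift R I M N u \<in> linear_maps R T N"
    and tensor_lift_pure: "a \<in> X \<Longrightarrow> tensor_lift R I M N u (pure_tensor R I M a) = u a"
proof -
  interpret N: Module.module R N by fact
  obtain f where f: "f \<in> linear_maps R L N" and f\<delta>: "\<And>a. a \<in> X \<Longrightarrow> f (\<delta> a) = u a"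
    using free.free_module_lift[OF N, of u] u by (auto simp: multilinear_def)
  interpret f: abelian_group_hom L N f
    by (rule linear_maps_abelian_group_hom[OF L.module_axioms N f])
  note cl = free.basis_element_closed fun_upd_PiE factor_add_closed factor_smult_closed
  let ?K = "{c \<in> carrier L. f c = \<zero>\<^bsub>N\<^esub>}"
  have "submodule ?K R L"
    by (rule L.submoduleI) (auto simp: linear_maps_smult[OF f])
  moreover have "tensor_relations R I M \<subseteq> ?K"
  proof -
    have f_minus: "f (x \<ominus>\<^bsub>L\<^esub> y) = \<zero>\<^bsub>N\<^esub>" if "x \<in> carrier L" "y \<in> carrier L" "f x = f y" for x y
      using that f.hom_closed[of y] by (simp add: L.M.minus_eq N.r_neg del: f.hom_closed)
    have uc: "u a \<in> carrier N" if "a \<in> X" for a using u that by (simp add: multilinear_def)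
    have "f (\<delta> (a(i := x \<oplus>\<^bsub>M i\<^esub> y)) \<ominus>\<^bsub>L\<^esub> (\<delta> (a(i := x)) \<oplus>\<^bsub>L\<^esub> \<delta> (a(i := y)))) = \<zero>\<^bsub>N\<^esub>"
      if "a \<in> X" "i \<in> I" "x \<in> carrier (M i)" "y \<in> carrier (M i)" for a i x y
      by (rule f_minus) (use that u in \<open>simp_all add: cl f\<delta> multilinear_def del: fun_upd_apply\<close>)
    moreover have "f (\<delta> (a(i := r \<odot>\<^bsub>M i\<^esub> x)) \<ominus>\<^bsub>L\<^esub> (r \<odot>\<^bsub>L\<^esub> \<delta> (a(i := x)))) = \<zero>\<^bsub>N\<^esub>"
      if "a \<in> X" "i \<in> I" "x \<in> carrier (M i)" "r \<in> carrier R" for a i x r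
      by (rule f_minus)
        (use that u in \<open>simp_all add: cl f\<delta> multilinear_def linear_maps_smult[OF f] del: fun_upd_apply\<close>)
    ultimately have "tensor_relations R I M \<subseteq> {c. f c = \<zero>\<^bsub>N\<^esub>}"
      unfolding subset_iff tensor_relations_iff mem_Collect_eq
      by (intro allI impI, elim disjE exE conjE) (simp_all only:)
    then show ?thesis using relations_subset by blast
  qed
  ultimately have "tensor_null R I M \<subseteq> ?K"
    unfolding tensor_null_def by (rule generated_submodule_least)
  then have "f x = \<zero>\<^bsub>N\<^esub>" if "x \<in> tensor_null R I M" for x using that by blast
  then have "\<exists>g\<in>linear_maps R T N. \<forall>x\<in>carrier L. g (tensor_null R I M +>\<^bsub>L\<^esub> x) = f x"
    unfolding tensor_product_def by (rule quot.quotient_lift[OF N f])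
  then obtain g where g: "g \<in> linear_maps R T N"
    and "\<forall>x\<in>carrier L. g (tensor_null R I M +>\<^bsub>L\<^esub> x) = f x" ..
  then have "\<forall>a\<in>X. g (pure_tensor R I M a) = u a"
    by (auto simp: pure_tensor_def f\<delta> free.basis_element_closed)
  with g have "\<exists>!g. g \<in> linear_maps R T N \<and> (\<forall>a\<in>X. g (pure_tensor R I M a) = u a)"
    by (intro ex1I[of _ g]) (auto intro!: tensor_map_eqI[OF N])
  from theI'[OF this]
  show "tensor_lift R I M N u \<in> linear_maps R T N"
    and "a \<in> X \<Longrightarrow> tensor_lift R I M N u (pure_tensor R I M a) = u a"
    by (auto simp: tensor_lift_def)
qed

end

section \<open>Homology of a poset with coefficients\<close>

definition signed :: "('a, 'm) ring_scheme \<Rightarrow> nat \<Rightarrow> 'a \<Rightarrow> 'a"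
  where "signed G i x = (if even i then x else \<ominus>\<^bsub>G\<^esub> x)"

context abelian_group
begin

lemma signed_closed: "x \<in> carrier G \<Longrightarrow> signed G i x \<in> carrier G"
  by (simp add: signed_def)

lemma signed_signed: "x \<in> carrier G \<Longrightarrow> signed G i (signed G j x) = signed G (i + j) x"
  by (simp add: signed_def)

lemma signed_Suc: "x \<in> carrier G \<Longrightarrow> signed G i x \<oplus> signed G (Suc i) x = \<zero>"
  by (simp add: signed_def r_neg l_neg)

lemma signed_add:
  "\<lbrakk>x \<in> carrier G; y \<in> carrier G\<rbrakk> \<Longrightarrow> signed G i (x \<oplus> y) = signed G i x \<oplus> signed G i y"
  by (simp add: signed_def minus_add)

lemma signed_finsum:
  assumes "f \<in> A \<rightarrow> carrier G"
  shows "signed G i (\<Oplus>j\<in>A. f j) = (\<Oplus>j\<in>A. signed G i (f j))"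
  using assms
proof (induction A rule: infinite_finite_induct)
  case (insert a A)
  then have "f a \<in> carrier G" "f \<in> A \<rightarrow> carrier G" "(\<lambda>j. signed G i (f j)) \<in> A \<rightarrow> carrier G"
    by (auto simp: Pi_iff intro!: signed_closed)
  with insert show ?case
    by (simp add: Pi_iff signed_add signed_closed finsum_closed)
qed (simp_all add: signed_def)

text \<open>The cancellation behind \<open>d \<circ> d = 0\<close>: the term at \<open>(i, j)\<close> with \<open>i \<le> j\<close> cancels the one at
  \<open>(j + 1, i)\<close>.\<close>

lemma alternating_double_sum:
  assumes "\<And>i j. \<lbrakk>i \<le> m; j < m\<rbrakk> \<Longrightarrow> E i j \<in> carrier G"
    and "\<And>i j. \<lbrakk>i \<le> j; j < m\<rbrakk> \<Longrightarrow> E i j = E (Suc j) i"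
  shows "(\<Oplus>i\<in>{..m}. \<Oplus>j\<in>{..<m}. signed G (i + j) (E i j)) = \<zero>"
  using assms
proof (induction m)
  case (Suc m)
  let ?g = "\<lambda>i j. signed G (i + j) (E i j)"
  have g: "?g i j \<in> carrier G" if "i \<le> Suc m" "j \<le> m" for i j
    using that Suc.prems(1) by (simp add: signed_closed)
  have s: "(\<Oplus>j\<in>{..<m}. ?g i j) \<in> carrier G" if "i \<le> Suc m" for i
    using that g by (intro finsum_closed) auto
  \<comment> \<open>Enlarging m adds the row with first index \<open>Suc m\<close> and the column
    with second index m. The entry at (i, m) cancels the one at (\<open>Suc m\<close>, i), and the
    rest is the induction hypothesis.\<close>
  have "(\<Oplus>i\<in>{..Suc m}. \<Oplus>j\<in>{..<Suc m}. ?g i j)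
      = (\<Oplus>j\<in>{..m}. ?g (Suc m) j) \<oplus> (\<Oplus>i\<in>{..m}. \<Oplus>j\<in>{..<Suc m}. ?g i j)"
    unfolding lessThan_Suc_atMost by (intro finsum_Suc Pi_I finsum_closed g) auto
  also have "(\<Oplus>i\<in>{..m}. \<Oplus>j\<in>{..<Suc m}. ?g i j) = (\<Oplus>i\<in>{..m}. ?g i m \<oplus> (\<Oplus>j\<in>{..<m}. ?g i j))"
  proof (rule finsum_cong')
    fix i assume i: "i \<in> {..m}"
    then show "(\<Oplus>j\<in>{..<Suc m}. ?g i j) = ?g i m \<oplus> (\<Oplus>j\<in>{..<m}. ?g i j)"
      unfolding lessThan_Suc using g by (intro finsum_insert) auto
  qed (use g s in auto)
  also have "\<dots> = (\<Oplus>i\<in>{..m}. ?g i m) \<oplus> (\<Oplus>i\<in>{..m}. \<Oplus>j\<in>{..<m}. ?g i j)"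
    using g s by (intro finsum_addf) auto
  also have "(\<Oplus>i\<in>{..m}. \<Oplus>j\<in>{..<m}. ?g i j) = \<zero>"
    by (rule Suc.IH) (use Suc.prems in auto)
  also have "(\<Oplus>j\<in>{..m}. ?g (Suc m) j) \<oplus> ((\<Oplus>i\<in>{..m}. ?g i m) \<oplus> \<zero>)
      = (\<Oplus>i\<in>{..m}. ?g i m) \<oplus> (\<Oplus>j\<in>{..m}. ?g (Suc m) j)"
  proof -
    have "(\<Oplus>j\<in>{..m}. ?g (Suc m) j) \<in> carrier G" "(\<Oplus>i\<in>{..m}. ?g i m) \<in> carrier G"
      by (intro finsum_closed Pi_I g; simp)+
    then show ?thesis by (simp only: r_zero a_comm)
  qed
  also have "\<dots> = (\<Oplus>i\<in>{..m}. ?g i m \<oplus> ?g (Suc m) i)"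
    by (intro finsum_addf[symmetric] Pi_I g) auto
  also have "\<dots> = \<zero>"
  proof (rule add.finprod_one_eqI)
    fix i assume "i \<in> {..m}"
    then show "?g i m \<oplus> ?g (Suc m) i = \<zero>"
      using signed_Suc[of "E i m" "i + m"] Suc.prems(1)[of i m] Suc.prems(2)[of i m]
      by (simp add: add.commute)
  qed
  finally show ?case .
qed simp

end

lemma linear_maps_signed:
  assumes "Module.module R M" "Module.module R N" "f \<in> linear_maps R M N" "x \<in> carrier M"
  shows "f (signed M i x) = signed N i (f x)"
  using linear_maps_minus[OF assms] by (simp add: signed_def)

lemma linear_maps_sum:
  assumes M: "Module.module R M" and N: "Module.module R N" and A: "finite A"
    and g: "\<And>i. i \<in> A \<Longrightarrow> (\<lambda>v\<in>carrier M. g i v) \<in> linear_maps R M N"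
  shows "(\<lambda>v\<in>carrier M. \<Oplus>\<^bsub>N\<^esub>i\<in>A. g i v) \<in> linear_maps R M N"
proof -
  interpret M: Module.module R M by fact
  interpret N: Module.module R N by fact
  have closed: "g i v \<in> carrier N" if "i \<in> A" "v \<in> carrier M" for i v
    using linear_maps_closed[OF g] that by auto
  have add: "g i (v \<oplus>\<^bsub>M\<^esub> w) = g i v \<oplus>\<^bsub>N\<^esub> g i w" if "i \<in> A" "v \<in> carrier M" "w \<in> carrier M" for i v w
    using linear_maps_add[OF g[OF that(1)], of v w] that by simp
  have smult: "g i (r \<odot>\<^bsub>M\<^esub> v) = r \<odot>\<^bsub>N\<^esub> g i v" if "i \<in> A" "v \<in> carrier M" "r \<in> carrier R" for i r v
    using linear_maps_smult[OF g[OF that(1)], of r v] that by simp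
  show ?thesis
  proof (rule linear_maps_restrictI[OF M])
    fix v w assume vw: "v \<in> carrier M" "w \<in> carrier M"
    have "(\<Oplus>\<^bsub>N\<^esub>i\<in>A. g i (v \<oplus>\<^bsub>M\<^esub> w)) = (\<Oplus>\<^bsub>N\<^esub>i\<in>A. g i v \<oplus>\<^bsub>N\<^esub> g i w)"
      by (rule N.finsum_cong') (use vw add closed in auto)
    also have "\<dots> = (\<Oplus>\<^bsub>N\<^esub>i\<in>A. g i v) \<oplus>\<^bsub>N\<^esub> (\<Oplus>\<^bsub>N\<^esub>i\<in>A. g i w)"
      by (rule N.finsum_addf) (use vw closed in auto)
    finally show "(\<Oplus>\<^bsub>N\<^esub>i\<in>A. g i (v \<oplus>\<^bsub>M\<^esub> w)) = (\<Oplus>\<^bsub>N\<^esub>i\<in>A. g i v) \<oplus>\<^bsub>N\<^esub> (\<Oplus>\<^bsub>N\<^esub>i\<in>A. g i w)" .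
  next
    fix r v assume rv: "r \<in> carrier R" "v \<in> carrier M"
    have "(\<Oplus>\<^bsub>N\<^esub>i\<in>A. g i (r \<odot>\<^bsub>M\<^esub> v)) = (\<Oplus>\<^bsub>N\<^esub>i\<in>A. r \<odot>\<^bsub>N\<^esub> g i v)"
      by (rule N.finsum_cong') (use rv smult closed in auto)
    also have "\<dots> = r \<odot>\<^bsub>N\<^esub> (\<Oplus>\<^bsub>N\<^esub>i\<in>A. g i v)"
      by (rule N.finsum_smult_ldistr[symmetric]) (use rv A closed in auto)
    finally show "(\<Oplus>\<^bsub>N\<^esub>i\<in>A. g i (r \<odot>\<^bsub>M\<^esub> v)) = r \<odot>\<^bsub>N\<^esub> (\<Oplus>\<^bsub>N\<^esub>i\<in>A. g i v)" .
  qed (use closed in \<open>auto intro: N.finsum_closed\<close>)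
qed

lemma linear_maps_signed_map:
  assumes M: "Module.module R M" and N: "Module.module R N"
    and g: "(\<lambda>v\<in>carrier M. g v) \<in> linear_maps R M N"
  shows "(\<lambda>v\<in>carrier M. signed N i (g v)) \<in> linear_maps R M N"
proof -
  interpret M: Module.module R M by fact
  interpret N: Module.module R N by fact
  have closed: "g v \<in> carrier N" if "v \<in> carrier M" for v
    using linear_maps_closed[OF g] that by auto
  have add: "g (v \<oplus>\<^bsub>M\<^esub> w) = g v \<oplus>\<^bsub>N\<^esub> g w" if "v \<in> carrier M" "w \<in> carrier M" for v w
    using linear_maps_add[OF g, of v w] that by simp
  have smult: "g (r \<odot>\<^bsub>M\<^esub> v) = r \<odot>\<^bsub>N\<^esub> g v" if "v \<in> carrier M" "r \<in> carrier R" for r v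
    using linear_maps_smult[OF g, of r v] that by simp
  show ?thesis
    by (rule linear_maps_restrictI[OF M])
      (simp_all add: closed add smult N.signed_closed N.signed_add signed_def N.smult_r_minus
        N.minus_add)
qed

lemma linear_maps_zero_map:
  assumes "Module.module R M" "Module.module R N"
  shows "(\<lambda>v\<in>carrier M. \<zero>\<^bsub>N\<^esub>) \<in> linear_maps R M N"
proof -
  interpret N: Module.module R N by fact
  show ?thesis by (rule linear_maps_restrictI[OF assms(1)]) simp_all
qed

section \<open>Faces of simplices\<close>

definition face :: "nat \<Rightarrow> 'p list \<Rightarrow> 'p list"
  where "face i xs = take i xs @ drop (Suc i) xs"

lemma face_0: "face 0 xs = tl xs"
  by (simp add: face_def drop_Suc)

lemma length_face: "i < length xs \<Longrightarrow> length (face i xs) = length xs - 1"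
  by (simp add: face_def)

lemma nth_face:
  "\<lbrakk>i < length xs; j < length xs - 1\<rbrakk> \<Longrightarrow> face i xs ! j = (if j < i then xs ! j else xs ! Suc j)"
  by (auto simp: face_def nth_append min_def)

lemma hd_face:
  "\<lbrakk>i < length xs; 2 \<le> length xs\<rbrakk> \<Longrightarrow> hd (face i xs) = (if i = 0 then xs ! 1 else xs ! 0)"
  using nth_face[of i xs 0] length_face[of i xs] by (subst hd_conv_nth) auto

lemma map_face: "map g (face i xs) = face i (map g xs)"
  by (simp add: face_def take_map drop_map)

text \<open>The simplicial identity in the indexing required by
  \<open>alternating_double_sum\<close>.\<close>

lemma face_face:
  assumes "i \<le> j" "Suc j < length xs"
  shows "face j (face i xs) = face i (face (Suc j) xs)"
  by (rule nth_equalityI) (use assms in \<open>auto simp: length_face nth_face\<close>)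

text \<open>Conditions by index instead of by list operations allow faces and images of simplices to
  be checked entry by entry.\<close>

lemma simplices_iff:
  "xs \<in> simplices P k \<longleftrightarrow> xs \<noteq> [] \<and> int (length xs) = k + 1 \<and> (\<forall>i<length xs. xs ! i \<in> P) \<and>
    (\<forall>i j. i \<le> j \<longrightarrow> j < length xs \<longrightarrow> xs ! i \<le> xs ! j)"
  unfolding simplices_def sorted_wrt_iff_nth_less
  by (auto simp: set_conv_nth le_less)

lemma hd_simplex: "xs \<in> simplices P k \<Longrightarrow> hd xs \<in> P"
  by (auto simp: simplices_def)

lemma face_simplex:
  assumes "xs \<in> simplices P k" "0 < k" "i < length xs"
  shows "face i xs \<in> simplices P (k - 1)"
proof -
  have "length (face i xs) = length xs - 1" using assms by (simp add: length_face)
  moreover have "2 \<le> length xs" using assms by (auto simp: simplices_iff)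
  ultimately show ?thesis
    using assms by (auto simp: simplices_iff nth_face)
qed

text \<open>The coefficient lives over the first vertex, and deleting that vertex is the only face
  operation that moves it.\<close>

definition face_coeff :: "('p \<Rightarrow> 'p \<Rightarrow> 'm \<Rightarrow> 'm) \<Rightarrow> nat \<Rightarrow> 'p list \<Rightarrow> 'm \<Rightarrow> 'm"
  where "face_coeff Fm i xs v = (if i = 0 then Fm (xs ! 0) (xs ! 1) v else v)"

section \<open>The chain complex of a functor on a poset\<close>

locale poset_functor = cring R for R :: "('r, 'z) ring_scheme" +
  fixes P :: "'p::order set" and Fo :: "'p \<Rightarrow> ('r, 'm) module" and Fm :: "'p \<Rightarrow> 'p \<Rightarrow> 'm \<Rightarrow> 'm"
  assumes Fo_module: "x \<in> P \<Longrightarrow> Module.module R (Fo x)"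
    and Fm_linear: "\<lbrakk>x \<in> P; y \<in> P; x \<le> y\<rbrakk> \<Longrightarrow> Fm x y \<in> linear_maps R (Fo x) (Fo y)"
    and Fm_comp: "\<lbrakk>x \<in> P; y \<in> P; z \<in> P; x \<le> y; y \<le> z; v \<in> carrier (Fo x)\<rbrakk>
      \<Longrightarrow> Fm y z (Fm x y v) = Fm x z v"
begin

abbreviation "C \<equiv> chain_module P Fo"
abbreviation "\<epsilon> \<equiv> elementary_chain P Fo"
abbreviation "d \<equiv> boundary P Fo Fm"
abbreviation "Z \<equiv> cycles P Fo Fm"
abbreviation "B \<equiv> boundaries P Fo Fm"

lemma direct_sum_chain: "module_direct_sum R (simplices P k) (\<lambda>xs. Fo (hd xs))"
  by (intro module_direct_sum.intro module_direct_sum_axioms.intro cring_axioms Fo_module hd_simplex)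

lemma module_chain: "Module.module R (C k)"
  unfolding chain_module_def by (rule module_direct_sum.module_direct_sum[OF direct_sum_chain])

lemma abelian_group_chain: "abelian_group (C k)"
  using module_chain by (rule module.axioms)

lemma elementary_chain_closed:
  "\<lbrakk>xs \<in> simplices P k; v \<in> carrier (Fo (hd xs))\<rbrakk> \<Longrightarrow> \<epsilon> k v xs \<in> carrier (C k)"
  unfolding chain_module_def elementary_chain_def
  by (rule module_direct_sum.summand_closed[OF direct_sum_chain])

lemma elementary_chain_linear:
  "xs \<in> simplices P k \<Longrightarrow> (\<lambda>v\<in>carrier (Fo (hd xs)). \<epsilon> k v xs) \<in> linear_maps R (Fo (hd xs)) (C k)"
  unfolding chain_module_def elementary_chain_def
  by (rule module_direct_sum.summand_linear[OF direct_sum_chain])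

lemma chain_map_eqI:
  assumes "Module.module R N" "f \<in> linear_maps R (C k) N" "g \<in> linear_maps R (C k) N"
    and "\<And>xs v. \<lbrakk>xs \<in> simplices P k; v \<in> carrier (Fo (hd xs))\<rbrakk> \<Longrightarrow> f (\<epsilon> k v xs) = g (\<epsilon> k v xs)"
  shows "f = g"
  using assms unfolding chain_module_def elementary_chain_def
  by (rule module_direct_sum.direct_sum_map_eqI[OF direct_sum_chain])

lemma
  assumes "Module.module R N"
    and "\<And>xs. xs \<in> simplices P k \<Longrightarrow> (\<lambda>v\<in>carrier (Fo (hd xs)). u v xs) \<in> linear_maps R (Fo (hd xs)) N"
  shows extend_linearly_linear: "extend_linearly P Fo k N u \<in> linear_maps R (C k) N"
    and extend_linearly_elementary:
      "\<lbrakk>xs \<in> simplices P k; v \<in> carrier (Fo (hd xs))\<rbrakk> \<Longrightarrow> extend_linearly P Fo k N u (\<epsilon> k v xs) = u v xs"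
proof -
  note lift = module_direct_sum.direct_sum_lift_linear[where u = "\<lambda>xs v. u v xs", OF direct_sum_chain[of k] assms]
    module_direct_sum.direct_sum_lift_summand[where u = "\<lambda>xs v. u v xs", OF direct_sum_chain[of k] assms]
  show "extend_linearly P Fo k N u \<in> linear_maps R (C k) N"
    unfolding extend_linearly_def chain_module_def by (rule lift(1))
  assume xs: "xs \<in> simplices P k" "v \<in> carrier (Fo (hd xs))"
  show "extend_linearly P Fo k N u (\<epsilon> k v xs) = u v xs"
    unfolding extend_linearly_def chain_module_def elementary_chain_def by (rule lift(2)[OF _ xs])
qed

lemma face_coeff_linear:
  assumes "xs \<in> simplices P k" "0 < k" "i < length xs"
  shows "(\<lambda>v\<in>carrier (Fo (hd xs)). face_coeff Fm i xs v) \<in> linear_maps R (Fo (hd xs)) (Fo (hd (face i xs)))"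
proof -
  have len: "2 \<le> length xs" and ne: "xs \<noteq> []" using assms by (auto simp: simplices_iff)
  have P: "xs ! 0 \<in> P" "xs ! 1 \<in> P" "xs ! 0 \<le> xs ! 1" using assms len by (auto simp: simplices_iff)
  show ?thesis
  proof (cases "i = 0")
    case True
    have "restrict (Fm (xs ! 0) (xs ! 1)) (carrier (Fo (xs ! 0))) = Fm (xs ! 0) (xs ! 1)"
      by (rule extensional_restrict, rule linear_maps_extensional, rule Fm_linear) (fact P)+
    then show ?thesis
      using Fm_linear[OF P] True len ne by (simp add: face_coeff_def hd_face hd_conv_nth restrict_def)
  next
    case False
    then show ?thesis
      using linear_maps_ident[OF Fo_module[OF P(1)]] assms len ne
      by (simp add: face_coeff_def hd_face hd_conv_nth)
  qed
qed

lemma face_coeff_closed: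
  assumes "xs \<in> simplices P k" "0 < k" "i < length xs" "v \<in> carrier (Fo (hd xs))"
  shows "face_coeff Fm i xs v \<in> carrier (Fo (hd (face i xs)))"
  using linear_maps_closed[OF face_coeff_linear[OF assms(1-3)], of v] assms(4) by simp

definition face_chain :: "int \<Rightarrow> nat \<Rightarrow> 'm \<Rightarrow> 'p list \<Rightarrow> 'p list \<Rightarrow> 'm"
  where "face_chain k i v xs = \<epsilon> (k - 1) (face_coeff Fm i xs v) (face i xs)"

lemma face_chain_closed:
  assumes "xs \<in> simplices P k" "0 < k" "i < length xs" "v \<in> carrier (Fo (hd xs))"
  shows "face_chain k i v xs \<in> carrier (C (k - 1))"
  unfolding face_chain_def using assms by (intro elementary_chain_closed face_simplex face_coeff_closed)

lemma face_chain_linear: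
  assumes "xs \<in> simplices P k" "0 < k" "i < length xs"
  shows "(\<lambda>v\<in>carrier (Fo (hd xs)). face_chain k i v xs) \<in> linear_maps R (Fo (hd xs)) (C (k - 1))"
proof -
  have "compose (carrier (Fo (hd xs))) (\<lambda>v\<in>carrier (Fo (hd (face i xs))). \<epsilon> (k - 1) v (face i xs))
      (\<lambda>v\<in>carrier (Fo (hd xs)). face_coeff Fm i xs v) \<in> linear_maps R (Fo (hd xs)) (C (k - 1))"
    by (intro linear_maps_compose[OF Fo_module face_coeff_linear[OF assms] elementary_chain_linear]
      hd_simplex[OF assms(1)] face_simplex[OF assms])
  also have "compose (carrier (Fo (hd xs))) (\<lambda>v\<in>carrier (Fo (hd (face i xs))). \<epsilon> (k - 1) v (face i xs))
      (\<lambda>v\<in>carrier (Fo (hd xs)). face_coeff Fm i xs v) = (\<lambda>v\<in>carrier (Fo (hd xs)). face_chain k i v xs)"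
    using face_coeff_closed[OF assms] by (auto simp: compose_def face_chain_def restrict_def fun_eq_iff)
  finally show ?thesis .
qed

text \<open>The leading term of the differential is absorbed as the term i = 0, which turns the
  differential into a single alternating sum over all faces.\<close>

lemma elementary_boundary_eq:
  assumes "xs \<in> simplices P k" "0 < k" "v \<in> carrier (Fo (hd xs))"
  shows "elementary_boundary P Fo Fm k v xs =
    (\<Oplus>\<^bsub>C (k - 1)\<^esub>i\<in>{..<length xs}. signed (C (k - 1)) i (face_chain k i v xs))"
proof -
  interpret Ck: abelian_group "C (k - 1)" by (rule abelian_group_chain)
  have len: "{..<length xs} = insert 0 {1..<length xs}" using assms by (auto simp: simplices_iff)
  have cl: "signed (C (k - 1)) i (face_chain k i v xs) \<in> carrier (C (k - 1))" if "i < length xs" for i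
    using face_chain_closed assms that by (intro Ck.signed_closed)
  have cl0: "signed (C (k - 1)) 0 (face_chain k 0 v xs) \<in> carrier (C (k - 1))" "0 < length xs"
    using assms(1) cl by (auto simp: simplices_iff)
  have "(\<Oplus>\<^bsub>C (k - 1)\<^esub>i\<in>{..<length xs}. signed (C (k - 1)) i (face_chain k i v xs)) =
      face_chain k 0 v xs \<oplus>\<^bsub>C (k - 1)\<^esub>
        (\<Oplus>\<^bsub>C (k - 1)\<^esub>i\<in>{1..<length xs}. signed (C (k - 1)) i (face_chain k i v xs))"
    unfolding len using cl cl0 by (subst Ck.finsum_insert) (auto simp: signed_def)
  also have "(\<Oplus>\<^bsub>C (k - 1)\<^esub>i\<in>{1..<length xs}. signed (C (k - 1)) i (face_chain k i v xs)) =
      (\<Oplus>\<^bsub>C (k - 1)\<^esub>i\<in>{1..<length xs}.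
        (let y = \<epsilon> (k - 1) v (take i xs @ drop (Suc i) xs) in if even i then y else \<ominus>\<^bsub>C (k - 1)\<^esub> y))"
    by (rule Ck.finsum_cong'[symmetric])
      (use cl in \<open>auto simp: signed_def face_chain_def face_coeff_def face_def\<close>)
  finally show ?thesis
    unfolding elementary_boundary_def Let_def by (simp only: face_chain_def face_coeff_def face_0 if_True refl)
qed

lemma elementary_boundary_linear:
  assumes "xs \<in> simplices P k" "0 < k"
  shows "(\<lambda>v\<in>carrier (Fo (hd xs)). elementary_boundary P Fo Fm k v xs) \<in> linear_maps R (Fo (hd xs)) (C (k - 1))"
proof -
  have "(\<lambda>v\<in>carrier (Fo (hd xs)). \<Oplus>\<^bsub>C (k - 1)\<^esub>i\<in>{..<length xs}. signed (C (k - 1)) i (face_chain k i v xs))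
      \<in> linear_maps R (Fo (hd xs)) (C (k - 1))"
    using assms hd_simplex[OF assms(1)]
    by (intro linear_maps_sum linear_maps_signed_map Fo_module module_chain face_chain_linear) auto
  also have "(\<lambda>v\<in>carrier (Fo (hd xs)). \<Oplus>\<^bsub>C (k - 1)\<^esub>i\<in>{..<length xs}. signed (C (k - 1)) i (face_chain k i v xs))
      = (\<lambda>v\<in>carrier (Fo (hd xs)). elementary_boundary P Fo Fm k v xs)"
    by (rule restrict_ext) (simp add: elementary_boundary_eq assms)
  finally show ?thesis .
qed

lemma boundary_linear: "d k \<in> linear_maps R (C k) (C (k - 1))"
  by (auto simp: boundary_def intro!: linear_maps_zero_map module_chain extend_linearly_linear
      elementary_boundary_linear)

lemma boundary_elementary:
  assumes "xs \<in> simplices P k" "0 < k" "v \<in> carrier (Fo (hd xs))"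
  shows "d k (\<epsilon> k v xs) = elementary_boundary P Fo Fm k v xs"
proof -
  have "extend_linearly P Fo k (C (k - 1)) (elementary_boundary P Fo Fm k) (\<epsilon> k v xs) =
      elementary_boundary P Fo Fm k v xs"
    by (rule extend_linearly_elementary[OF module_chain elementary_boundary_linear])
      (use assms in auto)
  then show ?thesis using assms(2) by (simp add: boundary_def)
qed

text \<open>The coefficient part of the simplicial identity. The only case with content is i = j =
  0, where it is functoriality along the first three vertices; in all other cases both sides apply
  the same single map, or none.\<close>

lemma face_coeff_face_coeff:
  assumes xs: "xs \<in> simplices P k" and ij: "i \<le> j" "Suc j < length xs" and len: "3 \<le> length xs"
    and v: "v \<in> carrier (Fo (hd xs))"
  shows "face_coeff Fm j (face i xs) (face_coeff Fm i xs v) =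
    face_coeff Fm i (face (Suc j) xs) (face_coeff Fm (Suc j) xs v)"
proof (cases "i = 0")
  case i: True
  show ?thesis
  proof (cases "j = 0")
    case True
    have "xs ! 0 \<in> P" "xs ! 1 \<in> P" "xs ! 2 \<in> P" "xs ! 0 \<le> xs ! 1" "xs ! 1 \<le> xs ! 2"
      using xs len by (auto simp: simplices_iff)
    moreover have "v \<in> carrier (Fo (xs ! 0))" using v xs by (simp add: hd_conv_nth simplices_iff)
    moreover have "face 0 xs ! 0 = xs ! 1" "face 0 xs ! 1 = xs ! 2" "face 1 xs ! 0 = xs ! 0" "face 1 xs ! 1 = xs ! 2"
      using len by (subst nth_face; auto simp: numeral_2_eq_2)+
    ultimately show ?thesis
      using i True by (simp add: face_coeff_def Fm_comp)
  next
    case False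
    then show ?thesis using i ij by (simp add: face_coeff_def nth_face)
  qed
qed (use ij in \<open>simp add: face_coeff_def\<close>)

lemma boundary_boundary:
  assumes c: "c \<in> carrier (C k)"
  shows "d (k - 1) (d k c) = \<zero>\<^bsub>C (k - 2)\<^esub>"
\<comment> \<open>For these k the outer differential starts in degree at most 0, where it is the
  zero map by definition.\<close>
proof (cases "k \<le> 1")
  case True
  then show ?thesis
    using linear_maps_closed[OF boundary_linear c] by (simp add: boundary_def[of _ _ _ "k - 1"])
next
  case False
  then have k: "0 < k" "0 < k - 1" by auto
  have C2: "C (k - 1 - 1) = C (k - 2)" by simp
  have d1: "d (k - 1) \<in> linear_maps R (C (k - 1)) (C (k - 2))"
    using boundary_linear[of "k - 1"] unfolding C2 .
  interpret C2: abelian_group "C (k - 2)" by (rule abelian_group_chain)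
  have "compose (carrier (C k)) (d (k - 1)) (d k) = (\<lambda>c\<in>carrier (C k). \<zero>\<^bsub>C (k - 2)\<^esub>)"
  proof (rule chain_map_eqI[OF module_chain])
    show "compose (carrier (C k)) (d (k - 1)) (d k) \<in> linear_maps R (C k) (C (k - 2))"
      by (rule linear_maps_compose[OF module_chain boundary_linear d1])
    show "(\<lambda>c\<in>carrier (C k). \<zero>\<^bsub>C (k - 2)\<^esub>) \<in> linear_maps R (C k) (C (k - 2))"
      by (intro linear_maps_zero_map module_chain)
    fix xs v assume xs: "xs \<in> simplices P k" and v: "v \<in> carrier (Fo (hd xs))"
    define m where "m = length xs - 1"
    have len: "length xs = Suc m" "3 \<le> length xs" using xs k by (auto simp: simplices_iff m_def)
    \<comment> \<open>\<open>E i j\<close> deletes vertex i and then vertex j of what is left. The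
      simplex has \<open>Suc m\<close> vertices and each face has m, so i runs up to m and j stays
      below m.\<close>
    define E where "E i j = face_chain (k - 1) j (face_coeff Fm i xs v) (face i xs)" for i j
    have face: "face i xs \<in> simplices P (k - 1)" "face_coeff Fm i xs v \<in> carrier (Fo (hd (face i xs)))"
        "length (face i xs) = m" if "i \<le> m" for i
      using that xs v k len by (auto intro!: face_simplex face_coeff_closed simp: length_face)
    have E: "E i j \<in> carrier (C (k - 2))" if "i \<le> m" "j < m" for i j
      using face_chain_closed[OF face(1)[OF that(1)] k(2) _ face(2)[OF that(1)], of j] face(3)[OF that(1)] that(2)
      unfolding C2 E_def by simp
    have fc: "face_chain k i v xs \<in> carrier (C (k - 1))" if "i \<le> m" for i
      using face_chain_closed[OF xs k(1) _ v] that len by simp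
    have "d (k - 1) (d k (\<epsilon> k v xs)) =
        d (k - 1) (\<Oplus>\<^bsub>C (k - 1)\<^esub>i\<in>{..m}. signed (C (k - 1)) i (face_chain k i v xs))"
      by (simp add: boundary_elementary[OF xs k(1) v] elementary_boundary_eq[OF xs k(1) v] len(1)
          lessThan_Suc_atMost)
    also have "\<dots> = (\<Oplus>\<^bsub>C (k - 2)\<^esub>i\<in>{..m}. d (k - 1) (signed (C (k - 1)) i (face_chain k i v xs)))"
      by (intro linear_maps_finsum[OF module_chain module_chain d1] Pi_I fc
          abelian_group.signed_closed[OF abelian_group_chain]) simp
    also have "\<dots> = (\<Oplus>\<^bsub>C (k - 2)\<^esub>i\<in>{..m}. \<Oplus>\<^bsub>C (k - 2)\<^esub>j\<in>{..<m}. signed (C (k - 2)) (i + j) (E i j))"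
    proof (rule C2.finsum_cong')
      fix i assume i: "i \<in> {..m}"
      have "d (k - 1) (signed (C (k - 1)) i (face_chain k i v xs)) =
          signed (C (k - 2)) i (d (k - 1) (face_chain k i v xs))"
        using linear_maps_signed[OF module_chain module_chain d1 fc[of i]] i by simp
      also have "d (k - 1) (face_chain k i v xs) = (\<Oplus>\<^bsub>C (k - 2)\<^esub>j\<in>{..<m}. signed (C (k - 2)) j (E i j))"
        using boundary_elementary[OF face(1) k(2) face(2)] elementary_boundary_eq[OF face(1) k(2) face(2)]
          face(3) i unfolding C2 face_chain_def[of k] E_def by simp
      also have "signed (C (k - 2)) i \<dots> = (\<Oplus>\<^bsub>C (k - 2)\<^esub>j\<in>{..<m}. signed (C (k - 2)) i (signed (C (k - 2)) j (E i j)))"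
        using i by (intro C2.signed_finsum Pi_I C2.signed_closed E) auto
      also have "\<dots> = (\<Oplus>\<^bsub>C (k - 2)\<^esub>j\<in>{..<m}. signed (C (k - 2)) (i + j) (E i j))"
        using i by (intro C2.finsum_cong' Pi_I C2.signed_closed C2.signed_signed E refl) auto
      finally show "d (k - 1) (signed (C (k - 1)) i (face_chain k i v xs)) =
          (\<Oplus>\<^bsub>C (k - 2)\<^esub>j\<in>{..<m}. signed (C (k - 2)) (i + j) (E i j))" .
    next
      show "(\<lambda>i. \<Oplus>\<^bsub>C (k - 2)\<^esub>j\<in>{..<m}. signed (C (k - 2)) (i + j) (E i j)) \<in> {..m} \<rightarrow> carrier (C (k - 2))"
        by (intro Pi_I C2.finsum_closed C2.signed_closed E) auto
    qed simp
    also have "\<dots> = \<zero>\<^bsub>C (k - 2)\<^esub>"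
    proof (rule C2.alternating_double_sum)
      fix i j assume "i \<le> j" "j < m"
      then show "E i j = E (Suc j) i"
        using face_coeff_face_coeff[OF xs _ _ len(2) v] face_face[of i j xs] len(1)
        by (simp add: E_def face_chain_def)
    qed (rule E)
    finally show "compose (carrier (C k)) (d (k - 1)) (d k) (\<epsilon> k v xs) =
        (\<lambda>c\<in>carrier (C k). \<zero>\<^bsub>C (k - 2)\<^esub>) (\<epsilon> k v xs)"
      using elementary_chain_closed[OF xs v] by (simp add: compose_eq)
  qed
  from fun_cong[OF this, of c] c show ?thesis by (simp add: compose_eq)
qed

section \<open>Cycles, boundaries and homology classes\<close>

lemma cycles_iff: "c \<in> Z k \<longleftrightarrow> c \<in> carrier (C k) \<and> d k c = \<zero>\<^bsub>C (k - 1)\<^esub>"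
  by (auto simp: cycles_def a_kernel_def')

lemma submodule_cycles: "submodule (Z k) R (C k)"
proof -
  interpret Ck: Module.module R "C k" by (rule module_chain)
  interpret Ck1: Module.module R "C (k - 1)" by (rule module_chain)
  interpret d: abelian_group_hom "C k" "C (k - 1)" "d k"
    by (rule linear_maps_abelian_group_hom[OF module_chain module_chain boundary_linear])
  show ?thesis
    by (rule Ck.submoduleI) (auto simp: cycles_iff linear_maps_smult[OF boundary_linear])
qed

lemma boundaries_subset_cycles: "B k \<subseteq> Z k"
proof -
  have "d k (d (k + 1) c) = \<zero>\<^bsub>C (k - 1)\<^esub>" if "c \<in> carrier (C (k + 1))" for c
    using boundary_boundary[OF that] by simp
  moreover have "d (k + 1) c \<in> carrier (C k)" if "c \<in> carrier (C (k + 1))" for c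
    using linear_maps_closed[OF boundary_linear that] by simp
  ultimately show ?thesis by (auto simp: boundaries_def cycles_iff)
qed

abbreviation "Zm k \<equiv> (C k)\<lparr>carrier := Z k\<rparr>"

lemma module_cycles: "Module.module R (Zm k)"
  by (rule submodule.submodule_is_module[OF submodule_cycles module_chain])

lemma submodule_boundaries: "submodule (B k) R (Zm k)"
proof -
  interpret Ck: Module.module R "C k" by (rule module_chain)
  interpret Ck1: Module.module R "C (k + 1)" by (rule module_chain)
  interpret Zk: Module.module R "Zm k" by (rule module_cycles)
  have "d (k + 1) \<in> linear_maps R (C (k + 1)) (C k)" using boundary_linear[of "k + 1"] by simp
  note d = this linear_maps_zero[OF module_chain module_chain this] linear_maps_minus[OF module_chain module_chain this]
  \<comment> \<open>An additive inverse is defined through the carrier, so the inverse in the module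
    of cycles has to be identified with the one in the chain module.\<close>
  have minus: "\<ominus>\<^bsub>Zm k\<^esub> c = \<ominus>\<^bsub>C k\<^esub> c" if "c \<in> Z k" for c
    using submodule_cycles that Ck.add.m_inv_consistent[of "Z k" c]
    by (simp add: submodule_def a_inv_def)
  show ?thesis
  proof (rule Zk.submoduleI)
    show "B k \<subseteq> carrier (Zm k)" using boundaries_subset_cycles by simp
    show "\<zero>\<^bsub>Zm k\<^esub> \<in> B k" unfolding boundaries_def
      by (rule image_eqI[of _ _ "\<zero>\<^bsub>C (k + 1)\<^esub>"]) (simp_all add: d(2))
  next
    fix a assume a: "a \<in> B k"
    then obtain c where "c \<in> carrier (C (k + 1))" "a = d (k + 1) c" by (auto simp: boundaries_def)
    moreover have "a \<in> Z k" using a boundaries_subset_cycles by blast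
    ultimately have "\<ominus>\<^bsub>Zm k\<^esub> a = d (k + 1) (\<ominus>\<^bsub>C (k + 1)\<^esub> c)" "\<ominus>\<^bsub>C (k + 1)\<^esub> c \<in> carrier (C (k + 1))"
      using minus d(3) by simp_all
    then show "\<ominus>\<^bsub>Zm k\<^esub> a \<in> B k" unfolding boundaries_def by (rule image_eqI)
  next
    fix a b assume "a \<in> B k" "b \<in> B k"
    then obtain c e where "c \<in> carrier (C (k + 1))" "a = d (k + 1) c"
      "e \<in> carrier (C (k + 1))" "b = d (k + 1) e" by (auto simp: boundaries_def)
    then show "a \<oplus>\<^bsub>Zm k\<^esub> b \<in> B k"
      unfolding boundaries_def using linear_maps_add[OF d(1), of c e]
      by (intro image_eqI[of _ _ "c \<oplus>\<^bsub>C (k + 1)\<^esub> e"]) simp_all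
  next
    fix r a assume "r \<in> carrier R" "a \<in> B k"
    then obtain c where "c \<in> carrier (C (k + 1))" "a = d (k + 1) c" by (auto simp: boundaries_def)
    then show "r \<odot>\<^bsub>Zm k\<^esub> a \<in> B k"
      unfolding boundaries_def using linear_maps_smult[OF d(1), of r c] \<open>r \<in> carrier R\<close>
      by (intro image_eqI[of _ _ "r \<odot>\<^bsub>C (k + 1)\<^esub> c"]) simp_all
  qed
qed

lemma quotient_homology: "module_quotient R (Zm k) (B k)"
  by (intro module_quotient.intro module_quotient_axioms.intro module_cycles submodule_boundaries)

lemma module_homology: "Module.module R (homology P Fo Fm k)"
  unfolding homology_def by (rule module_quotient.module_quotient[OF quotient_homology])

abbreviation "cls k z \<equiv> B k +>\<^bsub>C k\<^esub> z"

text \<open>A coset depends on the addition alone, not on the carrier. Homology classes may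
  therefore be written in the chain module, as \<open>induced_homology_map\<close> does.\<close>

lemma coset_cycles: "B k +>\<^bsub>Zm k\<^esub> z = cls k z"
  by (simp add: a_r_coset_def')

lemma carrier_homology: "carrier (homology P Fo Fm k) = cls k ` Z k"
  using module_quotient.carrier_quotient[OF quotient_homology, of k] by (simp add: homology_def coset_cycles)

lemma add_homology:
  "\<lbrakk>y \<in> Z k; z \<in> Z k\<rbrakk> \<Longrightarrow> cls k y \<oplus>\<^bsub>homology P Fo Fm k\<^esub> cls k z = cls k (y \<oplus>\<^bsub>C k\<^esub> z)"
  using module_quotient.add_quotient[OF quotient_homology, of y k z] by (simp add: homology_def coset_cycles)

lemma smult_homology:
  "\<lbrakk>r \<in> carrier R; z \<in> Z k\<rbrakk> \<Longrightarrow> r \<odot>\<^bsub>homology P Fo Fm k\<^esub> cls k z = cls k (r \<odot>\<^bsub>C k\<^esub> z)"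
  using module_quotient.smult_quotient[OF quotient_homology, of r z k] by (simp add: homology_def coset_cycles)

lemma cls_subset:
  assumes "z \<in> Z k" "y \<in> cls k z"
  obtains c where "c \<in> carrier (C (k + 1))" "y = d (k + 1) c \<oplus>\<^bsub>C k\<^esub> z"
  using assms by (auto simp: a_r_coset_def' boundaries_def)

lemma cls_self: "z \<in> Z k \<Longrightarrow> z \<in> cls k z"
proof -
  interpret module_quotient R "Zm k" "B k" by (rule quotient_homology)
  show "z \<in> Z k \<Longrightarrow> z \<in> cls k z" using H.a_rcos_self[of z] by (simp add: coset_cycles)
qed

lemma cls_absorb:
  assumes "c \<in> carrier (C (k + 1))" "z \<in> Z k"
  shows "cls k (d (k + 1) c \<oplus>\<^bsub>C k\<^esub> z) = cls k z"
proof -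
  interpret module_quotient R "Zm k" "B k" by (rule quotient_homology)
  have "d (k + 1) c \<oplus>\<^bsub>C k\<^esub> z \<in> cls k z"
    using assms(1) by (auto simp: a_r_coset_def' boundaries_def)
  then show ?thesis using H.a_repr_independence'[of _ z] assms(2) by (simp add: coset_cycles)
qed

end

section \<open>Maps induced on homology\<close>

locale poset_transformation = F: poset_functor R P Fo Fm + G: poset_functor R Q Go Gm
  for R :: "('r, 'z) ring_scheme"
    and P :: "'p::order set" and Fo :: "'p \<Rightarrow> ('r, 'm) module" and Fm
    and Q :: "'q::order set" and Go :: "'q \<Rightarrow> ('r, 'n) module" and Gm +
  fixes g :: "'p \<Rightarrow> 'q" and \<tau> :: "'p \<Rightarrow> 'm \<Rightarrow> 'n"
  assumes g_closed: "x \<in> P \<Longrightarrow> g x \<in> Q"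
    and g_mono: "\<lbrakk>x \<in> P; y \<in> P; x \<le> y\<rbrakk> \<Longrightarrow> g x \<le> g y"
    and \<tau>_linear: "x \<in> P \<Longrightarrow> \<tau> x \<in> linear_maps R (Fo x) (Go (g x))"
    and naturality: "\<lbrakk>x \<in> P; y \<in> P; x \<le> y; v \<in> carrier (Fo x)\<rbrakk>
      \<Longrightarrow> \<tau> y (Fm x y v) = Gm (g x) (g y) (\<tau> x v)"
begin

abbreviation "\<Phi> \<equiv> induced_chain_map P Fo Q Go g \<tau>"
abbreviation "\<Phi>\<^sub>H \<equiv> induced_homology_map P Fo Fm Q Go Gm g \<tau>"

lemma map_simplex: "xs \<in> simplices P k \<Longrightarrow> map g xs \<in> simplices Q k"
  by (auto simp: simplices_iff g_closed intro!: g_mono)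

lemma hd_map_simplex: "xs \<in> simplices P k \<Longrightarrow> hd (map g xs) = g (hd xs)"
  by (simp add: simplices_iff hd_map)

lemma \<tau>_closed: "\<lbrakk>xs \<in> simplices P k; v \<in> carrier (Fo (hd xs))\<rbrakk> \<Longrightarrow> \<tau> (hd xs) v \<in> carrier (Go (hd (map g xs)))"
  using linear_maps_closed[OF \<tau>_linear[OF hd_simplex]] by (simp add: hd_map_simplex)

lemma elementary_image_linear:
  assumes "xs \<in> simplices P k"
  shows "(\<lambda>v\<in>carrier (Fo (hd xs)). G.\<epsilon> k (\<tau> (hd xs) v) (map g xs)) \<in> linear_maps R (Fo (hd xs)) (G.C k)"
proof -
  have \<tau>: "\<tau> (hd xs) \<in> linear_maps R (Fo (hd xs)) (Go (hd (map g xs)))"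
    using \<tau>_linear[OF hd_simplex[OF assms]] by (simp add: hd_map_simplex[OF assms])
  have "compose (carrier (Fo (hd xs))) (\<lambda>v\<in>carrier (Go (hd (map g xs))). G.\<epsilon> k v (map g xs)) (\<tau> (hd xs))
      \<in> linear_maps R (Fo (hd xs)) (G.C k)"
    by (rule linear_maps_compose[OF F.Fo_module[OF hd_simplex[OF assms]] \<tau>
          G.elementary_chain_linear[OF map_simplex[OF assms]]])
  also have "compose (carrier (Fo (hd xs))) (\<lambda>v\<in>carrier (Go (hd (map g xs))). G.\<epsilon> k v (map g xs)) (\<tau> (hd xs))
      = (\<lambda>v\<in>carrier (Fo (hd xs)). G.\<epsilon> k (\<tau> (hd xs) v) (map g xs))"
    using \<tau>_closed[OF assms] by (auto simp: compose_def restrict_def fun_eq_iff)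
  finally show ?thesis .
qed

lemma chain_map_linear: "\<Phi> k \<in> linear_maps R (F.C k) (G.C k)"
  unfolding induced_chain_map_def by (intro F.extend_linearly_linear G.module_chain elementary_image_linear)

lemma chain_map_elementary:
  assumes "xs \<in> simplices P k" "v \<in> carrier (Fo (hd xs))"
  shows "\<Phi> k (F.\<epsilon> k v xs) = G.\<epsilon> k (\<tau> (hd xs) v) (map g xs)"
  unfolding induced_chain_map_def
  by (rule F.extend_linearly_elementary[OF G.module_chain elementary_image_linear assms])

text \<open>Naturality is used for i = 0 only; every other face leaves both the first vertex and the
  coefficient unchanged.\<close>

lemma face_coeff_natural:
  assumes "xs \<in> simplices P k" "0 < k" "i < length xs" "v \<in> carrier (Fo (hd xs))"
  shows "\<tau> (hd (face i xs)) (face_coeff Fm i xs v) = face_coeff Gm i (map g xs) (\<tau> (hd xs) v)"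
proof -
  have len: "2 \<le> length xs" "xs \<noteq> []" using assms by (auto simp: simplices_iff)
  then have "xs ! 0 \<in> P" "xs ! 1 \<in> P" "xs ! 0 \<le> xs ! 1" using assms by (auto simp: simplices_iff)
  then show ?thesis
    using naturality[of "xs ! 0" "xs ! 1" v] assms len by (simp add: face_coeff_def hd_face hd_conv_nth)
qed

lemma chain_map_face_chain:
  assumes "xs \<in> simplices P k" "0 < k" "i < length xs" "v \<in> carrier (Fo (hd xs))"
  shows "\<Phi> (k - 1) (F.face_chain k i v xs) = G.face_chain k i (\<tau> (hd xs) v) (map g xs)"
  unfolding F.face_chain_def G.face_chain_def
  by (simp add: chain_map_elementary[OF face_simplex[OF assms(1-3)] F.face_coeff_closed[OF assms]]
      face_coeff_natural[OF assms] map_face)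

text \<open>Both composites are linear, so elementary chains suffice, and there the chain map
  carries the i-th face to the i-th face. In degrees up to 0 both differentials vanish.\<close>

lemma chain_map_boundary:
  assumes c: "c \<in> carrier (F.C k)"
  shows "\<Phi> (k - 1) (F.d k c) = G.d k (\<Phi> k c)"
proof (cases "0 < k")
  case False
  then show ?thesis
    using c linear_maps_closed[OF chain_map_linear c]
      linear_maps_zero[OF F.module_chain G.module_chain chain_map_linear[of "k - 1"]]
    by (simp add: boundary_def)
next
  case k: True
  interpret G1: abelian_group "G.C (k - 1)" by (rule G.abelian_group_chain)
  have "compose (carrier (F.C k)) (\<Phi> (k - 1)) (F.d k) = compose (carrier (F.C k)) (G.d k) (\<Phi> k)"
  proof (rule F.chain_map_eqI[OF G.module_chain])
    show "compose (carrier (F.C k)) (\<Phi> (k - 1)) (F.d k) \<in> linear_maps R (F.C k) (G.C (k - 1))"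
      by (rule linear_maps_compose[OF F.module_chain F.boundary_linear chain_map_linear])
    show "compose (carrier (F.C k)) (G.d k) (\<Phi> k) \<in> linear_maps R (F.C k) (G.C (k - 1))"
      by (rule linear_maps_compose[OF F.module_chain chain_map_linear G.boundary_linear])
    fix xs v assume xs: "xs \<in> simplices P k" and v: "v \<in> carrier (Fo (hd xs))"
    have fc: "F.face_chain k i v xs \<in> carrier (F.C (k - 1))" if "i < length xs" for i
      by (rule F.face_chain_closed[OF xs k that v])
    have \<Phi>fc: "\<Phi> (k - 1) (signed (F.C (k - 1)) i (F.face_chain k i v xs)) =
        signed (G.C (k - 1)) i (G.face_chain k i (\<tau> (hd xs) v) (map g xs))" if "i < length xs" for i
      using linear_maps_signed[OF F.module_chain G.module_chain chain_map_linear fc[OF that]]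
      by (simp add: chain_map_face_chain[OF xs k that v])
    have "\<Phi> (k - 1) (F.d k (F.\<epsilon> k v xs)) =
        \<Phi> (k - 1) (\<Oplus>\<^bsub>F.C (k - 1)\<^esub>i\<in>{..<length xs}. signed (F.C (k - 1)) i (F.face_chain k i v xs))"
      by (simp add: F.boundary_elementary[OF xs k v] F.elementary_boundary_eq[OF xs k v])
    also have "\<dots> = (\<Oplus>\<^bsub>G.C (k - 1)\<^esub>i\<in>{..<length xs}.
        \<Phi> (k - 1) (signed (F.C (k - 1)) i (F.face_chain k i v xs)))"
      by (intro linear_maps_finsum[OF F.module_chain G.module_chain chain_map_linear] Pi_I fc
          abelian_group.signed_closed[OF F.abelian_group_chain]) simp
    also have "\<dots> = (\<Oplus>\<^bsub>G.C (k - 1)\<^esub>i\<in>{..<length (map g xs)}.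
        signed (G.C (k - 1)) i (G.face_chain k i (\<tau> (hd xs) v) (map g xs)))"
      by (intro G1.finsum_cong' Pi_I G1.signed_closed G.face_chain_closed[OF map_simplex[OF xs] k]
          \<tau>_closed[OF xs v]) (simp_all add: \<Phi>fc)
    also have "\<dots> = G.d k (\<Phi> k (F.\<epsilon> k v xs))"
      using map_simplex[OF xs] \<tau>_closed[OF xs v] k
      by (simp only: chain_map_elementary[OF xs v] G.boundary_elementary G.elementary_boundary_eq)
    finally show "compose (carrier (F.C k)) (\<Phi> (k - 1)) (F.d k) (F.\<epsilon> k v xs) =
        compose (carrier (F.C k)) (G.d k) (\<Phi> k) (F.\<epsilon> k v xs)"
      using F.elementary_chain_closed[OF xs v] by (simp add: compose_eq)
  qed
  from fun_cong[OF this, of c] c show ?thesis by (simp add: compose_eq)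
qed

lemma chain_map_cycles: "z \<in> F.Z k \<Longrightarrow> \<Phi> k z \<in> G.Z k"
  using linear_maps_closed[OF chain_map_linear] chain_map_boundary
    linear_maps_zero[OF F.module_chain G.module_chain chain_map_linear[of "k - 1"]]
  by (simp add: F.cycles_iff G.cycles_iff flip: chain_map_boundary)

text \<open>The induced map is defined as a union over representatives. Two representatives differ
  by a boundary, whose image is again a boundary, so all members of the union coincide; the union is
  nonempty because it contains the coset belonging to z itself.\<close>

lemma homology_map_cls:
  assumes z: "z \<in> F.Z k"
  shows "\<Phi>\<^sub>H k (F.cls k z) = G.cls k (\<Phi> k z)"
proof -
  have "G.cls k (\<Phi> k y) = G.cls k (\<Phi> k z)" if y: "y \<in> F.cls k z" for y
  proof -
    obtain c where c: "c \<in> carrier (F.C (k + 1))" "y = F.d (k + 1) c \<oplus>\<^bsub>F.C k\<^esub> z"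
      using F.cls_subset[OF z y] .
    have "F.d (k + 1) c \<in> carrier (F.C k)" "z \<in> carrier (F.C k)"
      using linear_maps_closed[OF F.boundary_linear c(1)] z by (auto simp: F.cycles_iff)
    then have "\<Phi> k y = G.d (k + 1) (\<Phi> (k + 1) c) \<oplus>\<^bsub>G.C k\<^esub> \<Phi> k z"
      using linear_maps_add[OF chain_map_linear, of "F.d (k + 1) c" k z] chain_map_boundary[OF c(1)] c(2)
      by simp
    then show ?thesis
      using G.cls_absorb[OF linear_maps_closed[OF chain_map_linear c(1)] chain_map_cycles[OF z]] by simp
  qed
  then have "(\<Union>y\<in>F.cls k z. G.cls k (\<Phi> k y)) = (\<Union>y\<in>F.cls k z. G.cls k (\<Phi> k z))"
    by (rule SUP_cong[OF refl])
  also have "\<dots> = G.cls k (\<Phi> k z)"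
    using F.cls_self[OF z] by (simp only: UN_constant split: if_splits) blast
  finally have "(\<Union>y\<in>F.cls k z. G.cls k (\<Phi> k y)) = G.cls k (\<Phi> k z)" .
  moreover have "F.cls k z \<in> carrier (homology P Fo Fm k)"
    using z by (simp add: F.carrier_homology)
  ultimately show ?thesis by (simp add: induced_homology_map_def)
qed

lemma homology_map_linear: "\<Phi>\<^sub>H k \<in> linear_maps R (homology P Fo Fm k) (homology Q Go Gm k)"
proof (rule linear_mapsI)
  interpret FZ: Module.module R "F.Zm k" by (rule F.module_cycles)
  show "\<Phi>\<^sub>H k \<in> extensional (carrier (homology P Fo Fm k))" by (simp add: induced_homology_map_def)
  fix X assume "X \<in> carrier (homology P Fo Fm k)"
  then obtain x where x: "X = F.cls k x" "x \<in> F.Z k" by (auto simp: F.carrier_homology)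
  then show "\<Phi>\<^sub>H k X \<in> carrier (homology Q Go Gm k)"
    by (simp add: homology_map_cls G.carrier_homology chain_map_cycles)
  {
    fix Y assume "Y \<in> carrier (homology P Fo Fm k)"
    then obtain y where y: "Y = F.cls k y" "y \<in> F.Z k" by (auto simp: F.carrier_homology)
    have "x \<oplus>\<^bsub>F.C k\<^esub> y \<in> F.Z k" using FZ.M.a_closed[of x y] x y by simp
    moreover have "\<Phi> k (x \<oplus>\<^bsub>F.C k\<^esub> y) = \<Phi> k x \<oplus>\<^bsub>G.C k\<^esub> \<Phi> k y"
      by (rule linear_maps_add[OF chain_map_linear]) (use x y in \<open>simp_all add: F.cycles_iff\<close>)
    ultimately show "\<Phi>\<^sub>H k (X \<oplus>\<^bsub>homology P Fo Fm k\<^esub> Y) = \<Phi>\<^sub>H k X \<oplus>\<^bsub>homology Q Go Gm k\<^esub> \<Phi>\<^sub>H k Y"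
      using x y by (simp add: F.add_homology G.add_homology homology_map_cls chain_map_cycles)
  next
    fix r assume r: "r \<in> carrier R"
    have "r \<odot>\<^bsub>F.C k\<^esub> x \<in> F.Z k" using FZ.smult_closed[of r x] x r by simp
    moreover have "\<Phi> k (r \<odot>\<^bsub>F.C k\<^esub> x) = r \<odot>\<^bsub>G.C k\<^esub> \<Phi> k x"
      by (rule linear_maps_smult[OF chain_map_linear r]) (use x in \<open>simp add: F.cycles_iff\<close>)
    ultimately show "\<Phi>\<^sub>H k (r \<odot>\<^bsub>homology P Fo Fm k\<^esub> X) = r \<odot>\<^bsub>homology Q Go Gm k\<^esub> \<Phi>\<^sub>H k X"
      using x r by (simp add: F.smult_homology G.smult_homology homology_map_cls chain_map_cycles)
  }
qed

end

text \<open>Agreement with the identity is only asked on P and on the carriers, since the identity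
  arrows of digraphs and algebras are restricted functions.\<close>

lemma homology_map_ident:
  assumes "poset_transformation R P Fo Fm P Fo Fm g \<tau>"
    and g: "\<And>x. x \<in> P \<Longrightarrow> g x = x" and \<tau>: "\<And>x v. \<lbrakk>x \<in> P; v \<in> carrier (Fo x)\<rbrakk> \<Longrightarrow> \<tau> x v = v"
  shows "induced_homology_map P Fo Fm P Fo Fm g \<tau> k = (\<lambda>X\<in>carrier (homology P Fo Fm k). X)"
proof -
  interpret poset_transformation R P Fo Fm P Fo Fm g \<tau> by fact
  have "\<Phi> k = (\<lambda>c\<in>carrier (F.C k). c)"
  proof (rule F.chain_map_eqI[OF F.module_chain chain_map_linear linear_maps_ident[OF F.module_chain]])
    fix xs v assume xs: "xs \<in> simplices P k" and v: "v \<in> carrier (Fo (hd xs))"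
    have "map g xs = xs" using xs by (intro map_idI g) (auto simp: simplices_def)
    then show "\<Phi> k (F.\<epsilon> k v xs) = (\<lambda>c\<in>carrier (F.C k). c) (F.\<epsilon> k v xs)"
      using chain_map_elementary[OF xs v] \<tau>[OF hd_simplex[OF xs] v] F.elementary_chain_closed[OF xs v] by simp
  qed
  then have "\<Phi>\<^sub>H k (F.cls k z) = F.cls k z" if "z \<in> F.Z k" for z
    using homology_map_cls[OF that] that by (simp add: F.cycles_iff)
  then show ?thesis
    by (intro linear_maps_eqI[OF homology_map_linear linear_maps_ident[OF F.module_homology]])
      (auto simp: F.carrier_homology)
qed

lemma homology_map_compose:
  assumes "poset_transformation R P Fo Fm Q Go Gm g \<tau>" "poset_transformation R Q Go Gm S Ho Hm h \<sigma>"
    "poset_transformation R P Fo Fm S Ho Hm l \<rho>"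
    and l: "\<And>x. x \<in> P \<Longrightarrow> l x = h (g x)"
    and \<rho>: "\<And>x v. \<lbrakk>x \<in> P; v \<in> carrier (Fo x)\<rbrakk> \<Longrightarrow> \<rho> x v = \<sigma> (g x) (\<tau> x v)"
  shows "induced_homology_map P Fo Fm S Ho Hm l \<rho> k =
    compose (carrier (homology P Fo Fm k))
      (induced_homology_map Q Go Gm S Ho Hm h \<sigma> k) (induced_homology_map P Fo Fm Q Go Gm g \<tau> k)"
proof -
  interpret \<tau>: poset_transformation R P Fo Fm Q Go Gm g \<tau> by fact
  interpret \<sigma>: poset_transformation R Q Go Gm S Ho Hm h \<sigma> by fact
  interpret \<rho>: poset_transformation R P Fo Fm S Ho Hm l \<rho> by fact
  have "\<rho>.\<Phi> k = compose (carrier (\<tau>.F.C k)) (\<sigma>.\<Phi> k) (\<tau>.\<Phi> k)"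
  proof (rule \<tau>.F.chain_map_eqI[OF \<sigma>.G.module_chain \<rho>.chain_map_linear])
    show "compose (carrier (\<tau>.F.C k)) (\<sigma>.\<Phi> k) (\<tau>.\<Phi> k) \<in> linear_maps R (\<tau>.F.C k) (\<sigma>.G.C k)"
      by (rule linear_maps_compose[OF \<tau>.F.module_chain \<tau>.chain_map_linear \<sigma>.chain_map_linear])
    fix xs v assume xs: "xs \<in> simplices P k" and v: "v \<in> carrier (Fo (hd xs))"
    have "map l xs = map (h \<circ> g) xs" using xs l by (auto simp: simplices_def)
    then show "\<rho>.\<Phi> k (\<tau>.F.\<epsilon> k v xs) = compose (carrier (\<tau>.F.C k)) (\<sigma>.\<Phi> k) (\<tau>.\<Phi> k) (\<tau>.F.\<epsilon> k v xs)"
      using \<rho>.chain_map_elementary[OF xs v] \<tau>.chain_map_elementary[OF xs v]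
        \<sigma>.chain_map_elementary[OF \<tau>.map_simplex[OF xs] \<tau>.\<tau>_closed[OF xs v]]
        \<rho>[OF hd_simplex[OF xs] v] \<tau>.F.elementary_chain_closed[OF xs v]
      by (simp add: compose_eq \<tau>.hd_map_simplex[OF xs] del: map_eq_conv)
  qed
  then have "\<rho>.\<Phi>\<^sub>H k (\<tau>.F.cls k z) = \<sigma>.\<Phi>\<^sub>H k (\<tau>.\<Phi>\<^sub>H k (\<tau>.F.cls k z))" if "z \<in> \<tau>.F.Z k" for z
    using that by (simp add: \<rho>.homology_map_cls \<tau>.homology_map_cls \<sigma>.homology_map_cls \<tau>.chain_map_cycles
        compose_eq \<tau>.F.cycles_iff)
  then show ?thesis
    by (intro linear_maps_eqI[OF \<rho>.homology_map_linear
          linear_maps_compose[OF \<tau>.F.module_homology \<tau>.homology_map_linear \<sigma>.homology_map_linear]])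
      (auto simp: \<tau>.F.carrier_homology compose_eq)
qed

section \<open>Multipaths\<close>

lemma simple_path_subset_arcs: "simple_path \<Gamma> p \<Longrightarrow> set p \<subseteq> arcs \<Gamma>"
  by (auto simp: simple_path_def pre_digraph.apath_def pre_digraph.awalk_def)

lemma multipath_subset_arcs: "x \<in> multipaths \<Gamma> \<Longrightarrow> x \<subseteq> arcs \<Gamma>"
  using simple_path_subset_arcs by (fastforce simp: multipaths_def)

lemma multipath_iff:
  "x \<in> multipaths \<Gamma> \<longleftrightarrow> (\<exists>Q. x = (\<Union>p\<in>Q. set p) \<and> (\<forall>p\<in>Q. simple_path \<Gamma> p) \<and>
    (\<forall>p\<in>Q. \<forall>q\<in>Q. p \<noteq> q \<longrightarrow> path_verts \<Gamma> p \<inter> path_verts \<Gamma> q = {}))"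
  by (simp add: multipaths_def pairwise_def disjnt_def)

lemma multipathI:
  assumes "x = (\<Union>p\<in>Q. set p)" "\<And>p. p \<in> Q \<Longrightarrow> simple_path \<Gamma> p"
    "\<And>p q. \<lbrakk>p \<in> Q; q \<in> Q; p \<noteq> q\<rbrakk> \<Longrightarrow> path_verts \<Gamma> p \<inter> path_verts \<Gamma> q = {}"
  shows "x \<in> multipaths \<Gamma>"
  unfolding multipath_iff by (intro exI[of _ Q] conjI ballI impI assms)

context wf_digraph
begin

text \<open>The vertex list of the whole path is that of p followed by that of q. Distinctness of
  the long list makes both pieces simple and keeps their vertices apart.\<close>

lemma simple_path_splitI:
  assumes "simple_path G (p @ e # q)"
  shows "p = [] \<or> simple_path G p" "q = [] \<or> simple_path G q" "path_verts G p \<inter> path_verts G q = {}"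
proof -
  from assms obtain u v where *: "awalk u (p @ e # q) v" "distinct (awalk_verts u (p @ e # q))"
    by (auto simp: simple_path_def apath_def)
  from *(1) have p: "awalk u p (tail G e)" and q: "awalk (head G e) q v"
    by (auto simp: awalk_append_iff awalk_Cons_iff)
  have "awalk_verts u (p @ e # q) = awalk_verts u p @ awalk_verts (head G e) q"
    using *(1) p by (subst awalk_verts_append[OF *(1)]) simp
  with *(2) have d: "distinct (awalk_verts u p)" "distinct (awalk_verts (head G e) q)"
    "set (awalk_verts u p) \<inter> set (awalk_verts (head G e) q) = {}" by auto
  show "p = [] \<or> simple_path G p" "q = [] \<or> simple_path G q"
    using p q d by (auto simp: simple_path_def apath_def)
  show "path_verts G p \<inter> path_verts G q = {}"
    using d(3) set_awalk_verts[OF p] set_awalk_verts[OF q] by (auto simp: path_verts_def)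
qed

lemma multipath_remove_arc:
  assumes "x \<in> multipaths G"
  shows "x - {e} \<in> multipaths G"
proof (cases "e \<in> x")
  case True
  obtain Q where Q: "x = (\<Union>p\<in>Q. set p)" "\<forall>p\<in>Q. simple_path G p"
    "\<forall>p\<in>Q. \<forall>q\<in>Q. p \<noteq> q \<longrightarrow> path_verts G p \<inter> path_verts G q = {}"
    using assms unfolding multipath_iff by blast
  note Q = Q(1) Q(2,3)[rule_format]
  from True Q(1) obtain p where p: "p \<in> Q" "e \<in> set p" by auto
  from split_list[OF p(2)] obtain p1 p2 where split: "p = p1 @ e # p2" by blast
  have sp: "simple_path G (p1 @ e # p2)" using Q(2)[OF p(1)] split by simp
  have "distinct p"
    using Q(2)[OF p(1)] by (auto simp: simple_path_def apath_def awalk_verts_conv distinct_map)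
  have sub: "path_verts G q \<subseteq> path_verts G p" if "q = p1 \<or> q = p2" for q
    using that by (auto simp: split path_verts_def)
  have e: "e \<notin> set q" if "q \<in> Q - {p}" for q
    using Q(3)[of p q] p that by (auto simp: path_verts_def)
  \<comment> \<open>The path through e is replaced by the pieces before and after e. An empty piece
    is dropped, because simple paths are nonempty here.\<close>
  define Q' where "Q' = (Q - {p}) \<union> ({p1, p2} - {[]})"
  show ?thesis
  proof (rule multipathI[of _ Q'])
    have "x = (\<Union>q\<in>Q - {p}. set q) \<union> set p" using Q(1) p(1) by blast
    also have "\<dots> - {e} = (\<Union>q\<in>Q - {p}. set q) \<union> (set p - {e})" using e by blast
    also have "set p - {e} = (\<Union>q\<in>{p1, p2} - {[]}. set q)"
      using \<open>distinct p\<close> by (cases "p1 = []"; cases "p2 = []") (auto simp: split)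
    finally show "x - {e} = (\<Union>q\<in>Q'. set q)" by (simp add: Q'_def UN_Un)
    show "simple_path G q" if "q \<in> Q'" for q
      using that Q(2) simple_path_splitI[OF sp] by (auto simp: Q'_def)
    fix q r assume "q \<in> Q'" "r \<in> Q'" "q \<noteq> r"
    then consider "q \<in> Q - {p}" "r \<in> Q - {p}" | "q \<in> Q - {p}" "r = p1 \<or> r = p2"
      | "q = p1 \<or> q = p2" "r \<in> Q - {p}" | "q = p1" "r = p2" | "q = p2" "r = p1"
      by (auto simp: Q'_def)
    then show "path_verts G q \<inter> path_verts G r = {}"
    proof cases
      case 1 then show ?thesis using Q(3) \<open>q \<noteq> r\<close> by auto
    next
      case 2 then show ?thesis using Q(3)[of q p] sub[of r] p by auto
    next
      case 3 then show ?thesis using Q(3)[of p r] sub[of q] p by auto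
    next
      case 4 then show ?thesis using simple_path_splitI(3)[OF sp] by simp
    next
      case 5 then show ?thesis using simple_path_splitI(3)[OF sp] by (simp add: Int_commute)
    qed
  qed
qed (use assms in simp)

end

lemma (in fin_digraph) multipath_finite: "x \<in> multipaths G \<Longrightarrow> finite x"
  by (rule finite_subset[OF multipath_subset_arcs finite_arcs])

text \<open>The finitely many missing edges are removed one at a time. This closure makes every edge
  set between two multipaths available for chains and diamonds.\<close>

lemma (in fin_digraph) multipath_subset:
  assumes "y \<in> multipaths G" "x \<subseteq> y"
  shows "x \<in> multipaths G"
proof -
  have "y - z \<in> multipaths G" if "finite z" for z
    using that
  proof (induction z rule: finite_induct)
    case (insert e z)
    have "y - insert e z = y - z - {e}" by blast
    then show ?case using multipath_remove_arc[OF insert.IH] by metis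
  qed (use assms in simp)
  from this[of "y - x"] show ?thesis
    using assms multipath_finite[OF assms(1)] by (simp add: double_diff)
qed

text \<open>A multipath embeds into a disjoint union of integer lines: \<open>l\<close> is the line of a vertex and
  \<open>h\<close> its position.\<close>

definition line_embedding ::
  "('v, 'e) pre_digraph \<Rightarrow> 'e set \<Rightarrow> ('v \<Rightarrow> 'l) \<Rightarrow> ('v \<Rightarrow> nat) \<Rightarrow> bool"
  where "line_embedding G x l h \<longleftrightarrow>
    (\<forall>e\<in>x. l (head G e) = l (tail G e) \<and> h (head G e) = Suc (h (tail G e))) \<and>
    inj_on (\<lambda>e. (l (tail G e), h (tail G e))) x"

lemma (in wf_digraph) line_embedding_exists:
  assumes "x \<in> multipaths G"
  obtains l :: "'a \<Rightarrow> 'b list" and h where "line_embedding G x l h"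
proof -
  obtain Q where Q: "x = (\<Union>p\<in>Q. set p)" "\<forall>p\<in>Q. simple_path G p"
    "\<forall>p\<in>Q. \<forall>q\<in>Q. p \<noteq> q \<longrightarrow> path_verts G p \<inter> path_verts G q = {}"
    using assms unfolding multipath_iff by blast
  note Q = Q(1) Q(2,3)[rule_format]
  \<comment> \<open>The lines are the paths themselves, and the position of a vertex is its index in
    the vertex list. Vertices on no path get arbitrary values; \<open>line_embedding\<close> looks
    only at ends of edges of x.\<close>
  define l where "l v = (THE p. p \<in> Q \<and> v \<in> path_verts G p)" for v
  have l: "l v = p" if "p \<in> Q" "v \<in> path_verts G p" for v p
    unfolding l_def using that Q(3) by (intro the_equality) blast+
  define vs where "vs p = map (tail G) p @ [head G (last p)]" for p
  define h where "h v = (THE i. i < length (vs (l v)) \<and> vs (l v) ! i = v)" for v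
  have main: "l (tail G (p ! i)) = p \<and> l (head G (p ! i)) = p \<and> h (tail G (p ! i)) = i \<and> h (head G (p ! i)) = Suc i"
    if p: "p \<in> Q" and i: "i < length p" for p i
  proof -
    from Q(2)[OF p] obtain u v where ne: "p \<noteq> []" and *: "awalk u p v" "distinct (awalk_verts u p)"
      by (auto simp: simple_path_def apath_def)
    have vs: "awalk_verts u p = vs p" using ne by (simp add: vs_def awalk_verts_conv)
    \<comment> \<open>The same vertex list read as the first tail followed by all heads, so that
      entry \<open>Suc i\<close> is the head of edge i, while \<open>vs\<close> has the tail of edge
      i as entry i.\<close>
    have vs': "awalk_verts u p = tail G (hd p) # map (head G) p"
      using ne *(1) by (auto simp: awalk_def awalk_verts_conv' simp del: awalk_verts_conv)
    have nth': "vs p ! Suc i = head G (p ! i)" using i unfolding vs[symmetric] vs' by simp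
    have nth: "vs p ! i = tail G (p ! i)" "Suc i < length (vs p)"
      using i by (simp_all add: vs_def nth_append)
    have l: "l (tail G (p ! i)) = p" "l (head G (p ! i)) = p"
      using i by (auto intro!: l[OF p] simp: path_verts_def)
    have the: "(THE j. j < length (vs p) \<and> vs p ! j = vs p ! n) = n" if "n < length (vs p)" for n
      using that *(2) by (intro the_equality) (auto simp: vs nth_eq_iff_index_eq)
    show ?thesis
      using l the[of i] the[of "Suc i"] nth nth' by (simp add: h_def)
  qed
  have "line_embedding G x l h"
    unfolding line_embedding_def
  proof (intro conjI ballI inj_onI)
    fix e assume "e \<in> x"
    then obtain p i where "p \<in> Q" "i < length p" "e = p ! i" by (auto simp: Q(1) in_set_conv_nth)
    then show "l (head G e) = l (tail G e)" "h (head G e) = Suc (h (tail G e))" using main by simp_all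
  next
    fix e e' assume "e \<in> x" "e' \<in> x" and eq: "(l (tail G e), h (tail G e)) = (l (tail G e'), h (tail G e'))"
    then obtain p i q j where "p \<in> Q" "i < length p" "e = p ! i" "q \<in> Q" "j < length q" "e' = q ! j"
      unfolding Q(1) by (metis UN_E in_set_conv_nth)
    with eq show "e = e'" using main[of p i] main[of q j] by simp
  qed
  then show ?thesis by (rule that)
qed

section \<open>Components\<close>

abbreviation comp_of :: "('v, 'e) pre_digraph \<Rightarrow> 'e set \<Rightarrow> 'v \<Rightarrow> 'v set"
  where "comp_of G x v \<equiv> component (spanning G x) v"

lemma spanning_simps [simp]:
  "verts (spanning G x) = verts G" "arcs (spanning G x) = x"
  "tail (spanning G x) = tail G" "head (spanning G x) = head G"
  by (simp_all add: spanning_def)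

lemma equiv_connectivity: "equiv (verts G) (connectivity G)"
proof (rule equivI)
  let ?E = "arcs_ends G \<union> (arcs_ends G)\<inverse>"
  show "connectivity G \<subseteq> verts G \<times> verts G" by (auto simp: connectivity_def)
  show "refl_on (verts G) (connectivity G)"
    by (auto simp: connectivity_def refl_on_def)
  have "sym (?E\<^sup>*)" by (intro sym_rtrancl) (auto simp: sym_def)
  then show "sym (connectivity G)" by (auto simp: connectivity_def sym_def)
  have "trans (?E\<^sup>*)" by (rule trans_rtrancl)
  then show "trans (connectivity G)" unfolding connectivity_def trans_def by blast
qed

lemma pi0_eq_components: "pi0 (spanning G x) = comp_of G x ` verts G"
  by (auto simp: pi0_def quotient_def component_def)

lemma component_in_pi0: "v \<in> verts G \<Longrightarrow> comp_of G x v \<in> pi0 (spanning G x)"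
  by (simp add: pi0_eq_components)

lemma component_self: "v \<in> verts G \<Longrightarrow> v \<in> comp_of G x v"
  using equiv_class_self[OF equiv_connectivity[of "spanning G x"]] by (simp add: component_def)

lemma component_subset: "comp_of G x v \<subseteq> verts G"
  by (auto simp: component_def connectivity_def)

lemma component_eqI: "w \<in> comp_of G x v \<Longrightarrow> comp_of G x w = comp_of G x v"
  using equiv_class_eq[OF equiv_connectivity[of "spanning G x"], of v w] by (auto simp: component_def)

lemma component_sym: "\<lbrakk>v \<in> verts G; w \<in> comp_of G x v\<rbrakk> \<Longrightarrow> v \<in> comp_of G x w"
  using component_eqI[of w G x v] component_self[of v G x] by simp

lemma component_eq_iff:
  "\<lbrakk>v \<in> verts G; w \<in> verts G\<rbrakk> \<Longrightarrow> comp_of G x v = comp_of G x w \<longleftrightarrow> w \<in> comp_of G x v"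
  using component_eqI[of w G x v] component_self[of w G x] by auto

lemma pi0_eq_component: "\<lbrakk>\<beta> \<in> pi0 (spanning G x); v \<in> \<beta>\<rbrakk> \<Longrightarrow> \<beta> = comp_of G x v"
  using component_eqI[of v G x] by (auto simp: pi0_eq_components)

lemma pi0_subset: "\<beta> \<in> pi0 (spanning G x) \<Longrightarrow> \<beta> \<subseteq> verts G"
  by (auto simp: pi0_eq_components dest: subsetD[OF component_subset])

lemma pi0_nonempty: "\<beta> \<in> pi0 (spanning G x) \<Longrightarrow> \<exists>v\<in>verts G. v \<in> \<beta>"
  using component_self by (fastforce simp: pi0_eq_components)

text \<open>The source of the upper bounds on components: exhibit a set with no edge between it and
  its complement.\<close>

lemma component_least:
  assumes "v \<in> S" "\<And>e. e \<in> x \<Longrightarrow> tail G e \<in> S \<longleftrightarrow> head G e \<in> S"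
  shows "comp_of G x v \<subseteq> S"
proof
  fix w assume "w \<in> comp_of G x v"
  then have "(v, w) \<in> (arcs_ends (spanning G x) \<union> (arcs_ends (spanning G x))\<inverse>)\<^sup>*"
    by (simp add: component_def connectivity_def)
  then show "w \<in> S"
    by induction (use assms in \<open>auto simp: arcs_ends_def arc_to_ends_def\<close>)
qed

context wf_digraph
begin

lemma ends_in_component:
  assumes "e \<in> x" "e \<in> arcs G"
  shows "tail G e \<in> comp_of G x v \<longleftrightarrow> head G e \<in> comp_of G x v"
proof -
  have "(tail G e, head G e) \<in> arcs_ends (spanning G x)"
    using assms(1) by (auto simp: arcs_ends_def arc_to_ends_def)
  then have *: "(tail G e, head G e) \<in> connectivity (spanning G x)" "(head G e, tail G e) \<in> connectivity (spanning G x)"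
    using assms(2) by (auto simp: connectivity_def)
  have "trans (connectivity (spanning G x))" using equiv_connectivity by (auto simp: equiv_def)
  with * show ?thesis unfolding component_def by (auto dest: transD)
qed

lemma component_mono:
  assumes "x \<subseteq> y" "y \<subseteq> arcs G" "v \<in> verts G"
  shows "comp_of G x v \<subseteq> comp_of G y v"
proof (rule component_least)
  fix e assume "e \<in> x"
  then show "tail G e \<in> comp_of G y v \<longleftrightarrow> head G e \<in> comp_of G y v"
    using assms(1,2) by (intro ends_in_component) auto
qed (rule component_self[OF assms(3)])

text \<open>The upper bound holds because no edge of \<open>insert e x\<close> joins the right-hand
  set to its complement. The lower bound is monotonicity together with the fact that e puts its two
  ends in one component.\<close>

lemma component_insert:
  assumes x: "x \<subseteq> arcs G" and e: "e \<in> arcs G" and v: "v \<in> verts G"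
  shows "comp_of G (insert e x) v =
    (if tail G e \<in> comp_of G x v \<or> head G e \<in> comp_of G x v
     then comp_of G x (tail G e) \<union> comp_of G x (head G e) else comp_of G x v)"
    (is "_ = ?S")
proof
  have te: "tail G e \<in> verts G" and he: "head G e \<in> verts G" using e by auto
  note eqs = component_eq_iff[OF te v, of x] component_eq_iff[OF he v, of x]
    component_eq_iff[OF v te, of x] component_eq_iff[OF v he, of x]
  have vS: "v \<in> ?S"
    using component_self[OF v, of x] eqs by auto
  show "comp_of G (insert e x) v \<subseteq> ?S"
  proof (rule component_least[OF vS])
    fix e' assume "e' \<in> insert e x"
    then show "tail G e' \<in> ?S \<longleftrightarrow> head G e' \<in> ?S"
    proof
      assume "e' = e"
      then show ?thesis using component_self[OF te, of x] component_self[OF he, of x] by simp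
    next
      assume "e' \<in> x"
      then show ?thesis using x ends_in_component[of e' x] by (simp add: subset_iff)
    qed
  qed
  have mono: "comp_of G x w \<subseteq> comp_of G (insert e x) w" if "w \<in> verts G" for w
    using that x e by (intro component_mono) auto
  have eq: "comp_of G (insert e x) (tail G e) = comp_of G (insert e x) (head G e)"
    using ends_in_component[of e "insert e x" "tail G e"] component_self[OF te] e
    by (simp add: component_eq_iff[OF te he])
  show "?S \<subseteq> comp_of G (insert e x) v"
  proof (cases "tail G e \<in> comp_of G x v \<or> head G e \<in> comp_of G x v")
    case True
    then have "tail G e \<in> comp_of G (insert e x) v \<or> head G e \<in> comp_of G (insert e x) v"
      using mono[OF v] by blast
    then have "comp_of G (insert e x) v = comp_of G (insert e x) (tail G e)"
      using component_eqI[of "tail G e" G "insert e x" v] component_eqI[of "head G e" G "insert e x" v] eq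
      by metis
    with True show ?thesis using mono[OF te] mono[OF he] eq by simp
  next
    case False
    then show ?thesis using mono[OF v] by auto
  qed
qed

text \<open>A component that avoids the tail of e was already a component before e was added, so the
  value \<open>a \<beta>\<close> taken there by \<open>F_cover\<close> is a genuine entry of the
  family.\<close>

lemma pi0_insert:
  assumes "x \<subseteq> arcs G" "e \<in> arcs G" "\<beta> \<in> pi0 (spanning G (insert e x))"
  shows "tail G e \<in> \<beta> \<Longrightarrow> \<beta> = comp_of G x (tail G e) \<union> comp_of G x (head G e)"
    and "tail G e \<in> \<beta> \<longleftrightarrow> head G e \<in> \<beta>"
    and "tail G e \<notin> \<beta> \<Longrightarrow> \<beta> \<in> pi0 (spanning G x)"
proof -
  have te: "tail G e \<in> verts G" and he: "head G e \<in> verts G" using assms(2) by auto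
  obtain v where v: "v \<in> verts G" "\<beta> = comp_of G (insert e x) v"
    using assms(3) by (auto simp: pi0_eq_components)
  show th: "tail G e \<in> \<beta> \<longleftrightarrow> head G e \<in> \<beta>"
    using ends_in_component[of e "insert e x" v] assms(2) v by simp
  show "\<beta> = comp_of G x (tail G e) \<union> comp_of G x (head G e)" if "tail G e \<in> \<beta>"
    using pi0_eq_component[OF assms(3) that] component_insert[OF assms(1,2) te] component_self[OF te] by simp
  assume "tail G e \<notin> \<beta>"
  then have "tail G e \<notin> comp_of G x v" "head G e \<notin> comp_of G x v"
    using component_mono[of x "insert e x" v] assms v th by auto
  then show "\<beta> \<in> pi0 (spanning G x)"
    using v component_insert[OF assms(1,2) v(1)] component_in_pi0 by simp
qed

end

section \<open>Separation of components by removed edges, and chains of multipaths\<close>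

context fin_digraph
begin

text \<open>On the line of e, an edge passing from positions up to that of \<open>tail G e\<close>
  to later ones must have its tail at exactly that position. Injectivity makes e the only such edge
  of y, and e is not in x.\<close>

lemma line_cut:
  assumes "line_embedding G y l h" "e \<in> y" "x \<subseteq> y - {e}"
    and v: "l v = l (tail G e)" "h v \<le> h (tail G e)" and w: "w \<in> comp_of G x v"
  shows "l w = l (tail G e) \<and> h w \<le> h (tail G e)"
proof -
  let ?S = "{v. l v = l (tail G e) \<and> h v \<le> h (tail G e)}"
  have "comp_of G x v \<subseteq> ?S"
  proof (rule component_least)
    fix e' assume e': "e' \<in> x"
    have "l (tail G e') = l (tail G e) \<Longrightarrow> h (tail G e') \<noteq> h (tail G e)"
      using assms(1-3) e' by (auto simp: line_embedding_def inj_on_def)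
    moreover have "l (head G e') = l (tail G e')" "h (head G e') = Suc (h (tail G e'))"
      using assms(1-3) e' by (auto simp: line_embedding_def)
    ultimately show "tail G e' \<in> ?S \<longleftrightarrow> head G e' \<in> ?S" by auto
  qed (use v in simp)
  with w show ?thesis by blast
qed

lemma line_invariant:
  assumes "line_embedding G y l h" "x \<subseteq> y" "w \<in> comp_of G x v"
  shows "l w = l v"
proof -
  have "comp_of G x v \<subseteq> {w. l w = l v}"
    by (rule component_least) (use assms(1,2) in \<open>auto simp: line_embedding_def\<close>)
  with assms(3) show ?thesis by blast
qed

text \<open>The head of e lies one position beyond the cut made by removing e.\<close>

lemma multipath_separates:
  assumes y: "y \<in> multipaths G" and e: "e \<in> y" and x: "x \<subseteq> y - {e}"
  shows "head G e \<notin> comp_of G x (tail G e)"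
proof
  assume *: "head G e \<in> comp_of G x (tail G e)"
  obtain l :: "'a \<Rightarrow> 'b list" and h where lh: "line_embedding G y l h"
    by (rule line_embedding_exists[OF y])
  from line_cut[OF lh e x refl order_refl *] have "h (head G e) \<le> h (tail G e)" by simp
  then show False using lh e by (simp add: line_embedding_def)
qed

text \<open>A shared component forces both edges onto one line, where their positions differ by
  injectivity; the cuts at the two positions then exclude each configuration. The third claim rules
  out the cyclic case, in which the second of the two merges would not fuse distinct
  components.\<close>

lemma multipath_separates2:
  assumes y: "y \<in> multipaths G" and e: "e \<in> y" "e' \<in> y" "e \<noteq> e'" and x: "x \<subseteq> y - {e, e'}"
  shows "tail G e' \<notin> comp_of G x (tail G e)"
    and "head G e' \<notin> comp_of G x (head G e)"
    and "\<not> (head G e' \<in> comp_of G x (tail G e) \<and> head G e \<in> comp_of G x (tail G e'))"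
proof -
  obtain l :: "'a \<Rightarrow> 'b list" and h where lh: "line_embedding G y l h"
    by (rule line_embedding_exists[OF y])
  have head: "l (head G e) = l (tail G e)" "h (head G e) = Suc (h (tail G e))" if "e \<in> y" for e
    using lh that by (simp_all add: line_embedding_def)
  have ne: "h (tail G e) \<noteq> h (tail G e')" if "l (tail G e) = l (tail G e')"
    using lh e that by (auto simp: line_embedding_def inj_on_def)
  have verts: "tail G e \<in> verts G" "head G e \<in> verts G" "tail G e' \<in> verts G" "head G e' \<in> verts G"
    using e multipath_subset_arcs[OF y] by auto
  have inv: "w \<in> comp_of G x v \<Longrightarrow> l w = l v" for v w
    by (rule line_invariant[OF lh]) (use x in auto)
  have cut: "w \<in> comp_of G x v \<Longrightarrow> l v = l (tail G e) \<Longrightarrow> h v \<le> h (tail G e) \<Longrightarrow> h w \<le> h (tail G e)"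
    and cut': "w \<in> comp_of G x v \<Longrightarrow> l v = l (tail G e') \<Longrightarrow> h v \<le> h (tail G e') \<Longrightarrow> h w \<le> h (tail G e')" for v w
    using line_cut[OF lh e(1), of x v w] line_cut[OF lh e(2), of x v w] x by auto
  show "tail G e' \<notin> comp_of G x (tail G e)"
  proof
    assume *: "tail G e' \<in> comp_of G x (tail G e)"
    show False
      using cut[OF *] cut'[OF component_sym[OF verts(1) *]] inv[OF *] ne by simp
  qed
  show "head G e' \<notin> comp_of G x (head G e)"
  proof
    assume *: "head G e' \<in> comp_of G x (head G e)"
    show False
      using cut'[OF *] cut[OF component_sym[OF verts(2) *]] inv[OF *] ne head[OF e(1)] head[OF e(2)]
      by (cases "h (tail G e) < h (tail G e')") simp_all
  qed
  show "\<not> (head G e' \<in> comp_of G x (tail G e) \<and> head G e \<in> comp_of G x (tail G e'))"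
  proof
    assume *: "head G e' \<in> comp_of G x (tail G e) \<and> head G e \<in> comp_of G x (tail G e')"
    then show False
      using cut[of "head G e'" "tail G e"] cut'[of "head G e" "tail G e'"] inv[of "head G e'" "tail G e"]
        head[OF e(1)] head[OF e(2)] by simp
  qed
qed

section \<open>Covering relations and saturated chains\<close>

lemma covers_multipaths_iff:
  "covers (multipaths G) x y \<longleftrightarrow> y \<in> multipaths G \<and> (\<exists>e. e \<notin> x \<and> y = insert e x)"
proof
  assume c: "covers (multipaths G) x y"
  then have xy: "x \<in> multipaths G" "y \<in> multipaths G" "x \<subset> y"
    by (auto simp: covers_def)
  then obtain e where e: "e \<in> y" "e \<notin> x" by auto
  \<comment> \<open>Closure under subsets puts this set strictly above x and below y, so a cover
    cannot add more than one edge.\<close>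
  have "insert e x \<in> multipaths G" using multipath_subset[OF xy(2), of "insert e x"] xy e by auto
  moreover have "x < insert e x" "insert e x \<le> y" using e xy by auto
  ultimately have "insert e x = y" using c by (auto simp: covers_def order_le_less)
  then show "y \<in> multipaths G \<and> (\<exists>e. e \<notin> x \<and> y = insert e x)" using xy e by auto
next
  assume "y \<in> multipaths G \<and> (\<exists>e. e \<notin> x \<and> y = insert e x)"
  then obtain e where y: "y \<in> multipaths G" and e: "e \<notin> x" "y = insert e x" by auto
  have "x \<in> multipaths G" using multipath_subset[OF y, of x] e by auto
  moreover have "\<not> (x \<subset> z \<and> z \<subset> insert e x)" for z by blast
  ultimately show "covers (multipaths G) x y"
    using y e unfolding covers_def by auto
qed

lemma coversI: "\<lbrakk>insert e x \<in> multipaths G; e \<notin> x\<rbrakk> \<Longrightarrow> covers (multipaths G) x (insert e x)"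
  by (auto simp: covers_multipaths_iff)

text \<open>Induction on the number of edges missing from a fixed top y. It suits
  \<open>F_along\<close>, which consumes a chain from its bottom.\<close>

lemma multipath_induct [consumes 2, case_names refl step]:
  assumes "y \<in> multipaths G" "x \<subseteq> y"
    and refl: "P y"
    and step: "\<And>x e. \<lbrakk>e \<notin> x; insert e x \<subseteq> y; insert e x \<in> multipaths G; P (insert e x)\<rbrakk> \<Longrightarrow> P x"
  shows "P x"
  using assms(2)
proof (induction "card (y - x)" arbitrary: x)
  case 0
  then have "x = y" using multipath_finite[OF assms(1)] by auto
  then show ?case using refl by simp
next
  case (Suc n)
  have fin: "finite (y - x)" using multipath_finite[OF assms(1)] by simp
  from Suc.hyps(2) have "y - x \<noteq> {}" by force
  then obtain e where e: "e \<in> y" "e \<notin> x" by blast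
  have eq: "y - insert e x = y - x - {e}" by blast
  have "card (y - x) = Suc (card (y - x - {e}))"
    by (rule card.remove[OF fin]) (use e in blast)
  then have "n = card (y - insert e x)" unfolding eq using Suc.hyps(2) by linarith
  then have "P (insert e x)" using e Suc.prems by (intro Suc.hyps(1)) auto
  then show ?case
    by (rule step[where e = e, rotated 3])
      (use e Suc.prems multipath_subset[OF assms(1), of "insert e x"] in auto)
qed

lemma saturated_chain_Cons:
  "saturated_chain (multipaths G) x z (x # y # ys) \<longleftrightarrow>
    covers (multipaths G) x y \<and> saturated_chain (multipaths G) y z (y # ys)"
  by (auto simp: saturated_chain_def covers_def)

lemma saturated_chain_subset:
  assumes "saturated_chain (multipaths G) x y xs"
  shows "x \<subseteq> y"
  using assms
proof (induction xs arbitrary: x)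
  case (Cons a xs)
  then show ?case
  proof (cases xs)
    case (Cons b ys)
    have "a = x" using Cons.prems by (simp add: saturated_chain_def)
    then have "covers (multipaths G) x b" "saturated_chain (multipaths G) b y xs"
      using Cons.prems by (simp_all add: Cons saturated_chain_Cons)
    then show ?thesis using Cons.IH[of b] by (auto simp: covers_def)
  qed (auto simp: saturated_chain_def)
qed (simp add: saturated_chain_def)

lemma saturated_chain_exists:
  assumes "y \<in> multipaths G" "x \<subseteq> y"
  shows "\<exists>xs. saturated_chain (multipaths G) x y xs"
  using assms
proof (induction rule: multipath_induct)
  case refl
  have "saturated_chain (multipaths G) y y [y]" using assms(1) by (simp add: saturated_chain_def)
  then show ?case ..
next
  case (step x e)
  then obtain xs where xs: "saturated_chain (multipaths G) (insert e x) y xs" by blast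
  then obtain ys where "xs = insert e x # ys" by (cases xs) (auto simp: saturated_chain_def)
  then have "saturated_chain (multipaths G) x y (x # xs)"
    using xs coversI[OF step(3,1)] by (simp add: saturated_chain_Cons)
  then show ?case ..
qed

end

section \<open>The coefficient functor\<close>

text \<open>The criterion applied to both \<open>merge\<close> and \<open>push\<close>: varying one
  coordinate of the argument varies a single coordinate of the result, and does so linearly. The
  linear map L may depend on the other coordinates, as in multiplication by a fixed second
  factor.\<close>

lemma multilinear_pure_tensor:
  assumes T: "tensor R I M" and T': "tensor R J N"
    and closed: "\<And>a. a \<in> (\<Pi>\<^sub>E i\<in>I. carrier (M i)) \<Longrightarrow> w a \<in> (\<Pi>\<^sub>E j\<in>J. carrier (N j))"
    and slot: "\<And>a i. \<lbrakk>a \<in> (\<Pi>\<^sub>E i\<in>I. carrier (M i)); i \<in> I\<rbrakk> \<Longrightarrow>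
      \<exists>j\<in>J. \<exists>L. (\<forall>x\<in>carrier (M i). w (a(i := x)) = (w a)(j := L x) \<and> L x \<in> carrier (N j) \<and>
        (\<forall>y\<in>carrier (M i). L (x \<oplus>\<^bsub>M i\<^esub> y) = L x \<oplus>\<^bsub>N j\<^esub> L y) \<and>
        (\<forall>r\<in>carrier R. L (r \<odot>\<^bsub>M i\<^esub> x) = r \<odot>\<^bsub>N j\<^esub> L x))"
  shows "multilinear R I M (tensor_product R J N) (\<lambda>a. pure_tensor R J N (w a))"
proof -
  interpret T: tensor R I M by fact
  interpret T': tensor R J N by fact
  have pure: "pure_tensor R J N (b(j := u \<oplus>\<^bsub>N j\<^esub> v)) =
        pure_tensor R J N (b(j := u)) \<oplus>\<^bsub>T'.T\<^esub> pure_tensor R J N (b(j := v))"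
      "pure_tensor R J N (b(j := r \<odot>\<^bsub>N j\<^esub> u)) = r \<odot>\<^bsub>T'.T\<^esub> pure_tensor R J N (b(j := u))"
    if "b \<in> T'.X" "j \<in> J" "u \<in> carrier (N j)" "v \<in> carrier (N j)" "r \<in> carrier R" for b j u v r
    using T'.pure_tensor_multilinear that by (simp_all add: multilinear_def)
  show ?thesis unfolding multilinear_def
  proof (intro conjI ballI)
    fix a i x assume a: "a \<in> T.X" "i \<in> I" "x \<in> carrier (M i)"
    from slot[OF a(1,2)] obtain j L where j: "j \<in> J" and L:
      "\<And>x. x \<in> carrier (M i) \<Longrightarrow> w (a(i := x)) = (w a)(j := L x)"
      "\<And>x. x \<in> carrier (M i) \<Longrightarrow> L x \<in> carrier (N j)"
      "\<And>x y. \<lbrakk>x \<in> carrier (M i); y \<in> carrier (M i)\<rbrakk> \<Longrightarrow> L (x \<oplus>\<^bsub>M i\<^esub> y) = L x \<oplus>\<^bsub>N j\<^esub> L y"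
      "\<And>x r. \<lbrakk>x \<in> carrier (M i); r \<in> carrier R\<rbrakk> \<Longrightarrow> L (r \<odot>\<^bsub>M i\<^esub> x) = r \<odot>\<^bsub>N j\<^esub> L x"
      by blast
    {
      fix y assume y: "y \<in> carrier (M i)"
      show "pure_tensor R J N (w (a(i := x \<oplus>\<^bsub>M i\<^esub> y))) =
          pure_tensor R J N (w (a(i := x))) \<oplus>\<^bsub>T'.T\<^esub> pure_tensor R J N (w (a(i := y)))"
        using pure(1)[OF closed[OF a(1)] j L(2)[OF a(3)] L(2)[OF y] T.zero_closed]
        by (simp only: L(1,3) a y T.factor_add_closed)
    next
      fix r assume r: "r \<in> carrier R"
      show "pure_tensor R J N (w (a(i := r \<odot>\<^bsub>M i\<^esub> x))) = r \<odot>\<^bsub>T'.T\<^esub> pure_tensor R J N (w (a(i := x)))"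
        using pure(2)[OF closed[OF a(1)] j L(2)[OF a(3)] L(2)[OF a(3)] r]
        by (simp only: L(1,4) a r T.factor_smult_closed)
    }
  qed (intro T'.pure_tensor_closed closed)
qed

section \<open>Tensor factors indexed by components, and their fusion along an edge\<close>

locale coefficients = unital_algebra R A for R :: "('r, 'z) ring_scheme" and A :: "('r, 'a) module"
begin

lemma tensor_F: "tensor R I (\<lambda>_. A)"
  by (intro tensor.intro tensor_axioms.intro module_axioms R.is_cring)

abbreviation "families G x \<equiv> \<Pi>\<^sub>E \<alpha>\<in>pi0 (spanning G x). carrier A"

lemma module_F: "Module.module R (F_obj R G A x)"
  unfolding F_obj_def by (rule tensor.module_tensor[OF tensor_F])

lemma F_map_eqI:
  assumes "Module.module R N" "f \<in> linear_maps R (F_obj R G A x) N" "g \<in> linear_maps R (F_obj R G A x) N"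
    and "\<And>a. a \<in> families G x \<Longrightarrow> f (F_pure R G A x a) = g (F_pure R G A x a)"
  shows "f = g"
  using assms unfolding F_obj_def F_pure_def by (rule tensor.tensor_map_eqI[OF tensor_F])

lemma F_pure_closed: "a \<in> families G x \<Longrightarrow> F_pure R G A x a \<in> carrier (F_obj R G A x)"
  unfolding F_obj_def F_pure_def by (rule tensor.pure_tensor_closed[OF tensor_F])

lemma F_lift_linear:
  assumes "Module.module R N" "multilinear R (pi0 (spanning G x)) (\<lambda>_. A) N u"
  shows "F_lift R G A x N u \<in> linear_maps R (F_obj R G A x) N"
  unfolding F_obj_def F_lift_def by (rule tensor.tensor_lift_linear[OF tensor_F assms])

lemma F_lift_pure:
  assumes "Module.module R N" "multilinear R (pi0 (spanning G x)) (\<lambda>_. A) N u" "a \<in> families G x"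
  shows "F_lift R G A x N u (F_pure R G A x a) = u a"
  unfolding F_pure_def F_lift_def by (rule tensor.tensor_lift_pure[OF tensor_F assms])

end

text \<open>The operation on families behind \<open>F_cover\<close>. Naming it allows diamonds and
  naturality to be verified before passing to tensors.\<close>

definition merge ::
  "('v, 'e) pre_digraph \<Rightarrow> ('r, 'a) module \<Rightarrow> 'e set \<Rightarrow> 'e \<Rightarrow> ('v set \<Rightarrow> 'a) \<Rightarrow> 'v set \<Rightarrow> 'a"
  where "merge G A x e a = (\<lambda>\<beta>\<in>pi0 (spanning G (insert e x)).
    if tail G e \<in> \<beta> then a (comp_of G x (tail G e)) \<otimes>\<^bsub>A\<^esub> a (comp_of G x (head G e)) else a \<beta>)"

locale digraph_coefficients = coefficients R A + fin_digraph G
  for R :: "('r, 'z) ring_scheme" and A :: "('r, 'a) module" and G :: "('v, 'e) pre_digraph"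
begin

abbreviation "Fo \<equiv> F_obj R G A"
abbreviation "Fm \<equiv> F_map R G A"
abbreviation "Fc \<equiv> F_cover R G A"
abbreviation "Fp \<equiv> F_pure R G A"
abbreviation "\<M> \<equiv> multipaths G"

lemma merge_closed:
  assumes "insert e x \<in> \<M>" "a \<in> families G x"
  shows "merge G A x e a \<in> families G (insert e x)"
proof (rule PiE_I)
  fix \<beta> assume \<beta>: "\<beta> \<in> pi0 (spanning G (insert e x))"
  have sub: "x \<subseteq> arcs G" "e \<in> arcs G" using multipath_subset_arcs[OF assms(1)] by auto
  have "a (comp_of G x (tail G e)) \<in> carrier A" "a (comp_of G x (head G e)) \<in> carrier A"
    using assms(2) sub by (auto intro!: PiE_mem[OF assms(2)] component_in_pi0)
  moreover have "tail G e \<notin> \<beta> \<Longrightarrow> a \<beta> \<in> carrier A"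
    using pi0_insert(3)[OF sub \<beta>] PiE_mem[OF assms(2)] by blast
  ultimately show "merge G A x e a \<beta> \<in> carrier A" using \<beta> by (simp add: merge_def)
qed (simp add: merge_def)

lemma F_cover_eq:
  assumes "e \<notin> x"
  shows "Fc x (insert e x) = F_lift R G A x (Fo (insert e x)) (\<lambda>a. Fp (insert e x) (merge G A x e a))"
proof -
  have "(THE e'. e' \<in> insert e x - x) = e" using assms by (intro the_equality) auto
  then show ?thesis by (simp add: F_cover_def merge_def)
qed

lemma merge_multilinear:
  assumes y: "insert e x \<in> \<M>" and e: "e \<notin> x"
  shows "multilinear R (pi0 (spanning G x)) (\<lambda>_. A) (Fo (insert e x)) (\<lambda>a. Fp (insert e x) (merge G A x e a))"
  unfolding F_obj_def F_pure_def
proof (rule multilinear_pure_tensor[OF tensor_F tensor_F merge_closed[OF y]])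
  fix a \<alpha> assume a: "a \<in> families G x" and \<alpha>: "\<alpha> \<in> pi0 (spanning G x)"
  have sub: "x \<subseteq> arcs G" "e \<in> arcs G" using multipath_subset_arcs[OF y] by auto
  then have ends: "tail G e \<in> verts G" "head G e \<in> verts G" by auto
  let ?T = "comp_of G x (tail G e)" and ?H = "comp_of G x (head G e)" and ?y = "insert e x"
  \<comment> \<open>If the two components coincided, the product would be quadratic in their common
    factor.\<close>
  have TH: "?T \<noteq> ?H"
    using multipath_separates[OF y, of e x] e by (subst component_eq_iff[OF ends]) auto
  have aT: "a ?T \<in> carrier A" and aH: "a ?H \<in> carrier A"
    using ends by (auto intro!: PiE_mem[OF a] component_in_pi0)
  have y_ends: "comp_of G ?y (tail G e) \<in> pi0 (spanning G ?y)" "tail G e \<in> comp_of G ?y (tail G e)"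
    using ends by (auto intro: component_in_pi0 component_self)
  have merged: "\<beta> = comp_of G ?y (tail G e)" if "\<beta> \<in> pi0 (spanning G ?y)" "tail G e \<in> \<beta>" for \<beta>
    using pi0_eq_component[OF that] .
  \<comment> \<open>A component away from the tail of e is also away from its head, so it is neither
    of the two fusing components, and updating one of these does not affect it.\<close>
  have unmerged: "\<beta> \<noteq> ?T" "\<beta> \<noteq> ?H" if "\<beta> \<in> pi0 (spanning G ?y)" "tail G e \<notin> \<beta>" for \<beta>
    using that pi0_insert(2)[OF sub that(1)] component_self[OF ends(1), of x] component_self[OF ends(2), of x]
    by auto
  consider "\<alpha> = ?T" | "\<alpha> = ?H" | "\<alpha> \<noteq> ?T" "\<alpha> \<noteq> ?H" by blast
  then show "\<exists>j\<in>pi0 (spanning G ?y). \<exists>L. \<forall>z\<in>carrier A.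
      merge G A x e (a(\<alpha> := z)) = (merge G A x e a)(j := L z) \<and> L z \<in> carrier A \<and>
      (\<forall>w\<in>carrier A. L (z \<oplus>\<^bsub>A\<^esub> w) = L z \<oplus>\<^bsub>A\<^esub> L w) \<and> (\<forall>r\<in>carrier R. L (r \<odot>\<^bsub>A\<^esub> z) = r \<odot>\<^bsub>A\<^esub> L z)"
  proof cases
    case 1
    show ?thesis
      by (rule bexI[OF _ y_ends(1)], rule exI[of _ "\<lambda>z. z \<otimes>\<^bsub>A\<^esub> a ?H"])
        (use 1 TH aH y_ends unmerged in \<open>auto simp: merge_def fun_eq_iff l_distr smult_mult_left dest: merged\<close>)
  next
    case 2
    show ?thesis
      by (rule bexI[OF _ y_ends(1)], rule exI[of _ "\<lambda>z. a ?T \<otimes>\<^bsub>A\<^esub> z"])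
        (use 2 TH aT y_ends unmerged in \<open>auto simp: merge_def fun_eq_iff r_distr smult_mult_right dest: merged\<close>)
  next
    case 3
    obtain v where v: "v \<in> verts G" "\<alpha> = comp_of G x v" using \<alpha> by (auto simp: pi0_eq_components)
    have "tail G e \<notin> \<alpha>" "head G e \<notin> \<alpha>"
      using 3 component_eqI[of "tail G e" G x v] component_eqI[of "head G e" G x v] v by auto
    then have "\<alpha> \<in> pi0 (spanning G ?y)" "tail G e \<notin> \<alpha>"
      using component_insert[OF sub v(1)] component_in_pi0[OF v(1), of ?y] v(2) by auto
    then show ?thesis
      by (intro bexI[of _ \<alpha>] exI[of _ "\<lambda>z. z"]) (use 3 in \<open>auto simp: merge_def fun_eq_iff\<close>)
  qed
qed

lemma F_cover_linear:
  assumes "insert e x \<in> \<M>" "e \<notin> x"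
  shows "Fc x (insert e x) \<in> linear_maps R (Fo x) (Fo (insert e x))"
  unfolding F_cover_eq[OF assms(2)] by (rule F_lift_linear[OF module_F merge_multilinear[OF assms]])

lemma F_cover_pure:
  assumes "insert e x \<in> \<M>" "e \<notin> x" "a \<in> families G x"
  shows "Fc x (insert e x) (Fp x a) = Fp (insert e x) (merge G A x e a)"
  unfolding F_cover_eq[OF assms(2)] by (rule F_lift_pure[OF module_F merge_multilinear[OF assms(1,2)] assms(3)])

lemma merge_apply:
  "\<lbrakk>insert e x \<in> \<M>; v \<in> verts G\<rbrakk> \<Longrightarrow> merge G A x e a (comp_of G (insert e x) v) =
    (if tail G e \<in> comp_of G (insert e x) v
     then a (comp_of G x (tail G e)) \<otimes>\<^bsub>A\<^esub> a (comp_of G x (head G e)) else a (comp_of G (insert e x) v))"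
  by (simp add: merge_def component_in_pi0)


text \<open>A closed form for adding e first and e' second. Tails lie apart and so do heads, hence
  the first merge can reach the tail of e' only through the component of the head of e, and the head
  of e' only through the component of the tail of e.\<close>

lemma merge_twice:
  assumes z: "insert e' (insert e x) \<in> \<M>" and e: "e \<notin> x" "e' \<notin> x" "e \<noteq> e'"
    and \<gamma>: "\<gamma> \<in> pi0 (spanning G (insert e' (insert e x)))"
  defines "T \<equiv> comp_of G x (tail G e)" and "H \<equiv> comp_of G x (head G e)"
    and "T' \<equiv> comp_of G x (tail G e')" and "H' \<equiv> comp_of G x (head G e')"
  shows "merge G A (insert e x) e' (merge G A x e a) \<gamma> =
    (if tail G e' \<in> \<gamma>
     then (if head G e \<in> T' then a T \<otimes>\<^bsub>A\<^esub> a H else a T') \<otimes>\<^bsub>A\<^esub> (if tail G e \<in> H' then a T \<otimes>\<^bsub>A\<^esub> a H else a H')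
     else if tail G e \<in> \<gamma> then a T \<otimes>\<^bsub>A\<^esub> a H else a \<gamma>)"
proof -
  have xe: "insert e x \<in> \<M>" by (rule multipath_subset[OF z]) blast
  have arcs: "x \<subseteq> arcs G" "e \<in> arcs G" "insert e x \<subseteq> arcs G" "e' \<in> arcs G"
    using multipath_subset_arcs[OF z] by auto
  then have ends: "tail G e' \<in> verts G" "head G e' \<in> verts G" by auto
  have sep: "tail G e \<notin> T'" "head G e \<notin> H'"
    unfolding T'_def H'_def
    by (rule multipath_separates2[OF z, of e' e x]; use e in auto)+
  have "merge G A x e a (comp_of G (insert e x) (tail G e')) = (if head G e \<in> T' then a T \<otimes>\<^bsub>A\<^esub> a H else a T')"
    using merge_apply[OF xe ends(1), of a] component_insert[OF arcs(1,2) ends(1)] sep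
      component_self[of "tail G e" G x] arcs(2)
    by (auto simp: T_def H_def T'_def)
  moreover have "merge G A x e a (comp_of G (insert e x) (head G e')) = (if tail G e \<in> H' then a T \<otimes>\<^bsub>A\<^esub> a H else a H')"
    using merge_apply[OF xe ends(2), of a] component_insert[OF arcs(1,2) ends(2)] sep
      component_self[of "tail G e" G x] arcs(2)
    by (auto simp: T_def H_def H'_def)
  moreover have "merge G A x e a \<gamma> = (if tail G e \<in> \<gamma> then a T \<otimes>\<^bsub>A\<^esub> a H else a \<gamma>)" if "tail G e' \<notin> \<gamma>"
    using pi0_insert(3)[OF arcs(3,4) \<gamma> that] by (simp add: merge_def T_def H_def)
  ultimately show ?thesis using \<gamma> by (simp add: merge_def[of G A "insert e x"])
qed

lemma merge_commute:
  assumes z: "insert e' (insert e x) \<in> \<M>" and e: "e \<notin> x" "e' \<notin> x" "e \<noteq> e'" and a: "a \<in> families G x"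
  shows "merge G A (insert e x) e' (merge G A x e a) = merge G A (insert e' x) e (merge G A x e' a)"
proof
  fix \<gamma>
  let ?z = "insert e' (insert e x)"
  have comm: "insert e (insert e' x) = ?z" by blast
  show "merge G A (insert e x) e' (merge G A x e a) \<gamma> = merge G A (insert e' x) e (merge G A x e' a) \<gamma>"
  proof (cases "\<gamma> \<in> pi0 (spanning G ?z)")
    case False
    then show ?thesis by (simp add: merge_def[of G A "insert _ x"] comm)
  next
    case \<gamma>: True
    define T H T' H' where "T = comp_of G x (tail G e)" and "H = comp_of G x (head G e)"
      and "T' = comp_of G x (tail G e')" and "H' = comp_of G x (head G e')"
    note defs = this
    have arcs: "x \<subseteq> arcs G" "e \<in> arcs G" "insert e x \<subseteq> arcs G" "e' \<in> arcs G"
      using multipath_subset_arcs[OF z] by auto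
    then have ends: "tail G e \<in> verts G" "head G e \<in> verts G" "tail G e' \<in> verts G" "head G e' \<in> verts G" by auto
    have sep: "tail G e' \<notin> T" "head G e' \<notin> H" "\<not> (head G e' \<in> T \<and> head G e \<in> T')"
      unfolding defs by (rule multipath_separates2[OF z, of e e' x]; use e in auto)+
    \<comment> \<open>Memberships of ends are turned into equalities of components, so that the
      closed forms for the two orders are governed by the same two conditions.\<close>
    have P: "head G e \<in> T' \<longleftrightarrow> T' = H" "tail G e' \<in> H \<longleftrightarrow> T' = H"
      and Q: "head G e' \<in> T \<longleftrightarrow> H' = T" "tail G e \<in> H' \<longleftrightarrow> H' = T"
      using component_eq_iff[OF ends(3,2), of x] component_eq_iff[OF ends(2,3), of x]
        component_eq_iff[OF ends(1,4), of x] component_eq_iff[OF ends(4,1), of x] unfolding defs by auto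
    have mono: "comp_of G x v \<subseteq> comp_of G ?z v" if "v \<in> verts G" for v
      using that arcs by (intro component_mono) auto
    \<comment> \<open>In the consecutive cases all ends of both edges land in one component, so both
      closed forms select the same branch.\<close>
    have together: "tail G e \<in> \<gamma> \<longleftrightarrow> tail G e' \<in> \<gamma>" if "T' = H \<or> H' = T"
    proof -
      have "comp_of G ?z (tail G e) = comp_of G ?z (tail G e')"
        using that
      proof
        assume "T' = H"
        then have "head G e \<in> comp_of G ?z (tail G e')" using P(1) mono[OF ends(3)] by (auto simp: T'_def)
        then have "tail G e \<in> comp_of G ?z (tail G e')" using ends_in_component[of e ?z] arcs by simp
        then show ?thesis by (rule component_eqI)
      next
        assume "H' = T"
        then have "head G e' \<in> comp_of G ?z (tail G e)" using Q(1) mono[OF ends(1)] by (auto simp: T_def)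
        then have "tail G e' \<in> comp_of G ?z (tail G e)" using ends_in_component[of e' ?z] arcs by simp
        then show ?thesis by (rule component_eqI[symmetric])
      qed
      then show ?thesis
        using pi0_eq_component[OF \<gamma>, of "tail G e"] pi0_eq_component[OF \<gamma>, of "tail G e'"]
          component_self[OF ends(1), of ?z] component_self[OF ends(3), of ?z] by auto
    qed
    \<comment> \<open>Adding e produces T \<union> H, which contains no end of e', so adding e'
      leaves it unchanged and away from the tail of e'. The two merges then act on different
      coordinates.\<close>
    have apart: "\<not> (tail G e \<in> \<gamma> \<and> tail G e' \<in> \<gamma>)" if "T' \<noteq> H" "H' \<noteq> T"
    proof
      assume *: "tail G e \<in> \<gamma> \<and> tail G e' \<in> \<gamma>"
      have "comp_of G (insert e x) (tail G e) = T \<union> H"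
        using component_insert[OF arcs(1,2) ends(1)] component_self[OF ends(1), of x] by (simp add: defs)
      then have "comp_of G ?z (tail G e) = T \<union> H"
        using component_insert[OF arcs(3,4) ends(1)] sep P Q that by simp
      moreover have "\<gamma> = comp_of G ?z (tail G e)" using pi0_eq_component[OF \<gamma>] * by blast
      ultimately show False using * sep P that by auto
    qed
    have cl: "a T \<in> carrier A" "a H \<in> carrier A" "a T' \<in> carrier A" "a H' \<in> carrier A"
      unfolding defs using ends by (auto intro!: PiE_mem[OF a] component_in_pi0)
    have lhs: "merge G A (insert e x) e' (merge G A x e a) \<gamma> = (if tail G e' \<in> \<gamma>
       then (if T' = H then a T \<otimes>\<^bsub>A\<^esub> a H else a T') \<otimes>\<^bsub>A\<^esub> (if H' = T then a T \<otimes>\<^bsub>A\<^esub> a H else a H')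
       else if tail G e \<in> \<gamma> then a T \<otimes>\<^bsub>A\<^esub> a H else a \<gamma>)"
      using merge_twice[OF z e \<gamma>, of a] unfolding defs[symmetric] P Q .
    have z': "insert e (insert e' x) \<in> \<M>" and \<gamma>': "\<gamma> \<in> pi0 (spanning G (insert e (insert e' x)))"
      unfolding comm by (fact z \<gamma>)+
    have rhs: "merge G A (insert e' x) e (merge G A x e' a) \<gamma> = (if tail G e \<in> \<gamma>
       then (if H' = T then a T' \<otimes>\<^bsub>A\<^esub> a H' else a T) \<otimes>\<^bsub>A\<^esub> (if T' = H then a T' \<otimes>\<^bsub>A\<^esub> a H' else a H)
       else if tail G e' \<in> \<gamma> then a T' \<otimes>\<^bsub>A\<^esub> a H' else a \<gamma>)"
      using merge_twice[OF z' e(2,1) e(3)[symmetric] \<gamma>', of a] unfolding defs[symmetric] P Q .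
    have not_both: "\<not> (H' = T \<and> T' = H)" using sep(3) unfolding P Q .
    show ?thesis
    proof (cases "T' = H")
      case True
      with not_both have "H' \<noteq> T" by simp
      \<comment> \<open>Here e' starts where e ends: the two sides are \<open>a T\<close>,
        \<open>a H\<close>, \<open>a H'\<close> multiplied in this order with different
        brackets.\<close>
      show ?thesis
        unfolding lhs rhs if_P[OF True] if_not_P[OF \<open>H' \<noteq> T\<close>]
        using together True cl by (simp add: m_assoc)
    next
      case False
      show ?thesis
      proof (cases "H' = T")
        case True
        \<comment> \<open>The mirror case, with e starting where e' ends: the factors are
          \<open>a T'\<close>, \<open>a T\<close>, \<open>a H\<close> in this order.\<close>
        show ?thesis
          unfolding lhs rhs if_P[OF True] if_not_P[OF \<open>T' \<noteq> H\<close>]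
          using together True cl by (simp add: m_assoc)
      next
        case False
        show ?thesis
          unfolding lhs rhs if_not_P[OF \<open>T' \<noteq> H\<close>] if_not_P[OF False]
          using apart[OF \<open>T' \<noteq> H\<close> False] by simp
      qed
    qed
  qed
qed

lemma F_cover_commute:
  assumes z: "insert e' (insert e x) \<in> \<M>" and e: "e \<notin> x" "e' \<notin> x" "e \<noteq> e'" and v: "v \<in> carrier (Fo x)"
  shows "Fc (insert e x) (insert e' (insert e x)) (Fc x (insert e x) v) =
    Fc (insert e' x) (insert e' (insert e x)) (Fc x (insert e' x) v)"
proof -
  let ?z = "insert e' (insert e x)"
  have comm: "insert e (insert e' x) = ?z" by blast
  have M: "insert e x \<in> \<M>" "insert e' x \<in> \<M>" by (rule multipath_subset[OF z]; blast)+
  have lin: "Fc (insert e x) ?z \<in> linear_maps R (Fo (insert e x)) (Fo ?z)"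
      "Fc (insert e' x) ?z \<in> linear_maps R (Fo (insert e' x)) (Fo ?z)"
    using F_cover_linear[of e' "insert e x"] F_cover_linear[of e "insert e' x"] z e by (auto simp: comm)
  have "compose (carrier (Fo x)) (Fc (insert e x) ?z) (Fc x (insert e x)) =
      compose (carrier (Fo x)) (Fc (insert e' x) ?z) (Fc x (insert e' x))"
  proof (rule F_map_eqI[OF module_F
        linear_maps_compose[OF module_F F_cover_linear[OF M(1) e(1)] lin(1)]
        linear_maps_compose[OF module_F F_cover_linear[OF M(2) e(2)] lin(2)]])
    fix a assume a: "a \<in> families G x"
    have "Fc (insert e x) ?z (Fc x (insert e x) (Fp x a)) = Fp ?z (merge G A (insert e x) e' (merge G A x e a))"
      using F_cover_pure[OF M(1) e(1) a] F_cover_pure[OF z _ merge_closed[OF M(1) a]] e by simp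
    also have "\<dots> = Fp ?z (merge G A (insert e' x) e (merge G A x e' a))"
      by (simp only: merge_commute[OF z e a])
    also have "\<dots> = Fc (insert e' x) ?z (Fc x (insert e' x) (Fp x a))"
      using F_cover_pure[OF M(2) e(2) a] F_cover_pure[of e "insert e' x", OF _ _ merge_closed[OF M(2) a]] e z
      by (simp add: comm)
    finally show "compose (carrier (Fo x)) (Fc (insert e x) ?z) (Fc x (insert e x)) (Fp x a) =
        compose (carrier (Fo x)) (Fc (insert e' x) ?z) (Fc x (insert e' x)) (Fp x a)"
      using F_pure_closed[OF a] by (simp add: compose_eq)
  qed
  from fun_cong[OF this, of v] v show ?thesis by (simp add: compose_eq)
qed

section \<open>Independence of the saturated chain\<close>

lemma F_along_Cons:
  "v \<in> carrier (Fo x) \<Longrightarrow> F_along R G A (x # y # zs) v = F_along R G A (y # zs) (Fc x y v)"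
  by (simp add: compose_eq)

lemma saturated_chain_cases:
  assumes "saturated_chain \<M> x y xs"
  obtains "xs = [x]" "y = x" | e zs where "xs = x # insert e x # zs" "e \<notin> x" "insert e x \<in> \<M>"
    "insert e x \<subseteq> y" "saturated_chain \<M> (insert e x) y (insert e x # zs)"
proof (cases xs)
  case Nil
  then show ?thesis using assms by (simp add: saturated_chain_def)
next
  case (Cons x' ys)
  then have x': "x' = x" using assms by (simp add: saturated_chain_def)
  show ?thesis
  proof (cases ys)
    case Nil
    then show ?thesis using that(1) assms Cons x' by (auto simp: saturated_chain_def)
  next
    case (Cons y' zs)
    then have c: "covers \<M> x y'" and s: "saturated_chain \<M> y' y (y' # zs)"
      using assms \<open>xs = x' # ys\<close> x' by (simp_all add: saturated_chain_Cons)
    from c obtain e where "e \<notin> x" "y' = insert e x" "insert e x \<in> \<M>" by (auto simp: covers_multipaths_iff)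
    then show ?thesis using that(2)[of e zs] s saturated_chain_subset[OF s] Cons \<open>xs = x' # ys\<close> x' by simp
  qed
qed

text \<open>Two chains starting with different edges are compared through a common continuation of the
  diamond formed by these edges.\<close>

lemma F_along_unique:
  assumes "y \<in> \<M>" "saturated_chain \<M> x y xs" "saturated_chain \<M> x y ys" "v \<in> carrier (Fo x)"
  shows "F_along R G A xs v = F_along R G A ys v"
  using assms(2-)
proof (induction "card (y - x)" arbitrary: x xs ys v rule: less_induct)
  case less
  note IH = less(1)
  have smaller: "card (y - insert e x) < card (y - x)" if "e \<notin> x" "insert e x \<subseteq> y" for e
    by (rule psubset_card_mono) (use that multipath_finite[OF assms(1)] in auto)
  from less(2) show ?case
  proof (cases rule: saturated_chain_cases)
    case 1
    from \<open>saturated_chain \<M> x y ys\<close> show ?thesis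
      by (cases rule: saturated_chain_cases) (use 1 in auto)
  next
    case (2 e zs)
    note xs = this
    have eq_xs: "F_along R G A xs v = F_along R G A (insert e x # zs) (Fc x (insert e x) v)"
      using xs(1) \<open>v \<in> carrier (Fo x)\<close> by (simp only: F_along_Cons)
    from \<open>saturated_chain \<M> x y ys\<close> show ?thesis
    proof (cases rule: saturated_chain_cases)
      case 1
      then show ?thesis using xs by auto
    next
      case (2 e' zs')
      note ys = this
      have eq_ys: "F_along R G A ys v = F_along R G A (insert e' x # zs') (Fc x (insert e' x) v)"
        using ys(1) \<open>v \<in> carrier (Fo x)\<close> by (simp only: F_along_Cons)
      have cl: "Fc x (insert e x) v \<in> carrier (Fo (insert e x))" "Fc x (insert e' x) v \<in> carrier (Fo (insert e' x))"
        using linear_maps_closed[OF F_cover_linear] xs ys \<open>v \<in> carrier (Fo x)\<close> by auto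
      show ?thesis
      proof (cases "e = e'")
        case True
        then show ?thesis
          unfolding eq_xs eq_ys using IH[OF smaller[OF xs(2,4)] xs(5) _ cl(1)] ys(5) by simp
      next
        case False
        let ?z = "insert e' (insert e x)"
        have comm: "insert e (insert e' x) = ?z" by blast
        have zy: "?z \<subseteq> y" using xs ys by auto
        have z: "?z \<in> \<M>" using multipath_subset[OF assms(1) zy] .
        obtain ws where ws: "saturated_chain \<M> ?z y ws" using saturated_chain_exists[OF assms(1) zy] ..
        then obtain ws' where ws': "ws = ?z # ws'" by (cases ws) (auto simp: saturated_chain_def)
        have c: "covers \<M> (insert e x) ?z" "covers \<M> (insert e' x) ?z"
          using coversI[of e' "insert e x"] coversI[of e "insert e' x"] z xs ys False by (auto simp: comm)
        have "saturated_chain \<M> (insert e x) y (insert e x # ws)" "saturated_chain \<M> (insert e' x) y (insert e' x # ws)"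
          using c ws by (simp_all add: ws' saturated_chain_Cons)
        note chains = this
        have "F_along R G A (insert e x # zs) (Fc x (insert e x) v) = F_along R G A (insert e x # ws) (Fc x (insert e x) v)"
          by (rule IH[OF smaller[OF xs(2,4)] xs(5) chains(1) cl(1)])
        also have "\<dots> = F_along R G A ws (Fc (insert e x) ?z (Fc x (insert e x) v))"
          using cl(1) unfolding ws' by (rule F_along_Cons)
        also have "\<dots> = F_along R G A ws (Fc (insert e' x) ?z (Fc x (insert e' x) v))"
          by (simp only: F_cover_commute[OF z xs(2) ys(2) False \<open>v \<in> carrier (Fo x)\<close>])
        also have "\<dots> = F_along R G A (insert e' x # ws) (Fc x (insert e' x) v)"
          using cl(2) unfolding ws' by (rule F_along_Cons[symmetric])
        also have "\<dots> = F_along R G A (insert e' x # zs') (Fc x (insert e' x) v)"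
          by (rule IH[OF smaller[OF ys(2,4)] chains(2) ys(5) cl(2)])
        finally show ?thesis unfolding eq_xs eq_ys .
      qed
    qed
  qed
qed

text \<open>Frees \<open>F_map\<close> from the chain picked by choice, so that any convenient chain
  computes it.\<close>

lemma F_map_eq_along:
  assumes "y \<in> \<M>" "saturated_chain \<M> x y xs" "v \<in> carrier (Fo x)"
  shows "Fm x y v = F_along R G A xs v"
  unfolding F_map_def
  by (rule F_along_unique[OF assms(1) _ assms(2,3)]) (rule someI[of "saturated_chain \<M> x y", OF assms(2)])

lemma F_map_refl:
  assumes "x \<in> \<M>" "v \<in> carrier (Fo x)"
  shows "Fm x x v = v"
proof -
  have "saturated_chain \<M> x x [x]" using assms(1) by (simp add: saturated_chain_def)
  from F_map_eq_along[OF assms(1) this assms(2)] assms(2) show ?thesis by simp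
qed

text \<open>The recursion behind linearity, composition and naturality of \<open>F_map\<close>. Any
  edge of y outside x can serve as the first one, because some saturated chain begins with
  it.\<close>

lemma F_map_step:
  assumes y: "y \<in> \<M>" and e: "e \<notin> x" "insert e x \<subseteq> y" and v: "v \<in> carrier (Fo x)"
  shows "Fm x y v = Fm (insert e x) y (Fc x (insert e x) v)"
proof -
  have M: "insert e x \<in> \<M>" by (rule multipath_subset[OF y e(2)])
  obtain ws where ws: "saturated_chain \<M> (insert e x) y ws" using saturated_chain_exists[OF y e(2)] ..
  then obtain ws' where ws': "ws = insert e x # ws'" by (cases ws) (auto simp: saturated_chain_def)
  have chain: "saturated_chain \<M> x y (x # insert e x # ws')"
    using ws coversI[OF M e(1)] by (simp add: ws' saturated_chain_Cons)
  have cl: "Fc x (insert e x) v \<in> carrier (Fo (insert e x))"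
    by (rule linear_maps_closed[OF F_cover_linear[OF M e(1)] v])
  show ?thesis
    using F_map_eq_along[OF y chain v] F_map_eq_along[OF y ws cl] F_along_Cons[OF v, of "insert e x" ws']
    by (simp only: ws')
qed

lemma F_along_extensional:
  assumes "saturated_chain \<M> x y xs"
  shows "F_along R G A xs \<in> extensional (carrier (Fo x))"
  using assms by (cases rule: saturated_chain_cases) auto

lemma F_map_linear:
  assumes "y \<in> \<M>" "x \<subseteq> y"
  shows "Fm x y \<in> linear_maps R (Fo x) (Fo y)"
proof -
  have "(\<lambda>v\<in>carrier (Fo x). Fm x y v) \<in> linear_maps R (Fo x) (Fo y)"
    using assms
  proof (induction rule: multipath_induct)
    case refl
    have "(\<lambda>v\<in>carrier (Fo y). Fm y y v) = (\<lambda>v\<in>carrier (Fo y). v)"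
      by (rule restrict_ext) (rule F_map_refl[OF assms(1)])
    then show ?case using linear_maps_ident[OF module_F[of G y]] by (simp only:)
  next
    case (step x e)
    note lin = F_cover_linear[OF step(3,1)]
    have "(\<lambda>v\<in>carrier (Fo x). Fm x y v) =
        compose (carrier (Fo x)) (\<lambda>v\<in>carrier (Fo (insert e x)). Fm (insert e x) y v) (Fc x (insert e x))"
      unfolding compose_def
      by (rule restrict_ext) (simp add: F_map_step[OF assms(1) step(1,2)] linear_maps_closed[OF lin])
    then show ?case using linear_maps_compose[OF module_F lin step(4)] by (simp only:)
  qed
  \<comment> \<open>The induction only sees values on the carrier, whereas
    \<open>linear_maps\<close> also asks for extensionality. The latter is read off from the chain
    used in the definition.\<close>
  moreover have "(\<lambda>v\<in>carrier (Fo x). Fm x y v) = Fm x y"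
  proof (rule extensional_restrict)
    obtain xs where "saturated_chain \<M> x y xs" using saturated_chain_exists[OF assms] ..
    then have "saturated_chain \<M> x y (SOME xs. saturated_chain \<M> x y xs)" by (rule someI)
    then show "Fm x y \<in> extensional (carrier (Fo x))" unfolding F_map_def by (rule F_along_extensional)
  qed
  ultimately show ?thesis by simp
qed

text \<open>The induction lowers x with y and z fixed; the maps out of x to y and to z peel off the
  same first edge.\<close>

lemma F_map_comp:
  assumes y: "y \<in> \<M>" "x \<subseteq> y" and z: "z \<in> \<M>" "y \<subseteq> z" and v: "v \<in> carrier (Fo x)"
  shows "Fm y z (Fm x y v) = Fm x z v"
  using y v
proof (induction arbitrary: v rule: multipath_induct)
  case refl
  then show ?case by (simp add: F_map_refl[OF y(1)])
next
  case (step x e)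
  have cl: "Fc x (insert e x) v \<in> carrier (Fo (insert e x))"
    by (rule linear_maps_closed[OF F_cover_linear[OF step(3,1)] step(5)])
  have "insert e x \<subseteq> z" using step(2) z(2) by blast
  then show ?case
    using step(4)[OF cl] F_map_step[OF y(1) step(1,2,5)] F_map_step[OF z(1) step(1) _ step(5)] by simp
qed

lemma poset_functor_F: "poset_functor R \<M> Fo Fm"
  by (intro poset_functor.intro poset_functor_axioms.intro R.is_cring module_F F_map_linear F_map_comp)

end

section \<open>Inclusions and algebra homomorphisms\<close>

text \<open>Needed because \<open>tau\<close> and \<open>sigma\<close> are identified with
  \<open>transport\<close> on multipaths only, not as functions on all edge sets.\<close>

lemma homology_map_cong:
  assumes "poset_transformation R P Fo Fm Q Go Gm g \<tau>" "poset_transformation R P Fo Fm Q Go Gm h \<sigma>"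
    and gh: "\<And>x. x \<in> P \<Longrightarrow> g x = h x" and \<tau>: "\<And>x. x \<in> P \<Longrightarrow> \<tau> x = \<sigma> x"
  shows "induced_homology_map P Fo Fm Q Go Gm g \<tau> k = induced_homology_map P Fo Fm Q Go Gm h \<sigma> k"
proof -
  interpret \<tau>: poset_transformation R P Fo Fm Q Go Gm g \<tau> by fact
  interpret \<sigma>: poset_transformation R P Fo Fm Q Go Gm h \<sigma> by fact
  have "\<tau>.\<Phi> k = \<sigma>.\<Phi> k"
  proof (rule \<tau>.F.chain_map_eqI[OF \<tau>.G.module_chain \<tau>.chain_map_linear \<sigma>.chain_map_linear])
    fix xs v assume xs: "xs \<in> simplices P k" and v: "v \<in> carrier (Fo (hd xs))"
    have "map g xs = map h xs" using xs gh by (auto simp: simplices_def)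
    then show "\<tau>.\<Phi> k (\<tau>.F.\<epsilon> k v xs) = \<sigma>.\<Phi> k (\<tau>.F.\<epsilon> k v xs)"
      using \<tau>.chain_map_elementary[OF xs v] \<sigma>.chain_map_elementary[OF xs v] \<tau>[OF hd_simplex[OF xs]]
      by (simp del: map_eq_conv)
  qed
  then show ?thesis by (simp add: induced_homology_map_def)
qed

text \<open>The operation on families behind \<open>transport\<close>, in the role that
  \<open>merge\<close> has for \<open>F_cover\<close>.\<close>

definition push ::
  "('v, 'e) pre_digraph \<Rightarrow> ('v \<Rightarrow> 'w) \<times> ('e \<Rightarrow> 'f) \<Rightarrow> ('w, 'f) pre_digraph \<Rightarrow> ('a \<Rightarrow> 'b) \<Rightarrow> ('r, 'b) module
    \<Rightarrow> 'e set \<Rightarrow> ('v set \<Rightarrow> 'a) \<Rightarrow> 'w set \<Rightarrow> 'b"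
  where "push G f H \<phi> B x a = (\<lambda>\<beta>\<in>pi0 (spanning H (snd f ` x)).
    if \<beta> \<subseteq> fst f ` verts G then \<phi> (a {v \<in> verts G. fst f v \<in> \<beta>}) else \<one>\<^bsub>B\<^esub>)"

text \<open>This specializes to \<^const>\<open>tau\<close> for \<open>\<phi> = id\<close> and to \<^const>\<open>sigma\<close> for \<open>f = id\<close>, so that one functor on
  the product category induces both kinds of maps.\<close>

definition transport ::
  "('r, 'z) ring_scheme \<Rightarrow> ('v, 'e) pre_digraph \<Rightarrow> ('v \<Rightarrow> 'w) \<times> ('e \<Rightarrow> 'f) \<Rightarrow> ('w, 'f) pre_digraph
    \<Rightarrow> ('r, 'a) module \<Rightarrow> ('a \<Rightarrow> 'b) \<Rightarrow> ('r, 'b) module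
    \<Rightarrow> 'e set \<Rightarrow> ('v, 'a, 'r) tensor \<Rightarrow> ('w, 'b, 'r) tensor"
  where "transport R G f H A \<phi> B x = F_lift R G A x (F_obj R H B (snd f ` x))
    (\<lambda>a. F_pure R H B (snd f ` x) (push G f H \<phi> B x a))"

locale digraph_algebra_map = D: digraph_coefficients R A G + E: digraph_coefficients R B H
  for R :: "('r, 'z) ring_scheme" and A :: "('r, 'a) module" and G :: "('v, 'e) pre_digraph"
    and B :: "('r, 'b) module" and H :: "('w, 'f) pre_digraph" +
  fixes f :: "('v \<Rightarrow> 'w) \<times> ('e \<Rightarrow> 'f)" and \<phi> :: "'a \<Rightarrow> 'b"
  assumes f: "f \<in> inclusions G H" and \<phi>_hom: "\<phi> \<in> ring_hom A B" and \<phi>_linear: "\<phi> \<in> linear_maps R A B"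
begin

abbreviation "fv \<equiv> fst f"
abbreviation "fe \<equiv> snd f"

section \<open>Images of multipaths and components under an inclusion\<close>

lemma fv_closed: "v \<in> verts G \<Longrightarrow> fv v \<in> verts H"
  and fe_closed: "e \<in> arcs G \<Longrightarrow> fe e \<in> arcs H"
  and inj_fv: "inj_on fv (verts G)" and inj_fe: "inj_on fe (arcs G)"
  and fe_ends: "e \<in> arcs G \<Longrightarrow> tail H (fe e) = fv (tail G e)" "e \<in> arcs G \<Longrightarrow> head H (fe e) = fv (head G e)"
  using f by (auto simp: inclusions_def)

abbreviation "push\<^sub>f \<equiv> push G f H \<phi> B"

text \<open>Injectivity on vertices keeps the image of the vertex list free of repetitions.\<close>

lemma simple_path_map:
  assumes "simple_path G p"
  shows "simple_path H (map fe p)"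
proof -
  from assms obtain u v where p: "p \<noteq> []" "D.awalk u p v" "distinct (D.awalk_verts u p)"
    by (auto simp: simple_path_def pre_digraph.apath_def)
  have arcs: "set p \<subseteq> arcs G" and u: "u \<in> verts G" and cas: "D.cas u p v"
    using p(2) by (auto simp: D.awalk_def)
  have "E.cas (fv u) (map fe p) (fv v)"
    using cas arcs by (induction u p v rule: D.cas.induct) (auto simp: fe_ends)
  then have walk: "E.awalk (fv u) (map fe p) (fv v)"
    using arcs u fv_closed fe_closed by (auto simp: E.awalk_def)
  have "E.awalk_verts (fv u) (map fe p) = map fv (D.awalk_verts u p)"
    using p(1) arcs last_in_set[OF p(1)]
    by (auto simp: D.awalk_verts_conv E.awalk_verts_conv last_map fe_ends subset_iff)
  moreover have "inj_on fv (set (D.awalk_verts u p))"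
    by (rule inj_on_subset[OF inj_fv]) (rule subsetI, rule D.awalk_verts_in_verts[OF u arcs])
  ultimately have "distinct (E.awalk_verts (fv u) (map fe p))"
    using p(3) by (simp add: distinct_map)
  with walk p(1) show ?thesis by (auto simp: simple_path_def E.apath_def)
qed

lemma path_verts_map: "set p \<subseteq> arcs G \<Longrightarrow> path_verts H (map fe p) = fv ` path_verts G p"
  by (auto simp: path_verts_def image_Un image_image fe_ends subset_iff cong: image_cong)

lemma multipath_image:
  assumes "x \<in> D.\<M>"
  shows "fe ` x \<in> E.\<M>"
proof -
  obtain Q where Q: "x = (\<Union>p\<in>Q. set p)" "\<forall>p\<in>Q. simple_path G p"
    "\<forall>p\<in>Q. \<forall>q\<in>Q. p \<noteq> q \<longrightarrow> path_verts G p \<inter> path_verts G q = {}"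
    using assms unfolding multipath_iff by blast
  show ?thesis
  proof (rule multipathI[of _ "map fe ` Q"])
    show "fe ` x = (\<Union>p\<in>map fe ` Q. set p)" by (auto simp: Q(1))
    show "simple_path H p" if "p \<in> map fe ` Q" for p
      using that Q(2) simple_path_map by auto
    fix p' q' assume "p' \<in> map fe ` Q" "q' \<in> map fe ` Q" "p' \<noteq> q'"
    then obtain p q where pq: "p \<in> Q" "q \<in> Q" "p' = map fe p" "q' = map fe q" "p \<noteq> q" by auto
    have arcs: "set p \<subseteq> arcs G" "set q \<subseteq> arcs G"
      using pq Q(2) simple_path_subset_arcs by blast+
    then have "path_verts G p \<subseteq> verts G" "path_verts G q \<subseteq> verts G"
      by (auto simp: path_verts_def)
    then have "fv ` path_verts G p \<inter> fv ` path_verts G q = fv ` (path_verts G p \<inter> path_verts G q)"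
      by (rule inj_on_image_Int[OF inj_fv, symmetric])
    then show "path_verts H p' \<inter> path_verts H q' = {}"
      using pq Q(3) path_verts_map arcs by simp
  qed
qed

text \<open>Both inclusions come from \<open>component_least\<close>. Each edge of the image
  multipath is the image of an edge of x, and injectivity on vertices turns membership of an end in
  the image of a component into membership in the component.\<close>

lemma component_image:
  assumes x: "x \<subseteq> arcs G" and v: "v \<in> verts G"
  shows "comp_of H (fe ` x) (fv v) = fv ` comp_of G x v"
proof
  show "comp_of H (fe ` x) (fv v) \<subseteq> fv ` comp_of G x v"
  proof (rule component_least)
    show "fv v \<in> fv ` comp_of G x v" using component_self[OF v] by blast
    fix e' assume "e' \<in> fe ` x"
    then obtain e where e: "e \<in> x" "e' = fe e" "e \<in> arcs G" using x by blast
    have mem: "fv w \<in> fv ` comp_of G x v \<longleftrightarrow> w \<in> comp_of G x v" if "w \<in> verts G" for w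
      using inj_on_image_mem_iff[OF inj_fv that component_subset] .
    show "tail H e' \<in> fv ` comp_of G x v \<longleftrightarrow> head H e' \<in> fv ` comp_of G x v"
      using e D.ends_in_component[OF e(1,3)] by (simp add: fe_ends mem)
  qed
  have "comp_of G x v \<subseteq> {w. fv w \<in> comp_of H (fe ` x) (fv v)}"
  proof (rule component_least)
    show "v \<in> {w. fv w \<in> comp_of H (fe ` x) (fv v)}" using component_self[OF fv_closed[OF v]] by simp
    fix e assume e: "e \<in> x"
    then have "fe e \<in> fe ` x" "fe e \<in> arcs H" "e \<in> arcs G" using x fe_closed by auto
    then show "tail G e \<in> {w. fv w \<in> comp_of H (fe ` x) (fv v)} \<longleftrightarrow> head G e \<in> {w. fv w \<in> comp_of H (fe ` x) (fv v)}"
      using E.ends_in_component[of "fe e" "fe ` x" "fv v"] by (simp add: fe_ends)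
  qed
  then show "fv ` comp_of G x v \<subseteq> comp_of H (fe ` x) (fv v)" by blast
qed

abbreviation "pre \<beta> \<equiv> {v \<in> verts G. fv v \<in> \<beta>}"

lemma pi0_image:
  assumes "x \<subseteq> arcs G" "\<alpha> \<in> pi0 (spanning G x)"
  shows "fv ` \<alpha> \<in> pi0 (spanning H (fe ` x))" "pre (fv ` \<alpha>) = \<alpha>" "fv ` \<alpha> \<subseteq> fv ` verts G"
proof -
  obtain v where v: "v \<in> verts G" "\<alpha> = comp_of G x v" using assms(2) by (auto simp: pi0_eq_components)
  show "fv ` \<alpha> \<in> pi0 (spanning H (fe ` x))"
    using component_image[OF assms(1) v(1)] component_in_pi0[OF fv_closed[OF v(1)]] v(2) by metis
  show "pre (fv ` \<alpha>) = \<alpha>" using pi0_subset[OF assms(2)] inj_fv by (auto simp: inj_on_def)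
  show "fv ` \<alpha> \<subseteq> fv ` verts G" using pi0_subset[OF assms(2)] by blast
qed

text \<open>A component that meets the image of the vertices is the image of a component and so lies
  inside that image. The inclusion test in \<open>tau\<close> therefore distinguishes exactly the
  images of components from the components disjoint from the image.\<close>

lemma pi0_image_cases:
  assumes x: "x \<subseteq> arcs G" and \<beta>: "\<beta> \<in> pi0 (spanning H (fe ` x))"
  obtains (image) \<alpha> where "\<alpha> \<in> pi0 (spanning G x)" "\<beta> = fv ` \<alpha>" "pre \<beta> = \<alpha>" "\<beta> \<subseteq> fv ` verts G"
    | (outside) "\<not> \<beta> \<subseteq> fv ` verts G" "\<beta> \<inter> fv ` verts G = {}"
proof (cases "\<beta> \<inter> fv ` verts G = {}")
  case True
  then show ?thesis using outside pi0_nonempty[OF \<beta>] by blast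
next
  case False
  then obtain v where v: "v \<in> verts G" "fv v \<in> \<beta>" by blast
  have "\<beta> = fv ` comp_of G x v" using pi0_eq_component[OF \<beta> v(2)] component_image[OF x v(1)] by simp
  then show ?thesis
    using image[of "comp_of G x v"] component_in_pi0[OF v(1), of x] pi0_image[OF x] by simp
qed

section \<open>Transport of families and tensors, and its naturality\<close>

lemma push_image:
  assumes "x \<subseteq> arcs G" "\<alpha> \<in> pi0 (spanning G x)"
  shows "push\<^sub>f x a (fv ` \<alpha>) = \<phi> (a \<alpha>)"
  using pi0_image[OF assms] by (simp add: push_def)

lemma push_outside:
  assumes "\<beta> \<in> pi0 (spanning H (fe ` x))" "\<not> \<beta> \<subseteq> fv ` verts G"
  shows "push\<^sub>f x a \<beta> = \<one>\<^bsub>B\<^esub>"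
  using assms by (simp add: push_def)

lemma push_closed:
  assumes x: "x \<subseteq> arcs G" and a: "a \<in> D.families G x"
  shows "push\<^sub>f x a \<in> E.families H (fe ` x)"
proof (rule PiE_I)
  fix \<beta> assume \<beta>: "\<beta> \<in> pi0 (spanning H (fe ` x))"
  from x \<beta> show "push\<^sub>f x a \<beta> \<in> carrier B"
  proof (cases rule: pi0_image_cases)
    case (image \<alpha>)
    then show ?thesis
      using push_image[OF x image(1)] linear_maps_closed[OF \<phi>_linear] PiE_mem[OF a image(1)] by simp
  next
    case outside
    then show ?thesis using push_outside[OF \<beta>] by simp
  qed
qed (simp add: push_def)

text \<open>Distinct components have distinct images, so an update of one factor is seen in one
  factor of the result only, through \<phi>.\<close>

lemma push_fun_upd:
  assumes x: "x \<subseteq> arcs G" and \<alpha>: "\<alpha> \<in> pi0 (spanning G x)"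
  shows "push\<^sub>f x (a(\<alpha> := z)) = (push\<^sub>f x a)(fv ` \<alpha> := \<phi> z)"
proof
  fix \<beta>
  show "push\<^sub>f x (a(\<alpha> := z)) \<beta> = ((push\<^sub>f x a)(fv ` \<alpha> := \<phi> z)) \<beta>"
  proof (cases "\<beta> \<in> pi0 (spanning H (fe ` x))")
    case False
    then have "\<beta> \<noteq> fv ` \<alpha>" using pi0_image(1)[OF x \<alpha>] by metis
    with False show ?thesis by (simp only: push_def restrict_apply fun_upd_apply if_False)
  next
    case True
    from x True show ?thesis
    proof (cases rule: pi0_image_cases)
      case (image \<alpha>')
      have "\<beta> = fv ` \<alpha> \<longleftrightarrow> \<alpha>' = \<alpha>" using image(2,3) pi0_image(2)[OF x \<alpha>] by metis
      then show ?thesis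
        using push_image[OF x image(1), of a] push_image[OF x image(1), of "a(\<alpha> := z)"] image(2)
        by (cases "\<alpha>' = \<alpha>") simp_all
    next
      case outside
      then have "\<beta> \<noteq> fv ` \<alpha>" using pi0_image(3)[OF x \<alpha>] by auto
      then show ?thesis using push_outside[OF True outside(1)] by simp
    qed
  qed
qed

lemma push_multilinear:
  assumes x: "x \<subseteq> arcs G"
  shows "multilinear R (pi0 (spanning G x)) (\<lambda>_. A) (E.Fo (fe ` x))
    (\<lambda>a. E.Fp (fe ` x) (push\<^sub>f x a))"
  unfolding F_obj_def F_pure_def
proof (rule multilinear_pure_tensor[OF D.tensor_F E.tensor_F push_closed[OF x]])
  fix a \<alpha> assume \<alpha>: "\<alpha> \<in> pi0 (spanning G x)"
  show "\<exists>j\<in>pi0 (spanning H (fe ` x)). \<exists>L. \<forall>z\<in>carrier A.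
      push\<^sub>f x (a(\<alpha> := z)) = (push\<^sub>f x a)(j := L z) \<and> L z \<in> carrier B \<and>
      (\<forall>w\<in>carrier A. L (z \<oplus>\<^bsub>A\<^esub> w) = L z \<oplus>\<^bsub>B\<^esub> L w) \<and> (\<forall>r\<in>carrier R. L (r \<odot>\<^bsub>A\<^esub> z) = r \<odot>\<^bsub>B\<^esub> L z)"
    by (rule bexI[OF _ pi0_image(1)[OF x \<alpha>]], rule exI[of _ \<phi>])
      (simp add: push_fun_upd[OF x \<alpha>] linear_maps_closed[OF \<phi>_linear] linear_maps_add[OF \<phi>_linear]
        linear_maps_smult[OF \<phi>_linear])
qed

abbreviation "\<rho> \<equiv> transport R G f H A \<phi> B"

lemma transport_linear:
  assumes "x \<subseteq> arcs G"
  shows "\<rho> x \<in> linear_maps R (D.Fo x) (E.Fo (fe ` x))"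
  unfolding transport_def by (rule D.F_lift_linear[OF E.module_F push_multilinear[OF assms]])

lemma transport_pure:
  assumes "x \<subseteq> arcs G" "a \<in> D.families G x"
  shows "\<rho> x (D.Fp x a) = E.Fp (fe ` x) (push\<^sub>f x a)"
  unfolding transport_def by (rule D.F_lift_pure[OF E.module_F push_multilinear[OF assms(1)] assms(2)])

text \<open>Naturality on families. On the fused component it is multiplicativity of \<phi>. Every
  other component is either the image of one that the merge leaves alone, or lies outside the image
  of the inclusion, where both sides are 1.\<close>

lemma push_merge:
  assumes y: "insert e x \<in> D.\<M>" and e: "e \<notin> x" and a: "a \<in> D.families G x"
  shows "push\<^sub>f (insert e x) (merge G A x e a) = merge H B (fe ` x) (fe e) (push\<^sub>f x a)"
proof
  fix \<gamma>
  let ?y = "insert e x"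
  have sub: "x \<subseteq> arcs G" "e \<in> arcs G" "?y \<subseteq> arcs G" using multipath_subset_arcs[OF y] by auto
  then have ends: "tail G e \<in> verts G" "head G e \<in> verts G" by auto
  have img: "fe ` ?y = insert (fe e) (fe ` x)" by simp
  have sub': "fe ` x \<subseteq> arcs H" "fe e \<in> arcs H" using sub fe_closed by auto
  show "push\<^sub>f ?y (merge G A x e a) \<gamma> = merge H B (fe ` x) (fe e) (push\<^sub>f x a) \<gamma>"
  proof (cases "\<gamma> \<in> pi0 (spanning H (fe ` ?y))")
    case False
    then show ?thesis by (simp add: push_def[of _ _ _ _ _ ?y] merge_def[of H])
  next
    case \<gamma>: True
    have te: "tail H (fe e) = fv (tail G e)" "head H (fe e) = fv (head G e)" using fe_ends sub by auto
    show ?thesis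
    proof (cases "tail H (fe e) \<in> \<gamma>")
      case True
      have "\<gamma> = fv ` comp_of G ?y (tail G e)"
        using pi0_eq_component[OF \<gamma> True] component_image[OF sub(3) ends(1)] te by simp
      then have "push\<^sub>f ?y (merge G A x e a) \<gamma> = \<phi> (merge G A x e a (comp_of G ?y (tail G e)))"
        using push_image[OF sub(3) component_in_pi0[OF ends(1)]] by simp
      also have "\<dots> = \<phi> (a (comp_of G x (tail G e)) \<otimes>\<^bsub>A\<^esub> a (comp_of G x (head G e)))"
        using D.merge_apply[OF y ends(1)] component_self[OF ends(1), of ?y] by simp
      also have "\<dots> = \<phi> (a (comp_of G x (tail G e))) \<otimes>\<^bsub>B\<^esub> \<phi> (a (comp_of G x (head G e)))"
        by (intro ring_hom_mult[OF \<phi>_hom] PiE_mem[OF a] component_in_pi0 ends)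
      also have "\<dots> = push\<^sub>f x a (comp_of H (fe ` x) (tail H (fe e))) \<otimes>\<^bsub>B\<^esub>
          push\<^sub>f x a (comp_of H (fe ` x) (head H (fe e)))"
        by (simp add: te component_image[OF sub(1) ends(1)] component_image[OF sub(1) ends(2)]
            push_image[OF sub(1) component_in_pi0[OF ends(1)]] push_image[OF sub(1) component_in_pi0[OF ends(2)]])
      also have "\<dots> = merge H B (fe ` x) (fe e) (push\<^sub>f x a) \<gamma>"
        using True \<gamma> by (simp add: merge_def)
      finally show ?thesis .
    next
      case False
      have \<gamma>x: "\<gamma> \<in> pi0 (spanning H (fe ` x))"
        using E.pi0_insert(3)[OF sub' \<gamma>[unfolded img] False] .
      have rhs: "merge H B (fe ` x) (fe e) (push\<^sub>f x a) \<gamma> = push\<^sub>f x a \<gamma>"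
        using \<gamma> False by (simp add: merge_def)
      from sub(3) \<gamma> show ?thesis
      proof (cases rule: pi0_image_cases)
        case (image \<alpha>)
        have "tail G e \<notin> \<alpha>" using False image(2) te by auto
        then have "merge G A x e a \<alpha> = a \<alpha>" "\<alpha> \<in> pi0 (spanning G x)"
          using image(1) D.pi0_insert(3)[OF sub(1,2) image(1)] by (simp_all add: merge_def)
        then show ?thesis
          using push_image[OF sub(3) image(1)] push_image[OF sub(1)] image(2) rhs by simp
      next
        case outside
        then show ?thesis using push_outside[OF \<gamma>] push_outside[OF \<gamma>x] rhs by simp
      qed
    qed
  qed
qed

lemma transport_cover:
  assumes y: "insert e x \<in> D.\<M>" and e: "e \<notin> x" and v: "v \<in> carrier (D.Fo x)"
  shows "\<rho> (insert e x) (D.Fc x (insert e x) v) =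
    E.Fc (fe ` x) (insert (fe e) (fe ` x)) (\<rho> x v)"
proof -
  let ?y = "insert e x" and ?fy = "insert (fe e) (fe ` x)"
  have sub: "x \<subseteq> arcs G" "?y \<subseteq> arcs G" using multipath_subset_arcs[OF y] by auto
  have y': "?fy \<in> E.\<M>" using multipath_image[OF y] by simp
  have e': "fe e \<notin> fe ` x" using e sub inj_fe by (auto simp: inj_on_def)
  have lin: "\<rho> ?y \<in> linear_maps R (D.Fo ?y) (E.Fo ?fy)"
    using transport_linear[OF sub(2)] by simp
  have "compose (carrier (D.Fo x)) (\<rho> ?y) (D.Fc x ?y) =
      compose (carrier (D.Fo x)) (E.Fc (fe ` x) ?fy) (\<rho> x)"
  proof (rule D.F_map_eqI[OF E.module_F
        linear_maps_compose[OF D.module_F D.F_cover_linear[OF y e] lin]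
        linear_maps_compose[OF D.module_F transport_linear[OF sub(1)] E.F_cover_linear[OF y' e']]])
    fix a assume a: "a \<in> D.families G x"
    have "\<rho> ?y (D.Fc x ?y (D.Fp x a)) = E.Fc (fe ` x) ?fy (\<rho> x (D.Fp x a))"
      using D.F_cover_pure[OF y e a] transport_pure[OF sub(2) D.merge_closed[OF y a]] transport_pure[OF sub(1) a]
        E.F_cover_pure[OF y' e' push_closed[OF sub(1) a]] push_merge[OF y e a]
      by simp
    then show "compose (carrier (D.Fo x)) (\<rho> ?y) (D.Fc x ?y) (D.Fp x a) =
        compose (carrier (D.Fo x)) (E.Fc (fe ` x) ?fy) (\<rho> x) (D.Fp x a)"
      using D.F_pure_closed[OF a] by (simp add: compose_eq)
  qed
  from fun_cong[OF this, of v] v show ?thesis by (simp add: compose_eq)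
qed

text \<open>Injectivity on edges makes the image of a newly added edge new again, so
  \<open>F_map_step\<close> applies on both sides and \<open>transport_cover\<close> compares the
  two first steps.\<close>

lemma transport_natural:
  assumes y: "y \<in> D.\<M>" "x \<subseteq> y" and v: "v \<in> carrier (D.Fo x)"
  shows "\<rho> y (D.Fm x y v) = E.Fm (fe ` x) (fe ` y) (\<rho> x v)"
  using y v
proof (induction arbitrary: v rule: D.multipath_induct)
  case refl
  then show ?case
    using D.F_map_refl[OF y(1)] E.F_map_refl[OF multipath_image[OF y(1)]]
      linear_maps_closed[OF transport_linear[OF multipath_subset_arcs[OF y(1)]]] by simp
next
  case (step x e)
  have sub: "x \<subseteq> arcs G" "insert e x \<subseteq> arcs G" using multipath_subset_arcs[OF step(3)] by auto
  have e': "fe e \<notin> fe ` x" using step(1) sub inj_fe by (auto simp: inj_on_def)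
  have y': "insert (fe e) (fe ` x) \<subseteq> fe ` y" using step(2) by auto
  have cl: "D.Fc x (insert e x) v \<in> carrier (D.Fo (insert e x))"
    by (rule linear_maps_closed[OF D.F_cover_linear[OF step(3,1)] step(5)])
  have "\<rho> y (D.Fm x y v) = E.Fm (fe ` insert e x) (fe ` y) (\<rho> (insert e x) (D.Fc x (insert e x) v))"
    using D.F_map_step[OF y(1) step(1,2,5)] step(4)[OF cl] by simp
  also have "\<dots> = E.Fm (fe ` x) (fe ` y) (\<rho> x v)"
    using E.F_map_step[OF multipath_image[OF y(1)] e' y' linear_maps_closed[OF transport_linear[OF sub(1)] step(5)]]
      transport_cover[OF step(3,1,5)] by simp
  finally show ?case .
qed

lemma transformation:
  "poset_transformation R D.\<M> D.Fo D.Fm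
    E.\<M> E.Fo E.Fm ((`) fe) \<rho>"
  by (intro poset_transformation.intro poset_transformation_axioms.intro D.poset_functor_F E.poset_functor_F
      multipath_image image_mono transport_linear multipath_subset_arcs transport_natural)

end

lemma poset_transformation_cong:
  assumes T: "poset_transformation R P Fo Fm Q Go Gm g \<tau>"
    and g: "\<And>x. x \<in> P \<Longrightarrow> h x = g x" and \<tau>: "\<And>x. x \<in> P \<Longrightarrow> \<sigma> x = \<tau> x"
  shows "poset_transformation R P Fo Fm Q Go Gm h \<sigma>"
proof -
  interpret poset_transformation R P Fo Fm Q Go Gm g \<tau> by fact
  show ?thesis
    by (intro poset_transformation.intro poset_transformation_axioms.intro F.poset_functor_axioms
        G.poset_functor_axioms)
      (simp_all add: g \<tau> g_closed g_mono \<tau>_linear naturality)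
qed

section \<open>Comparison of transport with the given induced maps\<close>

abbreviation transport_homology ::
  "('r, 'z) ring_scheme \<Rightarrow> ('v, 'e) pre_digraph \<Rightarrow> ('v \<Rightarrow> 'w) \<times> ('e \<Rightarrow> 'f) \<Rightarrow> ('w, 'f) pre_digraph
    \<Rightarrow> ('r, 'a) module \<Rightarrow> ('a \<Rightarrow> 'b) \<Rightarrow> ('r, 'b) module \<Rightarrow> int
    \<Rightarrow> ('v, 'e, 'a, 'r) homology_class \<Rightarrow> ('w, 'f, 'b, 'r) homology_class"
  where "transport_homology R G f H A \<phi> B \<equiv> induced_homology_map
    (multipaths G) (F_obj R G A) (F_map R G A) (multipaths H) (F_obj R H B) (F_map R H B)
    ((`) (snd f)) (transport R G f H A \<phi> B)"

abbreviation digraph_id :: "('v, 'e) pre_digraph \<Rightarrow> ('v \<Rightarrow> 'v) \<times> ('e \<Rightarrow> 'e)"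
  where "digraph_id H \<equiv> (\<lambda>v\<in>verts H. v, \<lambda>e\<in>arcs H. e)"

abbreviation digraph_comp ::
  "('v, 'e) pre_digraph \<Rightarrow> ('w \<Rightarrow> 'x) \<times> ('f \<Rightarrow> 'g) \<Rightarrow> ('v \<Rightarrow> 'w) \<times> ('e \<Rightarrow> 'f) \<Rightarrow> ('v \<Rightarrow> 'x) \<times> ('e \<Rightarrow> 'g)"
  where "digraph_comp H g f \<equiv> (compose (verts H) (fst g) (fst f), compose (arcs H) (snd g) (snd f))"

text \<open>The description defining \<open>tensor_lift\<close> refers to u on extensional families
  only.\<close>

lemma F_lift_cong:
  assumes "\<And>a. a \<in> (\<Pi>\<^sub>E \<alpha>\<in>pi0 (spanning H x). carrier A) \<Longrightarrow> u a = u' a"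
  shows "F_lift R H A x N u = F_lift R H A x N u'"
  unfolding F_lift_def tensor_lift_def using assms by (simp cong: ball_cong)

text \<open>The identity arrow of A is restricted to the carrier, so the two families agree because
  the entries of a that are used lie in the carrier.\<close>

lemma tau_eq_transport:
  assumes "digraph_algebra_map R A G A H f (\<lambda>a\<in>carrier A. a)" "x \<in> multipaths G"
  shows "tau R A G f H x = transport R G f H A (\<lambda>a\<in>carrier A. a) A x"
  unfolding tau_def transport_def
proof (rule F_lift_cong)
  interpret digraph_algebra_map R A G A H f "\<lambda>a\<in>carrier A. a" by fact
  let ?\<phi> = "\<lambda>a\<in>carrier A. a"
  fix a assume a: "a \<in> D.families G x"
  have x: "x \<subseteq> arcs G" by (rule multipath_subset_arcs[OF assms(2)])
  have "(if \<beta> \<subseteq> fv ` verts G then a (pre \<beta>) else \<one>\<^bsub>A\<^esub>) = (if \<beta> \<subseteq> fv ` verts G then ?\<phi> (a (pre \<beta>)) else \<one>\<^bsub>A\<^esub>)"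
    if "\<beta> \<in> pi0 (spanning H (fe ` x))" for \<beta>
    using x that
  proof (cases rule: pi0_image_cases)
    case (image \<alpha>)
    then show ?thesis using PiE_mem[OF a image(1)] by simp
  next
    case outside
    then show ?thesis by simp
  qed
  then have "(\<lambda>\<beta>\<in>pi0 (spanning H (fe ` x)). if \<beta> \<subseteq> fv ` verts G then a (pre \<beta>) else \<one>\<^bsub>A\<^esub>) = push G f H ?\<phi> A x a"
    unfolding push_def by (rule restrict_ext)
  then show "F_pure R H A (fe ` x) (\<lambda>\<beta>\<in>pi0 (spanning H (fe ` x)). if \<beta> \<subseteq> fv ` verts G then a (pre \<beta>) else \<one>\<^bsub>A\<^esub>) =
      F_pure R H A (fe ` x) (push G f H ?\<phi> A x a)" by (rule arg_cong)
qed

lemma digraph_id_image: "x \<subseteq> arcs H \<Longrightarrow> snd (digraph_id H) ` x = x"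
  by (auto simp: subset_iff)

text \<open>For the identity inclusion every component lies in the image and is its own preimage, so
  no unit is inserted.\<close>

lemma push_id:
  assumes "x \<subseteq> arcs H"
  shows "push H (digraph_id H) H \<phi> B x a = (\<lambda>\<alpha>\<in>pi0 (spanning H x). \<phi> (a \<alpha>))"
  unfolding push_def digraph_id_image[OF assms]
proof (rule restrict_ext)
  fix \<beta> assume "\<beta> \<in> pi0 (spanning H x)"
  then have "\<beta> \<subseteq> verts H" by (rule pi0_subset)
  then have "{v \<in> verts H. fst (digraph_id H) v \<in> \<beta>} = \<beta>" "\<beta> \<subseteq> fst (digraph_id H) ` verts H"
    by (auto simp: subset_iff)
  then show "(if \<beta> \<subseteq> fst (digraph_id H) ` verts H then \<phi> (a {v \<in> verts H. fst (digraph_id H) v \<in> \<beta>})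
      else \<one>\<^bsub>B\<^esub>) = \<phi> (a \<beta>)" by simp
qed

lemma sigma_eq_transport:
  "x \<in> multipaths H \<Longrightarrow> sigma R H A \<phi> B x = transport R H (digraph_id H) H A \<phi> B x"
  unfolding sigma_def transport_def
  by (simp only: push_id digraph_id_image multipath_subset_arcs)

lemma inclusion_map_eq:
  assumes "digraph_algebra_map R A G A H f (\<lambda>a\<in>carrier A. a)"
  shows "transport_homology R G f H A (\<lambda>a\<in>carrier A. a) A k = inclusion_map R A G f H k"
proof -
  interpret digraph_algebra_map R A G A H f "\<lambda>a\<in>carrier A. a" by fact
  show ?thesis unfolding inclusion_map_def
    by (rule homology_map_cong[OF transformation poset_transformation_cong[OF transformation]])
      (simp_all add: tau_eq_transport[OF assms])
qed

lemma algebra_map_eq: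
  assumes "digraph_algebra_map R A H B H (digraph_id H) \<phi>"
  shows "transport_homology R H (digraph_id H) H A \<phi> B k = algebra_map R H A \<phi> B k"
proof -
  interpret digraph_algebra_map R A H B H "digraph_id H" \<phi> by fact
  have id: "snd (digraph_id H) ` x = x" if "x \<in> multipaths H" for x
    by (rule digraph_id_image[OF multipath_subset_arcs[OF that]])
  show ?thesis unfolding algebra_map_def
    by (rule homology_map_cong[OF transformation poset_transformation_cong[OF transformation]])
      (simp_all only: id sigma_eq_transport)
qed

section \<open>Functoriality of transport\<close>

lemma transport_homology_ident:
  assumes "digraph_algebra_map R A H A H (digraph_id H) (\<lambda>a\<in>carrier A. a)"
  shows "transport_homology R H (digraph_id H) H A (\<lambda>a\<in>carrier A. a) A k =
    (\<lambda>X\<in>carrier (path_homology R H A k). X)"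
proof -
  interpret digraph_algebra_map R A H A H "digraph_id H" "\<lambda>a\<in>carrier A. a" by fact
  have "\<rho> x v = v" if x: "x \<in> multipaths H" and v: "v \<in> carrier (F_obj R H A x)" for x v
  proof -
    have sub: "x \<subseteq> arcs H" by (rule multipath_subset_arcs[OF x])
    have lin: "\<rho> x \<in> linear_maps R (F_obj R H A x) (F_obj R H A x)"
      using transport_linear[OF sub] unfolding digraph_id_image[OF sub] .
    have "\<rho> x = (\<lambda>v\<in>carrier (F_obj R H A x). v)"
    proof (rule D.F_map_eqI[OF D.module_F lin linear_maps_ident[OF D.module_F]])
      fix a assume a: "a \<in> D.families H x"
      have "push H (digraph_id H) H (\<lambda>a\<in>carrier A. a) A x a = restrict a (pi0 (spanning H x))"
        unfolding push_id[OF sub] by (rule restrict_ext) (simp add: PiE_mem[OF a])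
      also have "\<dots> = a" using a by (rule PiE_restrict)
      finally have "\<rho> x (F_pure R H A x a) = F_pure R H A x a"
        using transport_pure[OF sub a] unfolding digraph_id_image[OF sub] by simp
      then show "\<rho> x (F_pure R H A x a) = (\<lambda>v\<in>carrier (F_obj R H A x). v) (F_pure R H A x a)"
        using D.F_pure_closed[OF a] by simp
    qed
    with v show ?thesis by simp
  qed
  then show ?thesis unfolding path_homology_def
    by (intro homology_map_ident[OF transformation] digraph_id_image multipath_subset_arcs)
qed

text \<open>Components of the last digraph are of three kinds. Images under both inclusions carry
  the composite of \<phi> and \<psi>. Images under g of components outside the image of f carry
  \<open>\<psi> \<one>\<close>, which is 1 as \<psi> preserves units. Components outside the image
  of g carry 1 directly.\<close>

lemma push_compose:
  assumes "digraph_algebra_map R A H1 B H2 f \<phi>" "digraph_algebra_map R B H2 C H3 g \<psi>"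
    "digraph_algebra_map R A H1 C H3 (digraph_comp H1 g f) (compose (carrier A) \<psi> \<phi>)"
    and x: "x \<subseteq> arcs H1" and a: "a \<in> (\<Pi>\<^sub>E \<alpha>\<in>pi0 (spanning H1 x). carrier A)"
  shows "push H1 (digraph_comp H1 g f) H3 (compose (carrier A) \<psi> \<phi>) C x a =
    push H2 g H3 \<psi> C (snd f ` x) (push H1 f H2 \<phi> B x a)"
proof
  interpret f: digraph_algebra_map R A H1 B H2 f \<phi> by fact
  interpret g: digraph_algebra_map R B H2 C H3 g \<psi> by fact
  interpret h: digraph_algebra_map R A H1 C H3 "digraph_comp H1 g f" "compose (carrier A) \<psi> \<phi>" by fact
  fix \<gamma>
  have fx: "snd f ` x \<subseteq> arcs H2" using x f.fe_closed by auto
  have hx: "snd (digraph_comp H1 g f) ` x = snd g ` snd f ` x"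
    using x by (auto simp: compose_eq image_image subset_iff cong: image_cong)
  have hV: "fst (digraph_comp H1 g f) ` V = fst g ` fst f ` V" if "V \<subseteq> verts H1" for V
    using that by (auto simp: compose_eq image_image subset_iff cong: image_cong)
  show "push H1 (digraph_comp H1 g f) H3 (compose (carrier A) \<psi> \<phi>) C x a \<gamma> =
    push H2 g H3 \<psi> C (snd f ` x) (push H1 f H2 \<phi> B x a) \<gamma>"
  proof (cases "\<gamma> \<in> pi0 (spanning H3 (snd g ` snd f ` x))")
    case False
    then show ?thesis unfolding push_def hx by (simp only: restrict_apply if_False)
  next
    case \<gamma>: True
    from fx \<gamma> show ?thesis
    proof (cases rule: g.pi0_image_cases)
      case (image \<beta>)
      note gb = image
      from x image(1) show ?thesis
      proof (cases rule: f.pi0_image_cases)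
        case (image \<alpha>)
        have "\<gamma> = fst (digraph_comp H1 g f) ` \<alpha>"
          using gb(2) image(2) hV[OF pi0_subset[OF image(1)]] by simp
        then show ?thesis
          using h.push_image[OF x image(1), of a] g.push_image[OF fx gb(1)] f.push_image[OF x image(1), of a]
            gb(2) image(2) PiE_mem[OF a image(1)] by (simp add: compose_eq)
      next
        case outside
        \<comment> \<open>Injectivity of g on vertices pulls a containment in the image of the
          composite back to a containment of \<beta> in the image of f.\<close>
        have "\<not> \<gamma> \<subseteq> fst (digraph_comp H1 g f) ` verts H1"
        proof
          assume "\<gamma> \<subseteq> fst (digraph_comp H1 g f) ` verts H1"
          then have "fst g ` \<beta> \<subseteq> fst g ` fst f ` verts H1" using gb(2) hV[OF order_refl] by simp
          moreover have "\<beta> \<subseteq> verts H2" "fst f ` verts H1 \<subseteq> verts H2"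
            using pi0_subset[OF gb(1)] f.fv_closed by auto
          ultimately have "b \<in> fst f ` verts H1" if "b \<in> \<beta>" for b
            using inj_on_image_mem_iff[OF g.inj_fv, of b "fst f ` verts H1"] that by blast
          then have "\<beta> \<subseteq> fst f ` verts H1" by (rule subsetI)
          with outside(1) show False ..
        qed
        then show ?thesis
          using h.push_outside[of \<gamma> x a, unfolded hx, OF \<gamma>] g.push_image[OF fx gb(1)] f.push_outside[OF gb(1) outside(1)]
            gb(2) ring_hom_one[OF g.\<phi>_hom] by simp
      qed
    next
      case outside
      have "\<not> \<gamma> \<subseteq> fst (digraph_comp H1 g f) ` verts H1"
      proof
        assume "\<gamma> \<subseteq> fst (digraph_comp H1 g f) ` verts H1"
        then have "\<gamma> \<subseteq> fst g ` fst f ` verts H1" using hV[OF order_refl] by simp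
        also have "\<dots> \<subseteq> fst g ` verts H2" using f.fv_closed by auto
        finally show False using outside(1) by simp
      qed
      then show ?thesis
        using h.push_outside[of \<gamma> x a, unfolded hx, OF \<gamma>] g.push_outside[OF \<gamma> outside(1)] by simp
    qed
  qed
qed

lemma transport_homology_compose:
  assumes "digraph_algebra_map R A H1 B H2 f \<phi>" "digraph_algebra_map R B H2 C H3 g \<psi>"
    "digraph_algebra_map R A H1 C H3 (digraph_comp H1 g f) (compose (carrier A) \<psi> \<phi>)"
  shows "transport_homology R H1 (digraph_comp H1 g f) H3 A (compose (carrier A) \<psi> \<phi>) C k =
    compose (carrier (path_homology R H1 A k))
      (transport_homology R H2 g H3 B \<psi> C k) (transport_homology R H1 f H2 A \<phi> B k)"
proof -
  interpret f: digraph_algebra_map R A H1 B H2 f \<phi> by fact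
  interpret g: digraph_algebra_map R B H2 C H3 g \<psi> by fact
  interpret h: digraph_algebra_map R A H1 C H3 "digraph_comp H1 g f" "compose (carrier A) \<psi> \<phi>" by fact
  have hx: "snd (digraph_comp H1 g f) ` x = snd g ` snd f ` x" if "x \<in> multipaths H1" for x
    using multipath_subset_arcs[OF that] by (auto simp: compose_eq image_image subset_iff cong: image_cong)
  have "h.\<rho> x v = g.\<rho> (snd f ` x) (f.\<rho> x v)" if x: "x \<in> multipaths H1" and v: "v \<in> carrier (F_obj R H1 A x)" for x v
  proof -
    have sub: "x \<subseteq> arcs H1" by (rule multipath_subset_arcs[OF x])
    have fx: "snd f ` x \<subseteq> arcs H2" using sub f.fe_closed by auto
    have "h.\<rho> x = compose (carrier (F_obj R H1 A x)) (g.\<rho> (snd f ` x)) (f.\<rho> x)"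
    proof (rule f.D.F_map_eqI[OF g.E.module_F h.transport_linear[OF sub, unfolded hx[OF x]]
          linear_maps_compose[OF f.D.module_F f.transport_linear[OF sub] g.transport_linear[OF fx]]])
      fix a assume a: "a \<in> f.D.families H1 x"
      have "h.\<rho> x (F_pure R H1 A x a) = g.\<rho> (snd f ` x) (f.\<rho> x (F_pure R H1 A x a))"
        using h.transport_pure[OF sub a, unfolded hx[OF x]] f.transport_pure[OF sub a]
          g.transport_pure[OF fx f.push_closed[OF sub a]] push_compose[OF assms sub a]
        by simp
      then show "h.\<rho> x (F_pure R H1 A x a) =
          compose (carrier (F_obj R H1 A x)) (g.\<rho> (snd f ` x)) (f.\<rho> x) (F_pure R H1 A x a)"
        using f.D.F_pure_closed[OF a] by (simp add: compose_eq)
    qed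
    with v show ?thesis by (simp add: compose_eq)
  qed
  then show ?thesis unfolding path_homology_def
    by (intro homology_map_compose[OF f.transformation g.transformation h.transformation] hx)
qed

section \<open>The bifunctor\<close>

lemma inclusions_compose:
  assumes "wf_digraph H1" "f \<in> inclusions H1 H2" "g \<in> inclusions H2 H3"
  shows "digraph_comp H1 g f \<in> inclusions H1 H3"
proof -
  interpret wf_digraph H1 by fact
  have f: "fst f \<in> verts H1 \<rightarrow>\<^sub>E verts H2" "inj_on (fst f) (verts H1)" "snd f \<in> arcs H1 \<rightarrow>\<^sub>E arcs H2"
    "inj_on (snd f) (arcs H1)" and g: "inj_on (fst g) (verts H2)" "inj_on (snd g) (arcs H2)"
    using assms(2,3) by (auto simp: inclusions_def)
  have "inj_on (compose (verts H1) (fst g) (fst f)) (verts H1)"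
    using f(1,2) g(1) by (auto simp: inj_on_def compose_eq PiE_iff)
  moreover have "inj_on (compose (arcs H1) (snd g) (snd f)) (arcs H1)"
    using f(3,4) g(2) by (auto simp: inj_on_def compose_eq PiE_iff)
  ultimately show ?thesis
    using assms(2,3) by (auto simp: inclusions_def compose_eq PiE_iff)
qed

text \<open>Identity arrows are restricted functions; this lemma and the next give the neutrality
  laws for them, on extensional maps.\<close>

lemma compose_restrict_ident:
  "f \<in> extensional A \<Longrightarrow> compose A f (\<lambda>x\<in>A. x) = f"
  by (auto simp: compose_def extensional_def fun_eq_iff)

lemma restrict_ident_compose:
  "\<lbrakk>f \<in> extensional A; \<And>x. x \<in> A \<Longrightarrow> f x \<in> B\<rbrakk> \<Longrightarrow> compose A (\<lambda>x\<in>B. x) f = f"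
  by (auto simp: compose_def extensional_def fun_eq_iff)

section \<open>The categories and their product\<close>

lemma category_DirGr: "category (DirGr :: (('v, 'e) pre_digraph, ('v, 'e) inclusion_arrow) category)"
proof
  fix f g h :: "('v, 'e) inclusion_arrow"
  assume "f \<in> Arr DirGr" "g \<in> Arr DirGr" "h \<in> Arr DirGr"
    "Cod DirGr f = Dom DirGr g" "Cod DirGr g = Dom DirGr h"
  then show "Comp DirGr h (Comp DirGr g f) = Comp DirGr (Comp DirGr h g) f"
    by (auto simp: DirGr_def inclusions_def intro!: compose_assoc)
next
  fix f g :: "('v, 'e) inclusion_arrow"
  assume "f \<in> Arr DirGr" "g \<in> Arr DirGr" "Cod DirGr f = Dom DirGr g"
  then show "Comp DirGr g f \<in> Arr DirGr"
    using inclusions_compose fin_digraph.axioms(1) by (fastforce simp: DirGr_def)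
qed (auto simp: DirGr_def inclusions_def compose_restrict_ident restrict_ident_compose PiE_iff inj_on_def
    fin_digraph.axioms(1)[THEN wf_digraph.tail_in_verts] fin_digraph.axioms(1)[THEN wf_digraph.head_in_verts])

lemma ring_hom_compose_restrict:
  assumes "\<phi> \<in> ring_hom A B" "\<psi> \<in> ring_hom B C" "ring A"
  shows "compose (carrier A) \<psi> \<phi> \<in> ring_hom A C"
proof -
  interpret ring A by fact
  show ?thesis
    using assms(1,2) by (auto simp: ring_hom_def compose_eq Pi_iff)
qed

lemma linear_maps_funcset: "f \<in> linear_maps R M N \<Longrightarrow> f \<in> carrier M \<rightarrow> carrier N"
  using linear_maps_closed[of f R M N] by (intro Pi_I)

lemma category_Alg:
  fixes R :: "('r, 'z) ring_scheme"
  shows "category (Alg R :: (('r, 'a) module, ('r, 'a) algebra_arrow) category)"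
proof
  fix f g h :: "('r, 'a) algebra_arrow"
  assume "f \<in> Arr (Alg R)" "g \<in> Arr (Alg R)" "h \<in> Arr (Alg R)"
    "Cod (Alg R) f = Dom (Alg R) g" "Cod (Alg R) g = Dom (Alg R) h"
  then show "Comp (Alg R) h (Comp (Alg R) g f) = Comp (Alg R) (Comp (Alg R) h g) f"
    by (auto simp: Alg_def intro!: compose_assoc[OF linear_maps_funcset])
next
  fix f g :: "('r, 'a) algebra_arrow"
  assume "f \<in> Arr (Alg R)" "g \<in> Arr (Alg R)" "Cod (Alg R) f = Dom (Alg R) g"
  then show "Comp (Alg R) g f \<in> Arr (Alg R)"
    by (auto simp: Alg_def unital_algebra_def intro!: ring_hom_compose_restrict linear_maps_compose)
next
  fix A :: "('r, 'a) module"
  assume "A \<in> Obj (Alg R)"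
  then have A: "unital_algebra R A" by (simp add: Alg_def)
  then interpret unital_algebra R A .
  have "(\<lambda>a\<in>carrier A. a) \<in> ring_hom A A" by (auto simp: ring_hom_def)
  then show "Ide (Alg R) A \<in> Arr (Alg R)"
    using A linear_maps_ident[OF module_axioms] by (simp add: Alg_def)
qed (auto simp: Alg_def linear_maps_closed linear_maps_extensional
    intro!: compose_restrict_ident restrict_ident_compose)

lemma category_GrMod:
  fixes R :: "('r, 'z) ring_scheme"
  shows "category (GrMod R :: (int \<Rightarrow> ('r, 'm) module, ('r, 'm) graded_arrow) category)"
proof
  fix f g h :: "('r, 'm) graded_arrow"
  assume "f \<in> Arr (GrMod R)" "g \<in> Arr (GrMod R)" "h \<in> Arr (GrMod R)"
    "Cod (GrMod R) f = Dom (GrMod R) g" "Cod (GrMod R) g = Dom (GrMod R) h"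
  then show "Comp (GrMod R) h (Comp (GrMod R) g f) = Comp (GrMod R) (Comp (GrMod R) h g) f"
    by (auto simp: GrMod_def fun_eq_iff[where 'a = int] intro!: compose_assoc[OF linear_maps_funcset])
next
  fix f g :: "('r, 'm) graded_arrow"
  assume "f \<in> Arr (GrMod R)" "g \<in> Arr (GrMod R)" "Cod (GrMod R) f = Dom (GrMod R) g"
  then show "Comp (GrMod R) g f \<in> Arr (GrMod R)"
    by (auto simp: GrMod_def intro!: linear_maps_compose)
next
  fix a :: "('r, 'm) graded_arrow"
  assume "a \<in> Arr (GrMod R)"
  then obtain M f N where a: "a = (M, f, N)" and f: "f k \<in> linear_maps R (M k) (N k)" for k
    by (cases a) (auto simp: GrMod_def)
  show "Comp (GrMod R) a (Ide (GrMod R) (Dom (GrMod R) a)) = a"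
    by (simp add: a GrMod_def compose_restrict_ident[OF linear_maps_extensional[OF f]])
  show "Comp (GrMod R) (Ide (GrMod R) (Cod (GrMod R) a)) a = a"
    by (simp add: a GrMod_def restrict_ident_compose[OF linear_maps_extensional[OF f] linear_maps_closed[OF f]])
qed (auto simp: GrMod_def linear_maps_ident)

lemma category_product:
  assumes "category C" "category D"
  shows "category (product_category C D)"
proof -
  interpret C: category C by fact
  interpret D: category D by fact
  show ?thesis
    by (rule category.intro)
      (auto simp: product_category_def C.Dom_in_Obj C.Cod_in_Obj C.Ide_in_Arr C.Dom_Ide C.Cod_Ide C.Comp_in_Arr
        C.Dom_Comp C.Cod_Comp C.Comp_Ide_right C.Comp_Ide_left C.Comp_assoc
        D.Dom_in_Obj D.Cod_in_Obj D.Ide_in_Arr D.Dom_Ide D.Cod_Ide D.Comp_in_Arr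
        D.Dom_Comp D.Cod_Comp D.Comp_Ide_right D.Comp_Ide_left D.Comp_assoc)
qed

section \<open>The functor on the product category\<close>

definition transport_arrow ::
  "('r, 'z) ring_scheme \<Rightarrow> ('v, 'e) inclusion_arrow \<times> ('r, 'a) algebra_arrow
    \<Rightarrow> ('r, ('v, 'e, 'a, 'r) homology_class) graded_arrow"
  where "transport_arrow R = (\<lambda>((G, f, H), (A, \<phi>, B)).
    (path_homology R G A, transport_homology R G f H A \<phi> B, path_homology R H B))"

lemma arrow_digraph_algebra_map:
  assumes "(G, f, H) \<in> Arr DirGr" "(A, \<phi>, B) \<in> Arr (Alg R)"
  shows "digraph_algebra_map R A G B H f \<phi>"
  using assms
  by (auto simp: DirGr_def Alg_def intro!: digraph_algebra_map.intro digraph_algebra_map_axioms.intro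
      digraph_coefficients.intro coefficients.intro)

lemma module_path_homology:
  assumes "fin_digraph H" "unital_algebra R A"
  shows "Module.module R (path_homology R H A k)"
proof -
  interpret digraph_coefficients R A H
    by (intro digraph_coefficients.intro coefficients.intro assms)
  show ?thesis unfolding path_homology_def by (rule poset_functor.module_homology[OF poset_functor_F])
qed

lemma transport_homology_linear:
  assumes "digraph_algebra_map R A G B H f \<phi>"
  shows "transport_homology R G f H A \<phi> B k \<in> linear_maps R (path_homology R G A k) (path_homology R H B k)"
  unfolding path_homology_def
  by (rule poset_transformation.homology_map_linear[OF digraph_algebra_map.transformation[OF assms]])

lemma transport_arrow_functor:
  fixes R :: "('r, 'z) ring_scheme"
  shows "covariant_functor
    (product_category (DirGr :: (('v, 'e) pre_digraph, ('v, 'e) inclusion_arrow) category)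
      (Alg R :: (('r, 'a) module, ('r, 'a) algebra_arrow) category))
    (GrMod R) (\<lambda>(H, A). path_homology R H A) (transport_arrow R)"
proof (intro covariant_functor.intro covariant_functor_axioms.intro category_product category_DirGr category_Alg
    category_GrMod)
  let ?C = "product_category (DirGr :: (('v, 'e) pre_digraph, ('v, 'e) inclusion_arrow) category)
      (Alg R :: (('r, 'a) module, ('r, 'a) algebra_arrow) category)"
  let ?Fo = "\<lambda>(H :: ('v, 'e) pre_digraph, A :: ('r, 'a) module). path_homology R H A"
  {
    fix x assume "x \<in> Obj ?C"
    then obtain H A where x: "x = (H, A)" "fin_digraph H" "unital_algebra R A"
      by (auto simp: product_category_def DirGr_def Alg_def)
    then show "?Fo x \<in> Obj (GrMod R)"
      by (simp add: GrMod_def module_path_homology)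
    have "(H, digraph_id H, H) \<in> Arr DirGr" "(A, \<lambda>a\<in>carrier A. a, A) \<in> Arr (Alg R)"
      using category.Ide_in_Arr[OF category_DirGr, of H] category.Ide_in_Arr[OF category_Alg, of A R] x
      by (simp_all add: DirGr_def Alg_def)
    then have "digraph_algebra_map R A H A H (digraph_id H) (\<lambda>a\<in>carrier A. a)"
      by (rule arrow_digraph_algebra_map)
    from transport_homology_ident[OF this] show "transport_arrow R (Ide ?C x) = Ide (GrMod R) (?Fo x)"
      by (simp add: x product_category_def DirGr_def Alg_def GrMod_def transport_arrow_def fun_eq_iff[where 'a = int])
  next
    fix a assume "a \<in> Arr ?C"
    then obtain G f H A \<phi> B where a: "a = ((G, f, H), (A, \<phi>, B))"
      "(G, f, H) \<in> Arr DirGr" "(A, \<phi>, B) \<in> Arr (Alg R)"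
      by (cases a) (auto simp: product_category_def)
    have "fin_digraph G" "fin_digraph H" "unital_algebra R A" "unital_algebra R B"
      using a by (auto simp: DirGr_def Alg_def)
    then show "transport_arrow R a \<in> Arr (GrMod R)"
      using transport_homology_linear[OF arrow_digraph_algebra_map[OF a(2,3)]]
      by (simp add: a GrMod_def transport_arrow_def module_path_homology)
    show "Dom (GrMod R) (transport_arrow R a) = ?Fo (Dom ?C a)" "Cod (GrMod R) (transport_arrow R a) = ?Fo (Cod ?C a)"
      by (simp_all add: a(1) GrMod_def transport_arrow_def product_category_def DirGr_def Alg_def)
    fix b assume "b \<in> Arr ?C" "Cod ?C a = Dom ?C b"
    then obtain g K \<psi> C where b: "b = ((H, g, K), (B, \<psi>, C))"
      "(H, g, K) \<in> Arr DirGr" "(B, \<psi>, C) \<in> Arr (Alg R)"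
      by (cases b) (auto simp: product_category_def a(1) DirGr_def Alg_def)
    have comp: "Comp DirGr (H, g, K) (G, f, H) = (G, digraph_comp G g f, K)"
        "Comp (Alg R) (B, \<psi>, C) (A, \<phi>, B) = (A, compose (carrier A) \<psi> \<phi>, C)"
      by (simp_all add: DirGr_def Alg_def case_prod_beta)
    have "(G, digraph_comp G g f, K) \<in> Arr DirGr" "(A, compose (carrier A) \<psi> \<phi>, C) \<in> Arr (Alg R)"
      using category.Comp_in_Arr[OF category_DirGr a(2) b(2)] category.Comp_in_Arr[OF category_Alg a(3) b(3)]
      unfolding comp by (simp_all add: DirGr_def Alg_def)
    then have "digraph_algebra_map R A G C K (digraph_comp G g f) (compose (carrier A) \<psi> \<phi>)"
      by (rule arrow_digraph_algebra_map)
    from transport_homology_compose[OF arrow_digraph_algebra_map[OF a(2,3)] arrow_digraph_algebra_map[OF b(2,3)] this]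
    show "transport_arrow R (Comp ?C b a) = Comp (GrMod R) (transport_arrow R b) (transport_arrow R a)"
      by (simp add: a(1) b(1) product_category_def comp transport_arrow_def GrMod_def fun_eq_iff[where 'a = int])
  }
qed

theorem theorem2:
  fixes R :: "('r, 'z) ring_scheme"
  assumes "cring R"
  shows "bifunctor
    (DirGr :: (('v, 'e) pre_digraph, ('v, 'e) inclusion_arrow) category)
    (Alg R :: (('r, 'a) module, ('r, 'a) algebra_arrow) category)
    (GrMod R)
    (path_homology R) (inclusion_arrow R) (algebra_arrow R)"
  unfolding bifunctor_def
\<comment> \<open>With functoriality settled, what remains is to recognise the two prescribed
  families of maps as the values at pairs with one identity entry, by
  \<open>inclusion_map_eq\<close> and \<open>algebra_map_eq\<close>.\<close>
proof (intro exI[of _ "transport_arrow R"] conjI ballI transport_arrow_functor)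
  fix a :: "('v, 'e) inclusion_arrow" and A :: "('r, 'a) module"
  assume "a \<in> Arr DirGr" and A: "A \<in> Obj (Alg R)"
  then obtain G f H where a: "a = (G, f, H)" "(G, f, H) \<in> Arr DirGr" by (cases a) auto
  have "(A, \<lambda>a\<in>carrier A. a, A) \<in> Arr (Alg R)"
    using category.Ide_in_Arr[OF category_Alg A] by (simp add: Alg_def)
  from inclusion_map_eq[OF arrow_digraph_algebra_map[OF a(2) this]]
  show "transport_arrow R (a, Ide (Alg R) A) = inclusion_arrow R a A"
    by (simp add: a(1) transport_arrow_def inclusion_arrow_def Alg_def fun_eq_iff[where 'a = int])
next
  fix H :: "('v, 'e) pre_digraph" and b :: "('r, 'a) algebra_arrow"
  assume H: "H \<in> Obj DirGr" and "b \<in> Arr (Alg R)"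
  then obtain A \<phi> B where b: "b = (A, \<phi>, B)" "(A, \<phi>, B) \<in> Arr (Alg R)" by (cases b) auto
  have "(H, digraph_id H, H) \<in> Arr DirGr"
    using category.Ide_in_Arr[OF category_DirGr H] by (simp add: DirGr_def)
  from algebra_map_eq[OF arrow_digraph_algebra_map[OF this b(2)]]
  show "transport_arrow R (Ide DirGr H, b) = algebra_arrow R H b"
    by (simp add: b(1) transport_arrow_def algebra_arrow_def DirGr_def fun_eq_iff[where 'a = int])
qed

end
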